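(* Consider the fixed-proportion model with $n_1=n_1(n)$ non-nulls, $n_1/n\to\pi_1$ as $n\to\infty$, and let $\mathsf{FNR}^*_n(\alpha)$ be the infimum of $\mathrm{FNR}(\delta^n)$ over all decision rules with $\mathrm{FDR}(\delta^n)\le\alpha$ in this model. For every $\alpha\in[0,1]$ the limit $\lim_{n\to\infty}\mathsf{FNR}^*_n(\alpha)$ exists and equals $b^{**}(\alpha)$, where $b^{**}$ is the greatest convex minorant on $[0,1]$ of the function $b^*$.
   Context: Let $\pi_0,\pi_1\in(0,1)$ with $\pi_0+\pi_1=1$, and let $f_0,f_1$ be probability densities on a sample space $\mathcal X$ (with respect to a common dominating measure), $f=\pi_0f_0+\pi_1f_1$. Fixed-proportion model: $\theta^n=(\theta_1,\dots,\theta_n)$ is uniformly distributed on $\{\theta^n\in\{0,1\}^n:\sum_i\theta_i=n_1\}$, where $n_1=n_1(n)$ is deterministic with $n_1/n\to\pi_1$; given $\theta^n$, the observations $X_1,\dots,X_n$ are independent with $X_i\sim f_{\theta_i}$. A (possibly randomized) decision rule $\delta^n=(\delta_1,\dots,\delta_n)$ is given by a Markov kernel from $\mathcal X^n$ to $\{0,1\}^n$ applied to $X^n$ (so $\delta^n$ is conditionally independent of $\theta^n$ given $X^n$). $\mathrm{FDR}(\delta^n)=\mathbb E\Big[\frac{\sum_i\delta_i(1-\theta_i)}{1\vee\sum_i\delta_i}\Big]$, $\mathrm{FNR}(\delta^n)=\mathbb E\Big[\frac{\sum_i(1-\delta_i)\theta_i}{1\vee\sum_i(1-\delta_i)}\Big]$.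 Functions $a,b,b^*,b^{**}$: let $W=\pi_0f_0(X)/f(X)$ with $X\sim f$, $G(t)=\mathbb P(W\le t)$, $G^{-1}(u)=\inf\{t\in[0,1]:G(t)\ge u\}$ for $u\in[0,1]$. For $u\in[0,1]$ choose $p(u)\in[0,1]$ with $\mathbb P(W<G^{-1}(u))+p(u)\mathbb P(W=G^{-1}(u))=u$. Let $S_u=1$ if $W<G^{-1}(u)$, $S_u\sim\mathrm{Bern}(p(u))$ (independent coin) if $W=G^{-1}(u)$, $S_u=0$ if $W>G^{-1}(u)$; then $S_u\sim\mathrm{Bern}(u)$. Set $a(u)=\mathbb E[W\mid S_u=1]$ for $u\in(0,1]$, $a(0)=0$; $b(u)=\mathbb E[1-W\mid S_u=0]$ for $u\in[0,1)$, $b(1)=0$. For $\alpha\in[0,1]$, $b^*(\alpha)=\inf\{b(u):u\in[0,1],\ a(u)\le\alpha\}$ and $b^{**}(\alpha)=\inf\{\mathbb E[b(U)]:\mathbb E[a(U)]\le\alpha\}$, the infimum over all random variables $U$ supported on $[0,1]$. The greatest convex minorant of $h:[0,1]\to\mathbb R$ is the pointwise supremum of all convex functions $C$ on $[0,1]$ with $C\le h$. *)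

theory Defs
  imports "HOL-Probability.Probability"
begin

definition is_prob_density :: "'a measure \<Rightarrow> ('a \<Rightarrow> real) \<Rightarrow> bool" where
  "is_prob_density M g \<longleftrightarrow>
     g \<in> borel_measurable M \<and> (\<forall>x\<in>space M. 0 \<le> g x) \<and> (\<integral>\<^sup>+x. ennreal (g x) \<partial>M) = 1"

definition mixture :: "('a \<Rightarrow> real) \<Rightarrow> ('a \<Rightarrow> real) \<Rightarrow> real \<Rightarrow> real \<Rightarrow> 'a \<Rightarrow> real" where
  "mixture f0 f1 \<pi>0 \<pi>1 x = \<pi>0 * f0 x + \<pi>1 * f1 x"

definition binary_vectors :: "nat \<Rightarrow> (nat \<Rightarrow> nat) set" where
  "binary_vectors n = ({..<n} \<rightarrow>\<^sub>E {0, 1})"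

text \<open>Uniform only for \<open>k \<le> n\<close>; otherwise the set is empty.\<close>
definition fixed_proportion_prior :: "nat \<Rightarrow> nat \<Rightarrow> (nat \<Rightarrow> nat) pmf" where
  "fixed_proportion_prior n k =
     pmf_of_set {\<theta> \<in> binary_vectors n. (\<Sum>i<n. \<theta> i) = k}"

definition observation_law ::
  "'a measure \<Rightarrow> ('a \<Rightarrow> real) \<Rightarrow> ('a \<Rightarrow> real) \<Rightarrow> nat \<Rightarrow> (nat \<Rightarrow> nat) \<Rightarrow> (nat \<Rightarrow> 'a) measure" where
  "observation_law M f0 f1 n \<theta> =
     PiM {..<n} (\<lambda>i. density M (\<lambda>x. ennreal (if \<theta> i = 0 then f0 x else f1 x)))"

definition decision_rules ::
  "'a measure \<Rightarrow> nat \<Rightarrow> ((nat \<Rightarrow> 'a) \<Rightarrow> (nat \<Rightarrow> nat) measure) set" where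
  "decision_rules M n =
     (PiM {..<n} (\<lambda>_. M)) \<rightarrow>\<^sub>M prob_algebra (count_space (binary_vectors n))"

text \<open>The joint law of \<open>(\<theta>, \<delta>)\<close>, with the observations integrated out. Since \<open>\<kappa>\<close> sees
  only the observations, \<open>\<delta>\<close> is conditionally independent of \<open>\<theta>\<close> given them.\<close>
definition joint_law ::
  "'a measure \<Rightarrow> ('a \<Rightarrow> real) \<Rightarrow> ('a \<Rightarrow> real) \<Rightarrow> nat \<Rightarrow> nat
   \<Rightarrow> ((nat \<Rightarrow> 'a) \<Rightarrow> (nat \<Rightarrow> nat) measure) \<Rightarrow> ((nat \<Rightarrow> nat) \<times> (nat \<Rightarrow> nat)) measure" where
  "joint_law M f0 f1 n k \<kappa> =
     measure_pmf (fixed_proportion_prior n k) \<bind> (\<lambda>\<theta>.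
       observation_law M f0 f1 n \<theta> \<bind> (\<lambda>x.
         \<kappa> x \<bind> (\<lambda>\<delta>. return (count_space UNIV) (\<theta>, \<delta>))))"

definition FDR ::
  "'a measure \<Rightarrow> ('a \<Rightarrow> real) \<Rightarrow> ('a \<Rightarrow> real) \<Rightarrow> nat \<Rightarrow> nat
   \<Rightarrow> ((nat \<Rightarrow> 'a) \<Rightarrow> (nat \<Rightarrow> nat) measure) \<Rightarrow> real" where
  "FDR M f0 f1 n k \<kappa> =
     (\<integral>(\<theta>, \<delta>). (\<Sum>i<n. real (\<delta> i) * (1 - real (\<theta> i))) / max 1 (\<Sum>i<n. real (\<delta> i))
        \<partial>joint_law M f0 f1 n k \<kappa>)"

definition FNR ::
  "'a measure \<Rightarrow> ('a \<Rightarrow> real) \<Rightarrow> ('a \<Rightarrow> real) \<Rightarrow> nat \<Rightarrow> nat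
   \<Rightarrow> ((nat \<Rightarrow> 'a) \<Rightarrow> (nat \<Rightarrow> nat) measure) \<Rightarrow> real" where
  "FNR M f0 f1 n k \<kappa> =
     (\<integral>(\<theta>, \<delta>). (\<Sum>i<n. (1 - real (\<delta> i)) * real (\<theta> i)) / max 1 (\<Sum>i<n. 1 - real (\<delta> i))
        \<partial>joint_law M f0 f1 n k \<kappa>)"

definition FNR_opt ::
  "'a measure \<Rightarrow> ('a \<Rightarrow> real) \<Rightarrow> ('a \<Rightarrow> real) \<Rightarrow> nat \<Rightarrow> nat \<Rightarrow> real \<Rightarrow> real" where
  "FNR_opt M f0 f1 n k \<alpha> =
     (INF \<kappa>\<in>{\<kappa> \<in> decision_rules M n. FDR M f0 f1 n k \<kappa> \<le> \<alpha>}. FNR M f0 f1 n k \<kappa>)"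

definition mixture_law ::
  "'a measure \<Rightarrow> ('a \<Rightarrow> real) \<Rightarrow> ('a \<Rightarrow> real) \<Rightarrow> real \<Rightarrow> real \<Rightarrow> 'a measure" where
  "mixture_law M f0 f1 \<pi>0 \<pi>1 = density M (\<lambda>x. ennreal (mixture f0 f1 \<pi>0 \<pi>1 x))"

text \<open>Equal to 0 where the mixture density vanishes, which is a null set for its law.\<close>
definition lfdr :: "('a \<Rightarrow> real) \<Rightarrow> ('a \<Rightarrow> real) \<Rightarrow> real \<Rightarrow> real \<Rightarrow> 'a \<Rightarrow> real" where
  "lfdr f0 f1 \<pi>0 \<pi>1 x = \<pi>0 * f0 x / mixture f0 f1 \<pi>0 \<pi>1 x"

definition lfdr_cdf ::
  "'a measure \<Rightarrow> ('a \<Rightarrow> real) \<Rightarrow> ('a \<Rightarrow> real) \<Rightarrow> real \<Rightarrow> real \<Rightarrow> real \<Rightarrow> real" where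
  "lfdr_cdf M f0 f1 \<pi>0 \<pi>1 t =
     measure (mixture_law M f0 f1 \<pi>0 \<pi>1) {x \<in> space M. lfdr f0 f1 \<pi>0 \<pi>1 x \<le> t}"

definition lfdr_quantile ::
  "'a measure \<Rightarrow> ('a \<Rightarrow> real) \<Rightarrow> ('a \<Rightarrow> real) \<Rightarrow> real \<Rightarrow> real \<Rightarrow> real \<Rightarrow> real" where
  "lfdr_quantile M f0 f1 \<pi>0 \<pi>1 u = Inf {t \<in> {0..1}. lfdr_cdf M f0 f1 \<pi>0 \<pi>1 t \<ge> u}"

definition is_tie_breaker ::
  "'a measure \<Rightarrow> ('a \<Rightarrow> real) \<Rightarrow> ('a \<Rightarrow> real) \<Rightarrow> real \<Rightarrow> real \<Rightarrow> (real \<Rightarrow> real) \<Rightarrow> bool" where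
  "is_tie_breaker M f0 f1 \<pi>0 \<pi>1 p \<longleftrightarrow>
     (\<forall>u\<in>{0..1}. p u \<in> {0..1} \<and>
        measure (mixture_law M f0 f1 \<pi>0 \<pi>1)
          {x \<in> space M. lfdr f0 f1 \<pi>0 \<pi>1 x < lfdr_quantile M f0 f1 \<pi>0 \<pi>1 u}
        + p u * measure (mixture_law M f0 f1 \<pi>0 \<pi>1)
          {x \<in> space M. lfdr f0 f1 \<pi>0 \<pi>1 x = lfdr_quantile M f0 f1 \<pi>0 \<pi>1 u} = u)"

text \<open>The probability space carrying an observation \<open>X \<sim> f\<close> and an independent
  \<open>p(u)\<close>-coin, and on it the event \<open>S\<^sub>u = 1\<close>.\<close>
definition coin_space ::
  "'a measure \<Rightarrow> ('a \<Rightarrow> real) \<Rightarrow> ('a \<Rightarrow> real) \<Rightarrow> real \<Rightarrow> real \<Rightarrow> (real \<Rightarrow> real) \<Rightarrow> real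
   \<Rightarrow> ('a \<times> bool) measure" where
  "coin_space M f0 f1 \<pi>0 \<pi>1 p u =
     mixture_law M f0 f1 \<pi>0 \<pi>1 \<Otimes>\<^sub>M measure_pmf (bernoulli_pmf (p u))"

definition selected ::
  "'a measure \<Rightarrow> ('a \<Rightarrow> real) \<Rightarrow> ('a \<Rightarrow> real) \<Rightarrow> real \<Rightarrow> real \<Rightarrow> real \<Rightarrow> 'a \<times> bool \<Rightarrow> bool" where
  "selected M f0 f1 \<pi>0 \<pi>1 u = (\<lambda>(x, c).
     lfdr f0 f1 \<pi>0 \<pi>1 x < lfdr_quantile M f0 f1 \<pi>0 \<pi>1 u \<or>
     lfdr f0 f1 \<pi>0 \<pi>1 x = lfdr_quantile M f0 f1 \<pi>0 \<pi>1 u \<and> c)"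

text \<open>\<open>uniform_measure P A\<close> is the conditional probability \<open>P (\<cdot> | A)\<close>.\<close>
definition a_fun ::
  "'a measure \<Rightarrow> ('a \<Rightarrow> real) \<Rightarrow> ('a \<Rightarrow> real) \<Rightarrow> real \<Rightarrow> real \<Rightarrow> (real \<Rightarrow> real) \<Rightarrow> real \<Rightarrow> real" where
  "a_fun M f0 f1 \<pi>0 \<pi>1 p u =
     (if u \<in> {0<..1} then
        (let P = coin_space M f0 f1 \<pi>0 \<pi>1 p u in
         \<integral>\<omega>. lfdr f0 f1 \<pi>0 \<pi>1 (fst \<omega>)
           \<partial>uniform_measure P {\<omega> \<in> space P. selected M f0 f1 \<pi>0 \<pi>1 u \<omega>})
      else 0)"

definition b_fun ::
  "'a measure \<Rightarrow> ('a \<Rightarrow> real) \<Rightarrow> ('a \<Rightarrow> real) \<Rightarrow> real \<Rightarrow> real \<Rightarrow> (real \<Rightarrow> real) \<Rightarrow> real \<Rightarrow> real" where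
  "b_fun M f0 f1 \<pi>0 \<pi>1 p u =
     (if u \<in> {0..<1} then
        (let P = coin_space M f0 f1 \<pi>0 \<pi>1 p u in
         \<integral>\<omega>. 1 - lfdr f0 f1 \<pi>0 \<pi>1 (fst \<omega>)
           \<partial>uniform_measure P {\<omega> \<in> space P. \<not> selected M f0 f1 \<pi>0 \<pi>1 u \<omega>})
      else 0)"

definition b_star ::
  "'a measure \<Rightarrow> ('a \<Rightarrow> real) \<Rightarrow> ('a \<Rightarrow> real) \<Rightarrow> real \<Rightarrow> real \<Rightarrow> (real \<Rightarrow> real) \<Rightarrow> real \<Rightarrow> real" where
  "b_star M f0 f1 \<pi>0 \<pi>1 p \<alpha> =
     (INF u\<in>{u \<in> {0..1}. a_fun M f0 f1 \<pi>0 \<pi>1 p u \<le> \<alpha>}. b_fun M f0 f1 \<pi>0 \<pi>1 p u)"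

text \<open>A random variable \<open>U\<close> enters only through its law \<open>N\<close>, so the infimum ranges over all
  Borel probability measures on \<open>[0, 1]\<close>.\<close>
definition b_star_star ::
  "'a measure \<Rightarrow> ('a \<Rightarrow> real) \<Rightarrow> ('a \<Rightarrow> real) \<Rightarrow> real \<Rightarrow> real \<Rightarrow> (real \<Rightarrow> real) \<Rightarrow> real \<Rightarrow> real" where
  "b_star_star M f0 f1 \<pi>0 \<pi>1 p \<alpha> =
     (INF N\<in>{N \<in> space (prob_algebra (restrict_space borel {0..1})).
              (\<integral>u. a_fun M f0 f1 \<pi>0 \<pi>1 p u \<partial>N) \<le> \<alpha>}.
        \<integral>u. b_fun M f0 f1 \<pi>0 \<pi>1 p u \<partial>N)"

text \<open>Meaningful for functions bounded below on \<open>[0, 1]\<close>, where the set of minorants is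
  nonempty.\<close>
definition greatest_convex_minorant :: "(real \<Rightarrow> real) \<Rightarrow> real \<Rightarrow> real" where
  "greatest_convex_minorant h x =
     (SUP C\<in>{C. convex_on {0..1} C \<and> (\<forall>y\<in>{0..1}. C y \<le> h y)}. C x)"

end

theory Submission
  imports Defs
begin

text \<open>
  With \<open>A u = \<integral>W S\<^sub>u\<close> one has \<open>a u = A u / u\<close> and \<open>b u = (\<pi>1 - u + A u) / (1 - u)\<close>, and by
  Neyman--Pearson \<open>A u\<close> is the least value of \<open>\<integral>W \<phi>\<close> over tests \<open>\<phi>\<close> of size \<open>u\<close>.

  Lower bound. In the i.i.d. model a rule with \<open>K = u n\<close> discoveries makes fewer than \<open>n (A u - \<eta>)\<close>
  false ones with exponentially small probability (Chernoff, with the Neyman--Pearson multiplier as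
  threshold). The fixed-proportion model is the i.i.d. model conditioned on an event of
  subexponential probability, so the bound survives. As \<open>\<Sum>\<theta> = n\<^sub>1\<close> is deterministic, false
  discoveries determine false non-discoveries, and the law of \<open>K / n\<close>, truncated near \<open>0\<close> and \<open>1\<close>,
  is asymptotically feasible in the definition of \<open>b\<^sup>*\<^sup>*\<close>; right continuity of \<open>b\<^sup>*\<^sup>*\<close>
  concludes.

  Upper bound. Applying \<open>S\<^sub>u\<close> to each observation separately has rates tending to \<open>(a u, b u)\<close>.
  The limit superior of the optimal rate is convex in the level, because rules can be mixed, and a
  supporting line shows that a convex function below \<open>b u\<close> at all levels above \<open>a u\<close> is below
  \<open>b\<^sup>*\<^sup>*\<close> on \<open>(0, 1)\<close>. The same argument identifies \<open>b\<^sup>*\<^sup>*\<close> with the convex minorant of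
  \<open>b\<^sup>*\<close>. At level \<open>0\<close> the test \<open>S\<^sub>u\<close> with \<open>u = P (W = 0)\<close> makes no false discovery.
\<close>

text \<open>The obstacle in the lower bound is that a rule may use all observations jointly, so its
  decisions need not be independent given the states. The remedy is to freeze the observations and
  the decision and to sum over the states, which in the i.i.d. model are independent given the
  observations, state 0 at coordinate i having probability \<open>W (x i)\<close>. With a multiplier
  t, a decision at coordinate i contributes to first order at most the positive part of
  \<open>t - W (x i)\<close>, whatever rule produced it. For t = \<open>q u\<close> this hinge has
  mean \<open>q u * u - A u\<close>, the Neyman-Pearson value itself. The multiplier depends on the
  number of discoveries, which has only n + 1 values, so a union bound is harmless. Conditioning
  forces exponential estimates here, whereas for the tests a mean absolute deviation suffices. The
  end points of the level need their own arguments, since a convex function on [0, 1] may jump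
  there; at level 0, moreover, a false discovery rate that is merely small is not
  admissible.\<close>

lemma PiM_density:
  fixes Q :: "'a measure" and h :: "'i \<Rightarrow> 'a \<Rightarrow> ennreal"
  assumes Q: "prob_space Q" and I: "finite I"
    and h[measurable]: "\<And>i. h i \<in> borel_measurable Q"
    and dens: "\<And>i. prob_space (density Q (h i))"
  shows "PiM I (\<lambda>i. density Q (h i)) = density (PiM I (\<lambda>_. Q)) (\<lambda>x. \<Prod>i\<in>I. h i (x i))"
proof -
  interpret Q: product_prob_space "\<lambda>_::'i. Q" I
    using Q by (simp add: product_prob_space_def product_prob_space_axioms_def
        product_sigma_finite_def prob_space_imp_sigma_finite)
  interpret D: product_prob_space "\<lambda>i. density Q (h i)" I
    using dens by (simp add: product_prob_space_def product_prob_space_axioms_def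
        product_sigma_finite_def prob_space_imp_sigma_finite)
  have [simp]: "sets (PiM I (\<lambda>i. density Q (h i))) = sets (PiM I (\<lambda>_. Q))"
    by (intro sets_PiM_cong) auto
  show ?thesis
  proof (rule D.PiM_eqI[OF I, symmetric])
    fix A assume A: "\<And>i. i \<in> I \<Longrightarrow> A i \<in> sets (density Q (h i))"
    then have A': "\<And>i. i \<in> I \<Longrightarrow> A i \<in> sets Q" by simp
    then have meas: "Pi\<^sub>E I A \<in> sets (PiM I (\<lambda>_. Q))"
      using I by (intro sets_PiM_I_finite) auto
    have "emeasure (density (PiM I (\<lambda>_. Q)) (\<lambda>x. \<Prod>i\<in>I. h i (x i))) (Pi\<^sub>E I A)
        = (\<integral>\<^sup>+x. (\<Prod>i\<in>I. h i (x i)) * indicator (Pi\<^sub>E I A) x \<partial>PiM I (\<lambda>_. Q))"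
      using meas by (intro emeasure_density) auto
    also have "\<dots> = (\<integral>\<^sup>+x. (\<Prod>i\<in>I. h i (x i) * indicator (A i) (x i)) \<partial>PiM I (\<lambda>_. Q))"
    proof (rule nn_integral_cong)
      fix x assume x: "x \<in> space (PiM I (\<lambda>_. Q))"
      then have "indicator (Pi\<^sub>E I A) x = (\<Prod>i\<in>I. indicator (A i) (x i) :: ennreal)"
        using I by (auto simp: space_PiM PiE_iff indicator_def prod_zero_iff split: if_splits)
      then show "(\<Prod>i\<in>I. h i (x i)) * indicator (Pi\<^sub>E I A) x
          = (\<Prod>i\<in>I. h i (x i) * indicator (A i) (x i))"
        by (simp add: prod.distrib)
    qed
    also have "\<dots> = (\<Prod>i\<in>I. \<integral>\<^sup>+x. h i x * indicator (A i) x \<partial>Q)"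
      using I A' by (intro Q.product_nn_integral_prod) auto
    also have "\<dots> = (\<Prod>i\<in>I. emeasure (density Q (h i)) (A i))"
      using A' by (intro prod.cong refl) (simp add: emeasure_density)
    finally show "emeasure (density (PiM I (\<lambda>_. Q)) (\<lambda>x. \<Prod>i\<in>I. h i (x i))) (Pi\<^sub>E I A)
        = (\<Prod>i\<in>I. emeasure (density Q (h i)) (A i))" .
  qed simp
qed

section \<open>Binary vectors with a prescribed sum\<close>

lemma finite_binary_vectors [simp]: "finite (binary_vectors n)"
  unfolding binary_vectors_def by (intro finite_PiE) auto

lemma binary_vectorsD: "\<delta> \<in> binary_vectors n \<Longrightarrow> i < n \<Longrightarrow> \<delta> i = 0 \<or> \<delta> i = 1"
  unfolding binary_vectors_def by (auto simp: PiE_iff)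

definition fixed_sum_vectors :: "nat \<Rightarrow> nat \<Rightarrow> (nat \<Rightarrow> nat) set" where
  "fixed_sum_vectors n k = {\<theta> \<in> binary_vectors n. (\<Sum>i<n. \<theta> i) = k}"

lemma finite_fixed_sum_vectors [simp]: "finite (fixed_sum_vectors n k)"
  unfolding fixed_sum_vectors_def by simp

lemma fixed_sum_vectorsD:
  assumes "\<theta> \<in> fixed_sum_vectors n k"
  shows "\<theta> \<in> binary_vectors n" "(\<Sum>i<n. \<theta> i) = k"
  using assms unfolding fixed_sum_vectors_def by auto

text \<open>A vector corresponds to the set of its ones; the value \<open>undefined\<close> outside
  \<open>{..<n}\<close> is forced by extensionality. The binomial coefficient later joins
  \<open>\<pi>1 ^ k * \<pi>0 ^ (n - k)\<close> to form the probability of the conditioning event in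
  the i.i.d. model.\<close>

lemma card_fixed_sum_vectors: "card (fixed_sum_vectors n k) = n choose k"
proof -
  have "bij_betw (\<lambda>S i. if i < n then of_bool (i \<in> S) else undefined)
      {S. S \<subseteq> {..<n} \<and> card S = k} (fixed_sum_vectors n k)"
  proof (rule bij_betwI[where g = "\<lambda>\<theta>. {i. i < n \<and> \<theta> i = 1}"])
    show "(\<lambda>S i. if i < n then of_bool (i \<in> S) else undefined)
        \<in> {S. S \<subseteq> {..<n} \<and> card S = k} \<rightarrow> fixed_sum_vectors n k"
    proof
      fix S assume "S \<in> {S. S \<subseteq> {..<n} \<and> card S = k}"
      then have S: "S \<subseteq> {..<n}" "card S = k" by auto
      have "(\<Sum>i<n. of_bool (i \<in> S)) = k"
        using S by (simp add: sum_of_bool_eq Int_absorb1)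
      then show "(\<lambda>i. if i < n then of_bool (i \<in> S) else undefined) \<in> fixed_sum_vectors n k"
        by (auto simp: fixed_sum_vectors_def binary_vectors_def PiE_iff extensional_def)
    qed
    show "(\<lambda>\<theta>. {i. i < n \<and> \<theta> i = 1})
        \<in> fixed_sum_vectors n k \<rightarrow> {S. S \<subseteq> {..<n} \<and> card S = k}"
    proof
      fix \<theta> assume \<theta>: "\<theta> \<in> fixed_sum_vectors n k"
      have "k = (\<Sum>i<n. \<theta> i)" using fixed_sum_vectorsD[OF \<theta>] by simp
      also have "\<dots> = (\<Sum>i<n. of_bool (\<theta> i = 1))"
        using binary_vectorsD[OF fixed_sum_vectorsD(1)[OF \<theta>]] by (intro sum.cong) auto
      also have "\<dots> = card {i. i < n \<and> \<theta> i = 1}"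
        by (simp add: sum_of_bool_eq Int_def)
      finally show "{i. i < n \<and> \<theta> i = 1} \<in> {S. S \<subseteq> {..<n} \<and> card S = k}" by auto
    qed
    show "(\<lambda>i. if i < n then of_bool (i \<in> {i. i < n \<and> y i = 1}) else undefined) = y"
      if "y \<in> fixed_sum_vectors n k" for y
      using that binary_vectorsD[OF fixed_sum_vectorsD(1)[OF that]]
      by (fastforce simp: fixed_sum_vectors_def binary_vectors_def PiE_iff extensional_def)
  qed auto
  then show ?thesis by (simp add: bij_betw_same_card[symmetric] n_subsets)
qed

lemma fixed_sum_vectors_nonempty: "k \<le> n \<Longrightarrow> fixed_sum_vectors n k \<noteq> {}"
  using card_fixed_sum_vectors[of n k] by force

section \<open>The mixture as reference measure\<close>

locale two_groups =
  fixes M :: "'a measure" and f0 f1 :: "'a \<Rightarrow> real" and \<pi>0 \<pi>1 :: real and p :: "real \<Rightarrow> real"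
  assumes \<pi>0_pos: "0 < \<pi>0" and \<pi>1_pos: "0 < \<pi>1" and \<pi>_sum: "\<pi>0 + \<pi>1 = 1"
    and f0_density: "is_prob_density M f0" and f1_density: "is_prob_density M f1"
    and tie_breaker: "is_tie_breaker M f0 f1 \<pi>0 \<pi>1 p"
begin

text \<open>The law of one observation from the mixture. Products are formed over this probability
  measure rather than over the dominating measure \<open>M\<close>, of which nothing like
  sigma-finiteness is known; both component laws have densities relative to it.\<close>

definition Q :: "'a measure" where "Q = mixture_law M f0 f1 \<pi>0 \<pi>1"

definition W :: "'a \<Rightarrow> real" where "W = lfdr f0 f1 \<pi>0 \<pi>1"

definition component :: "nat \<Rightarrow> 'a measure" where
  "component t = density M (\<lambda>x. ennreal (if t = 0 then f0 x else f1 x))"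

text \<open>The conditional probability of state \<open>t\<close> given \<open>x\<close>. By Bayes'
  formula its quotient by \<open>prior_weight t\<close> is the density of the component law relative
  to \<open>Q\<close>. Every nonzero \<open>t\<close> counts as state 1, as in
  \<open>observation_law\<close>.\<close>

definition posterior :: "nat \<Rightarrow> 'a \<Rightarrow> real" where
  "posterior t x = (if t = 0 then W x else 1 - W x)"

definition prior_weight :: "nat \<Rightarrow> real" where
  "prior_weight t = (if t = 0 then \<pi>0 else \<pi>1)"

lemma f_measurable [measurable]: "f0 \<in> borel_measurable M" "f1 \<in> borel_measurable M"
  using f0_density f1_density by (auto simp: is_prob_density_def)

lemma f_nonneg: "x \<in> space M \<Longrightarrow> 0 \<le> f0 x" "x \<in> space M \<Longrightarrow> 0 \<le> f1 x"
  using f0_density f1_density by (auto simp: is_prob_density_def)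

lemma \<pi>_less_1: "\<pi>0 < 1" "\<pi>1 < 1"
  using \<pi>0_pos \<pi>1_pos \<pi>_sum by auto

lemma mixture_measurable [measurable]: "mixture f0 f1 \<pi>0 \<pi>1 \<in> borel_measurable M"
  unfolding mixture_def by measurable

lemma mixture_nonneg: "x \<in> space M \<Longrightarrow> 0 \<le> mixture f0 f1 \<pi>0 \<pi>1 x"
  using f_nonneg[of x] \<pi>0_pos \<pi>1_pos by (simp add: mixture_def)

lemma sets_Q [measurable_cong, simp]: "sets Q = sets M"
  by (simp add: Q_def mixture_law_def)

lemma space_Q [simp]: "space Q = space M"
  by (simp add: Q_def mixture_law_def)

lemma W_measurable [measurable]: "W \<in> borel_measurable M"
  unfolding W_def lfdr_def by measurable

text \<open>Where the mixture density vanishes, so do both of its nonnegative summands. The default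
  value 0 of \<open>W\<close> is therefore harmless, and the product form of Bayes' formula holds on
  all of \<open>space M\<close>.\<close>

lemma mixture_mult_W:
  assumes "x \<in> space M"
  shows "mixture f0 f1 \<pi>0 \<pi>1 x * W x = \<pi>0 * f0 x"
    and "mixture f0 f1 \<pi>0 \<pi>1 x * (1 - W x) = \<pi>1 * f1 x"
proof -
  have "mixture f0 f1 \<pi>0 \<pi>1 x * W x = \<pi>0 * f0 x
      \<and> mixture f0 f1 \<pi>0 \<pi>1 x * (1 - W x) = \<pi>1 * f1 x"
  proof (cases "mixture f0 f1 \<pi>0 \<pi>1 x = 0")
    case True
    then have "\<pi>0 * f0 x = 0" "\<pi>1 * f1 x = 0"
      using f_nonneg[OF assms] \<pi>0_pos \<pi>1_pos
      by (simp_all add: mixture_def add_nonneg_eq_0_iff)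
    then show ?thesis using True by simp
  next
    case False
    then show ?thesis by (simp add: W_def lfdr_def mixture_def field_simps)
  qed
  then show "mixture f0 f1 \<pi>0 \<pi>1 x * W x = \<pi>0 * f0 x"
    "mixture f0 f1 \<pi>0 \<pi>1 x * (1 - W x) = \<pi>1 * f1 x" by auto
qed

lemma W_bounds:
  assumes "x \<in> space M"
  shows "0 \<le> W x" "W x \<le> 1"
proof -
  show "0 \<le> W x"
    using f_nonneg[OF assms] \<pi>0_pos mixture_nonneg[OF assms] by (simp add: W_def lfdr_def)
  have "\<pi>0 * f0 x \<le> mixture f0 f1 \<pi>0 \<pi>1 x"
    using f_nonneg[OF assms] \<pi>1_pos by (simp add: mixture_def)
  then show "W x \<le> 1"
    using mixture_nonneg[OF assms] by (auto simp: W_def lfdr_def divide_le_eq_1)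
qed

lemma posterior_measurable [measurable]: "posterior t \<in> borel_measurable M"
  unfolding posterior_def by measurable

lemma posterior_nonneg: "x \<in> space M \<Longrightarrow> 0 \<le> posterior t x"
  using W_bounds[of x] by (simp add: posterior_def)

lemma prior_weight_pos: "0 < prior_weight t"
  using \<pi>0_pos \<pi>1_pos by (simp add: prior_weight_def)

lemma component_eq_density:
  "component t = density Q (\<lambda>x. ennreal (posterior t x / prior_weight t))"
proof -
  have "density Q (\<lambda>x. ennreal (posterior t x / prior_weight t))
     = density M (\<lambda>x. ennreal (mixture f0 f1 \<pi>0 \<pi>1 x) * ennreal (posterior t x / prior_weight t))"
    unfolding Q_def mixture_law_def by (rule density_density_eq) measurable
  also have "\<dots> = component t"
    unfolding component_def
  proof (rule density_cong; measurable?; intro AE_I2)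
    fix x assume x: "x \<in> space M"
    have "mixture f0 f1 \<pi>0 \<pi>1 x * (posterior t x / prior_weight t)
        = (if t = 0 then f0 x else f1 x)"
      using mixture_mult_W[OF x] \<pi>0_pos \<pi>1_pos by (simp add: posterior_def prior_weight_def)
    then show "ennreal (mixture f0 f1 \<pi>0 \<pi>1 x) * ennreal (posterior t x / prior_weight t)
        = ennreal (if t = 0 then f0 x else f1 x)"
      using ennreal_mult'[OF mixture_nonneg[OF x], symmetric] by simp
  qed
  finally show ?thesis ..
qed

lemma prob_space_component: "prob_space (component t)"
proof
  have "emeasure (component t) (space (component t))
      = (\<integral>\<^sup>+x. ennreal (if t = 0 then f0 x else f1 x) * indicator (space M) x \<partial>M)"
    unfolding component_def by (simp, subst emeasure_density) auto
  also have "\<dots> = (\<integral>\<^sup>+x. ennreal (if t = 0 then f0 x else f1 x) \<partial>M)"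
    by (intro nn_integral_cong) (simp add: indicator_def)
  also have "\<dots> = 1"
    using f0_density f1_density by (cases "t = 0") (simp_all add: is_prob_density_def)
  finally show "emeasure (component t) (space (component t)) = 1" .
qed

lemma prob_space_Q: "prob_space Q"
proof
  have "emeasure Q (space Q) = (\<integral>\<^sup>+x. ennreal (mixture f0 f1 \<pi>0 \<pi>1 x) * indicator (space M) x \<partial>M)"
    unfolding Q_def mixture_law_def by (simp, subst emeasure_density) auto
  also have "\<dots> = (\<integral>\<^sup>+x. ennreal \<pi>0 * ennreal (f0 x) + ennreal \<pi>1 * ennreal (f1 x) \<partial>M)"
    using \<pi>0_pos \<pi>1_pos f_nonneg
    by (intro nn_integral_cong) (simp add: mixture_def ennreal_plus ennreal_mult)
  also have "\<dots> = ennreal \<pi>0 * (\<integral>\<^sup>+x. ennreal (f0 x) \<partial>M) + ennreal \<pi>1 * (\<integral>\<^sup>+x. ennreal (f1 x) \<partial>M)"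
    by (subst nn_integral_add) (auto simp: nn_integral_cmult)
  also have "\<dots> = 1"
    using f0_density f1_density \<pi>0_pos \<pi>1_pos \<pi>_sum
    by (simp add: is_prob_density_def flip: ennreal_plus)
  finally show "emeasure Q (space Q) = 1" .
qed

sublocale Q: prob_space Q by (rule prob_space_Q)

sublocale QP: product_prob_space "\<lambda>_::nat. Q" I for I
  by (simp add: product_prob_space_def product_prob_space_axioms_def
      product_sigma_finite_def prob_space_imp_sigma_finite prob_space_Q)

lemma sets_component [measurable_cong, simp]: "sets (component t) = sets M"
  by (simp add: component_def)

lemma space_component [simp]: "space (component t) = space M"
  by (simp add: component_def)

lemma observation_law_eq_PiM: "observation_law M f0 f1 n \<theta> = PiM {..<n} (\<lambda>i. component (\<theta> i))"
  by (simp add: observation_law_def component_def)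

lemma observation_law_eq_density:
  "observation_law M f0 f1 n \<theta> = density (PiM {..<n} (\<lambda>_. Q))
     (\<lambda>x. \<Prod>i<n. ennreal (posterior (\<theta> i) (x i) / prior_weight (\<theta> i)))"
proof -
  have "PiM {..<n} (\<lambda>i. density Q (\<lambda>x. ennreal (posterior (\<theta> i) x / prior_weight (\<theta> i))))
      = density (PiM {..<n} (\<lambda>_. Q))
          (\<lambda>x. \<Prod>i<n. ennreal (posterior (\<theta> i) (x i) / prior_weight (\<theta> i)))"
  proof (rule PiM_density[OF prob_space_Q])
    show "prob_space (density Q (\<lambda>x. ennreal (posterior (\<theta> i) x / prior_weight (\<theta> i))))" for i
      using prob_space_component[of "\<theta> i"] by (simp only: component_eq_density)
  qed (simp, measurable)
  then show ?thesis
    by (simp only: observation_law_eq_PiM component_eq_density)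
qed

lemma sets_observation_law [measurable_cong, simp]:
  "sets (observation_law M f0 f1 n \<theta>) = sets (PiM {..<n} (\<lambda>_. M))"
  unfolding observation_law_eq_PiM by (intro sets_PiM_cong) auto

lemma space_observation_law [simp]:
  "space (observation_law M f0 f1 n \<theta>) = space (PiM {..<n} (\<lambda>_. M))"
  by (rule sets_eq_imp_space_eq) simp

lemma prob_space_observation_law: "prob_space (observation_law M f0 f1 n \<theta>)"
  unfolding observation_law_eq_PiM by (intro prob_space_PiM prob_space_component)

lemma sets_PiM_Q [measurable_cong]: "sets (PiM {..<n} (\<lambda>_::nat. Q)) = sets (PiM {..<n} (\<lambda>_. M))"
  by (intro sets_PiM_cong) auto

end

subsection \<open>Decision rules as weights\<close>

lemma integral_finite_count_space_sets:
  fixes f :: "'b \<Rightarrow> real"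
  assumes sets: "sets N = Pow D" and D: "finite D" and N: "finite_measure N"
  shows "(\<integral>y. f y \<partial>N) = (\<Sum>y\<in>D. f y * measure N {y})"
proof -
  interpret finite_measure N by fact
  have sp: "space N = D"
    using sets by (metis Pow_bottom Pow_top sets.sets_into_space sets.top subset_antisym PowD)
  have "(\<integral>y. f y \<partial>N) = (\<integral>y. (\<Sum>z\<in>D. f z * indicator {z} y) \<partial>N)"
    using D sp by (intro Bochner_Integration.integral_cong) (auto simp: indicator_def sum.delta)
  also have "\<dots> = (\<Sum>z\<in>D. \<integral>y. f z * indicator {z} y \<partial>N)"
    using sets by (intro Bochner_Integration.integral_sum) (auto simp: emeasure_eq_measure)
  also have "\<dots> = (\<Sum>y\<in>D. f y * measure N {y})"
    using sp by (intro sum.cong) (auto simp: Int_absorb2)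
  finally show ?thesis .
qed

text \<open>The decision space is finite, so a Markov kernel into it amounts to finitely many
  measurable functions with sum 1. Integrals over decisions become finite sums, and rules can be
  built or mixed by writing down weights.\<close>

definition is_rule_weights :: "'a measure \<Rightarrow> nat \<Rightarrow> ((nat \<Rightarrow> nat) \<Rightarrow> (nat \<Rightarrow> 'a) \<Rightarrow> real) \<Rightarrow> bool" where
  "is_rule_weights M n w \<longleftrightarrow>
     (\<forall>\<delta>\<in>binary_vectors n. w \<delta> \<in> borel_measurable (PiM {..<n} (\<lambda>_. M))) \<and>
     (\<forall>x\<in>space (PiM {..<n} (\<lambda>_. M)).
        (\<forall>\<delta>\<in>binary_vectors n. 0 \<le> w \<delta> x) \<and> (\<Sum>\<delta>\<in>binary_vectors n. w \<delta> x) = 1)"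

lemma is_rule_weightsD:
  assumes "is_rule_weights M n w"
  shows "\<delta> \<in> binary_vectors n \<Longrightarrow> w \<delta> \<in> borel_measurable (PiM {..<n} (\<lambda>_. M))"
    and "\<delta> \<in> binary_vectors n \<Longrightarrow> x \<in> space (PiM {..<n} (\<lambda>_. M)) \<Longrightarrow> 0 \<le> w \<delta> x"
    and "x \<in> space (PiM {..<n} (\<lambda>_. M)) \<Longrightarrow> (\<Sum>\<delta>\<in>binary_vectors n. w \<delta> x) = 1"
    and "\<delta> \<in> binary_vectors n \<Longrightarrow> x \<in> space (PiM {..<n} (\<lambda>_. M)) \<Longrightarrow> w \<delta> x \<le> 1"
proof -
  show "0 \<le> w \<delta> x" if "\<delta> \<in> binary_vectors n" "x \<in> space (PiM {..<n} (\<lambda>_. M))" for \<delta> x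
    using assms that unfolding is_rule_weights_def by blast
  then show "w \<delta> x \<le> 1" if "\<delta> \<in> binary_vectors n" "x \<in> space (PiM {..<n} (\<lambda>_. M))" for \<delta> x
    using assms that member_le_sum[of \<delta> "binary_vectors n" "\<lambda>\<delta>. w \<delta> x"]
    unfolding is_rule_weights_def by fastforce
qed (use assms in \<open>auto simp: is_rule_weights_def\<close>)

definition kernel_of_weights ::
  "nat \<Rightarrow> ((nat \<Rightarrow> nat) \<Rightarrow> (nat \<Rightarrow> 'a) \<Rightarrow> real) \<Rightarrow> (nat \<Rightarrow> 'a) \<Rightarrow> (nat \<Rightarrow> nat) measure" where
  "kernel_of_weights n w x = point_measure (binary_vectors n) (\<lambda>\<delta>. ennreal (w \<delta> x))"

lemma measure_kernel_of_weights:
  assumes "is_rule_weights M n w" "x \<in> space (PiM {..<n} (\<lambda>_. M))" "\<delta> \<in> binary_vectors n"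
  shows "measure (kernel_of_weights n w x) {\<delta>} = w \<delta> x"
  using assms is_rule_weightsD(2)[OF assms(1)]
  by (simp add: kernel_of_weights_def measure_def emeasure_point_measure_finite)

lemma kernel_of_weights_decision_rule:
  assumes w: "is_rule_weights M n w"
  shows "kernel_of_weights n w \<in> decision_rules M n"
  unfolding decision_rules_def
proof (rule measurable_prob_algebraI)
  fix x assume x: "x \<in> space (PiM {..<n} (\<lambda>_. M))"
  then show prob: "prob_space (kernel_of_weights n w x)"
    using is_rule_weightsD(2,3)[OF w]
    by (intro prob_spaceI)
      (simp add: kernel_of_weights_def space_point_measure emeasure_point_measure_finite sum_ennreal)
next
  show "kernel_of_weights n w \<in> PiM {..<n} (\<lambda>_. M) \<rightarrow>\<^sub>M subprob_algebra (count_space (binary_vectors n))"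
  proof (rule measurable_subprob_algebra)
    fix x assume x: "x \<in> space (PiM {..<n} (\<lambda>_. M))"
    then show "subprob_space (kernel_of_weights n w x)"
      using is_rule_weightsD(2,3)[OF w]
      by (intro prob_space_imp_subprob_space prob_spaceI)
        (simp add: kernel_of_weights_def space_point_measure emeasure_point_measure_finite sum_ennreal)
    show "sets (kernel_of_weights n w x) = sets (count_space (binary_vectors n))"
      by (simp add: kernel_of_weights_def sets_point_measure)
  next
    fix A assume "A \<in> sets (count_space (binary_vectors n))"
    then have A: "A \<subseteq> binary_vectors n" by simp
    have [measurable]: "w \<delta> \<in> borel_measurable (PiM {..<n} (\<lambda>_. M))" if "\<delta> \<in> A" for \<delta>
      using that A is_rule_weightsD(1)[OF w] by blast
    have "(\<lambda>x. \<Sum>\<delta>\<in>A. ennreal (w \<delta> x)) \<in> borel_measurable (PiM {..<n} (\<lambda>_. M))"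
      by measurable
    then show "(\<lambda>x. emeasure (kernel_of_weights n w x) A) \<in> borel_measurable (PiM {..<n} (\<lambda>_. M))"
      using A by (simp add: kernel_of_weights_def emeasure_point_measure_finite)
  qed
qed

lemma decision_rule_prob:
  assumes "\<kappa> \<in> decision_rules M n" "x \<in> space (PiM {..<n} (\<lambda>_. M))"
  shows "prob_space (\<kappa> x)" "sets (\<kappa> x) = Pow (binary_vectors n)"
  using measurable_space[OF assms(1)[unfolded decision_rules_def] assms(2)]
  by (auto simp: space_prob_algebra)

lemma is_rule_weights_kernel:
  assumes \<kappa>: "\<kappa> \<in> decision_rules M n"
  shows "is_rule_weights M n (\<lambda>\<delta> x. measure (\<kappa> x) {\<delta>})"
  unfolding is_rule_weights_def
proof (intro conjI ballI)
  fix \<delta> assume \<delta>: "\<delta> \<in> binary_vectors n"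
  show "(\<lambda>x. measure (\<kappa> x) {\<delta>}) \<in> borel_measurable (PiM {..<n} (\<lambda>_. M))"
    by (rule measurable_compose[OF \<kappa>[unfolded decision_rules_def]])
      (use \<delta> in \<open>auto intro!: measurable_measure_prob_algebra\<close>)
next
  fix x assume x: "x \<in> space (PiM {..<n} (\<lambda>_. M))"
  interpret prob_space "\<kappa> x" using decision_rule_prob[OF \<kappa> x] by simp
  have sets: "sets (\<kappa> x) = Pow (binary_vectors n)" using decision_rule_prob[OF \<kappa> x] by simp
  have "(\<integral>\<delta>. 1 \<partial>\<kappa> x) = (\<Sum>\<delta>\<in>binary_vectors n. 1 * measure (\<kappa> x) {\<delta>})"
    by (rule integral_finite_count_space_sets[OF sets]) (simp_all add: finite_measure_axioms)
  then show "(\<Sum>\<delta>\<in>binary_vectors n. measure (\<kappa> x) {\<delta>}) = 1"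
    by (simp add: prob_space)
qed simp

section \<open>Expectations under the joint law of states and decisions\<close>

context two_groups
begin

lemma joint_law_kernels:
  fixes \<theta> :: "nat \<Rightarrow> nat"
  assumes \<kappa>: "\<kappa> \<in> decision_rules M n"
  shows "(\<lambda>x. \<kappa> x \<bind> (\<lambda>\<delta>. return (count_space UNIV) (\<theta>, \<delta>)))
      \<in> PiM {..<n} (\<lambda>_. M) \<rightarrow>\<^sub>M prob_algebra (count_space UNIV)"
    and "(\<lambda>\<theta>. observation_law M f0 f1 n \<theta> \<bind> (\<lambda>x. \<kappa> x \<bind> (\<lambda>\<delta>. return (count_space UNIV) (\<theta>, \<delta>))))
      \<in> count_space UNIV \<rightarrow>\<^sub>M prob_algebra (count_space UNIV)"
proof -
  have ret: "(\<lambda>\<delta>. return (count_space UNIV) (\<theta>, \<delta>))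
      \<in> count_space (binary_vectors n) \<rightarrow>\<^sub>M prob_algebra (count_space UNIV)" for \<theta> :: "nat \<Rightarrow> nat"
    by (auto simp: space_prob_algebra prob_space_return)
  have in_kernel: "(\<lambda>x. \<kappa> x \<bind> (\<lambda>\<delta>. return (count_space UNIV) (\<theta>, \<delta>)))
      \<in> PiM {..<n} (\<lambda>_. M) \<rightarrow>\<^sub>M prob_algebra (count_space UNIV)" for \<theta> :: "nat \<Rightarrow> nat"
    by (rule measurable_bind_prob_space[OF \<kappa>[unfolded decision_rules_def] ret])
  show "(\<lambda>x. \<kappa> x \<bind> (\<lambda>\<delta>. return (count_space UNIV) (\<theta>, \<delta>)))
      \<in> PiM {..<n} (\<lambda>_. M) \<rightarrow>\<^sub>M prob_algebra (count_space UNIV)"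
    by (rule in_kernel)
  have obs: "observation_law M f0 f1 n \<theta> \<in> space (prob_algebra (PiM {..<n} (\<lambda>_. M)))" for \<theta>
    by (simp add: space_prob_algebra prob_space_observation_law)
  show "(\<lambda>\<theta>. observation_law M f0 f1 n \<theta> \<bind> (\<lambda>x. \<kappa> x \<bind> (\<lambda>\<delta>. return (count_space UNIV) (\<theta>, \<delta>))))
      \<in> count_space UNIV \<rightarrow>\<^sub>M prob_algebra (count_space UNIV)"
    using prob_space_bind'[OF obs in_kernel] sets_bind'[OF obs in_kernel]
    by (auto simp: space_prob_algebra)
qed

lemma prob_space_joint_law:
  assumes \<kappa>: "\<kappa> \<in> decision_rules M n"
  shows "prob_space (joint_law M f0 f1 n k \<kappa>)" "sets (joint_law M f0 f1 n k \<kappa>) = UNIV"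
proof -
  have pr: "measure_pmf (fixed_proportion_prior n k) \<in> space (prob_algebra (count_space UNIV))"
    by (simp add: space_prob_algebra measure_pmf.prob_space_axioms)
  show "prob_space (joint_law M f0 f1 n k \<kappa>)" "sets (joint_law M f0 f1 n k \<kappa>) = UNIV"
    unfolding joint_law_def
    using prob_space_bind'[OF pr joint_law_kernels(2)[OF \<kappa>]]
      sets_bind'[OF pr joint_law_kernels(2)[OF \<kappa>]] by auto
qed

text \<open>The three binds are integrated out one at a time. Each use of
  \<open>integral_bind\<close> asks for a bound that holds everywhere, hence the global hypothesis
  on \<open>L\<close>; error proportions need not satisfy it at vectors that are not binary, and
  \<open>joint_law_integral_support\<close> repairs this.\<close>

lemma integral_joint_law:
  fixes L :: "(nat \<Rightarrow> nat) \<times> (nat \<Rightarrow> nat) \<Rightarrow> real"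
  assumes \<kappa>: "\<kappa> \<in> decision_rules M n" and k: "k \<le> n" and B: "\<And>y. \<bar>L y\<bar> \<le> B"
  shows "(\<integral>y. L y \<partial>joint_law M f0 f1 n k \<kappa>)
    = (\<Sum>\<theta>\<in>fixed_sum_vectors n k.
        \<integral>x. (\<Sum>\<delta>\<in>binary_vectors n. L (\<theta>, \<delta>) * measure (\<kappa> x) {\<delta>}) \<partial>observation_law M f0 f1 n \<theta>)
       / card (fixed_sum_vectors n k)"
proof -
  have inner: "(\<integral>y. L y \<partial>(\<kappa> x \<bind> (\<lambda>\<delta>. return (count_space UNIV) (\<theta>, \<delta>))))
      = (\<Sum>\<delta>\<in>binary_vectors n. L (\<theta>, \<delta>) * measure (\<kappa> x) {\<delta>})"
    if x: "x \<in> space (PiM {..<n} (\<lambda>_. M))" for x \<theta>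
  proof -
    interpret prob_space "\<kappa> x" using decision_rule_prob[OF \<kappa> x] by simp
    have sets: "sets (\<kappa> x) = Pow (binary_vectors n)" using decision_rule_prob[OF \<kappa> x] by simp
    have [measurable_cong]: "sets (\<kappa> x) = sets (count_space (binary_vectors n))"
      using sets by simp
    have "(\<integral>y. L y \<partial>(\<kappa> x \<bind> (\<lambda>\<delta>. return (count_space UNIV) (\<theta>, \<delta>))))
        = (\<integral>\<delta>. (\<integral>y. L y \<partial>return (count_space UNIV) (\<theta>, \<delta>)) \<partial>\<kappa> x)"
      by (rule integral_bind[where K = "count_space UNIV" and B = B and B' = 1])
        (auto simp: B finite_measure_axioms space_subprob_algebra
          intro!: prob_space_imp_subprob_space prob_space_return)
    also have "\<dots> = (\<integral>\<delta>. L (\<theta>, \<delta>) \<partial>\<kappa> x)"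
      by (simp add: integral_return)
    also have "\<dots> = (\<Sum>\<delta>\<in>binary_vectors n. L (\<theta>, \<delta>) * measure (\<kappa> x) {\<delta>})"
      by (rule integral_finite_count_space_sets[OF sets]) (simp_all add: finite_measure_axioms)
    finally show ?thesis .
  qed
  have mid: "(\<integral>y. L y \<partial>(observation_law M f0 f1 n \<theta> \<bind> (\<lambda>x. \<kappa> x \<bind> (\<lambda>\<delta>. return (count_space UNIV) (\<theta>, \<delta>)))))
      = (\<integral>x. (\<Sum>\<delta>\<in>binary_vectors n. L (\<theta>, \<delta>) * measure (\<kappa> x) {\<delta>}) \<partial>observation_law M f0 f1 n \<theta>)" for \<theta>
  proof -
    have [measurable]: "(\<lambda>x. \<kappa> x \<bind> (\<lambda>\<delta>. return (count_space UNIV) (\<theta>, \<delta>)))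
      \<in> PiM {..<n} (\<lambda>_. M) \<rightarrow>\<^sub>M subprob_algebra (count_space UNIV)"
      by (rule measurable_prob_algebraD[OF joint_law_kernels(1)[OF \<kappa>]])
    have em: "emeasure (\<kappa> x \<bind> (\<lambda>\<delta>. return (count_space UNIV) (\<theta>, \<delta>)))
        (space (\<kappa> x \<bind> (\<lambda>\<delta>. return (count_space UNIV) (\<theta>, \<delta>)))) = 1"
      if "x \<in> space (PiM {..<n} (\<lambda>_. M))" for x
      using measurable_space[OF joint_law_kernels(1)[OF \<kappa>, of \<theta>] that]
      by (simp add: space_prob_algebra prob_space.emeasure_space_1)
    have "(\<integral>y. L y \<partial>(observation_law M f0 f1 n \<theta> \<bind> (\<lambda>x. \<kappa> x \<bind> (\<lambda>\<delta>. return (count_space UNIV) (\<theta>, \<delta>)))))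
      = (\<integral>x. (\<integral>y. L y \<partial>(\<kappa> x \<bind> (\<lambda>\<delta>. return (count_space UNIV) (\<theta>, \<delta>)))) \<partial>observation_law M f0 f1 n \<theta>)"
      by (rule integral_bind[where K = "count_space UNIV" and B = B and B' = 1])
        (auto simp: B em prob_space.finite_measure prob_space_observation_law intro!: AE_I2)
    also have "\<dots> = (\<integral>x. (\<Sum>\<delta>\<in>binary_vectors n. L (\<theta>, \<delta>) * measure (\<kappa> x) {\<delta>}) \<partial>observation_law M f0 f1 n \<theta>)"
      by (rule Bochner_Integration.integral_cong) (simp_all add: inner)
    finally show ?thesis .
  qed
  have em: "emeasure (observation_law M f0 f1 n \<theta> \<bind> (\<lambda>x. \<kappa> x \<bind> (\<lambda>\<delta>. return (count_space UNIV) (\<theta>, \<delta>))))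
      (space (observation_law M f0 f1 n \<theta> \<bind> (\<lambda>x. \<kappa> x \<bind> (\<lambda>\<delta>. return (count_space UNIV) (\<theta>, \<delta>))))) = 1" for \<theta>
    using measurable_space[OF joint_law_kernels(2)[OF \<kappa>], of \<theta>]
    by (simp add: space_prob_algebra prob_space.emeasure_space_1)
  have "(\<integral>y. L y \<partial>joint_law M f0 f1 n k \<kappa>)
      = (\<integral>\<theta>. (\<integral>y. L y \<partial>(observation_law M f0 f1 n \<theta> \<bind> (\<lambda>x. \<kappa> x \<bind> (\<lambda>\<delta>. return (count_space UNIV) (\<theta>, \<delta>)))))
           \<partial>measure_pmf (fixed_proportion_prior n k))"
    unfolding joint_law_def
    by (rule integral_bind[where K = "count_space UNIV" and B = B and B' = 1])
      (use measurable_prob_algebraD[OF joint_law_kernels(2)[OF \<kappa>]] in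
        \<open>auto simp: B em measure_pmf.finite_measure_axioms\<close>)
  also have "\<dots> = (\<Sum>\<theta>\<in>fixed_sum_vectors n k.
        \<integral>x. (\<Sum>\<delta>\<in>binary_vectors n. L (\<theta>, \<delta>) * measure (\<kappa> x) {\<delta>}) \<partial>observation_law M f0 f1 n \<theta>)
       / card (fixed_sum_vectors n k)"
    unfolding mid fixed_proportion_prior_def fixed_sum_vectors_def[symmetric]
    by (rule integral_pmf_of_set) (simp_all add: fixed_sum_vectors_nonempty[OF k])
  finally show ?thesis .
qed

text \<open>Applied to the indicator of the complement, the expectation formula is a sum without a
  nonzero term.\<close>

lemma AE_joint_law:
  assumes \<kappa>: "\<kappa> \<in> decision_rules M n" and k: "k \<le> n"
  shows "AE y in joint_law M f0 f1 n k \<kappa>. y \<in> fixed_sum_vectors n k \<times> binary_vectors n"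
proof -
  let ?J = "joint_law M f0 f1 n k \<kappa>" and ?S = "fixed_sum_vectors n k \<times> binary_vectors n"
  interpret J: prob_space ?J by (rule prob_space_joint_law[OF \<kappa>])
  have [simp]: "space ?J = UNIV"
    using prob_space_joint_law(2)[OF \<kappa>] sets.sets_into_space[of UNIV ?J] by auto
  have "J.prob (- ?S) = (\<integral>y. indicator (- ?S) y \<partial>?J)"
    by (simp add: prob_space_joint_law(2)[OF \<kappa>])
  also have "\<dots> = 0"
    by (subst integral_joint_law[OF \<kappa> k, of _ 1]) (auto simp: indicator_def)
  finally show ?thesis
    by (intro AE_I'[of "- ?S"])
      (auto simp: null_sets_def prob_space_joint_law(2)[OF \<kappa>] J.emeasure_eq_measure)
qed

text \<open>Cutting \<open>L\<close> off outside the support changes it only on a null set and makes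
  it globally bounded, so the previous formula applies to losses controlled on binary vectors
  alone.\<close>

lemma joint_law_integral_support:
  fixes L :: "(nat \<Rightarrow> nat) \<times> (nat \<Rightarrow> nat) \<Rightarrow> real"
  assumes \<kappa>: "\<kappa> \<in> decision_rules M n" and k: "k \<le> n"
    and B: "\<And>\<theta> \<delta>. \<theta> \<in> fixed_sum_vectors n k \<Longrightarrow> \<delta> \<in> binary_vectors n \<Longrightarrow> \<bar>L (\<theta>, \<delta>)\<bar> \<le> B"
  shows "integrable (joint_law M f0 f1 n k \<kappa>) L"
    and "(\<integral>y. L y \<partial>joint_law M f0 f1 n k \<kappa>)
      = (\<Sum>\<theta>\<in>fixed_sum_vectors n k.
          \<integral>x. (\<Sum>\<delta>\<in>binary_vectors n. L (\<theta>, \<delta>) * measure (\<kappa> x) {\<delta>}) \<partial>observation_law M f0 f1 n \<theta>)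
         / card (fixed_sum_vectors n k)"
proof -
  let ?J = "joint_law M f0 f1 n k \<kappa>"
  let ?L = "\<lambda>y. L y * indicator (fixed_sum_vectors n k \<times> binary_vectors n) y"
  interpret J: prob_space ?J by (rule prob_space_joint_law[OF \<kappa>])
  have meas: "g \<in> borel_measurable ?J" for g :: "_ \<Rightarrow> real"
    using prob_space_joint_law(2)[OF \<kappa>] sets.sets_into_space[of UNIV ?J]
    by (auto simp: measurable_def)
  show "integrable ?J L"
  proof (rule J.integrable_const_bound[where B = B])
    show "AE y in ?J. norm (L y) \<le> B"
      using AE_joint_law[OF \<kappa> k] by eventually_elim (use B in auto)
  qed (rule meas)
  have "(\<integral>y. L y \<partial>?J) = (\<integral>y. ?L y \<partial>?J)"
  proof (intro integral_cong_AE meas)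
    show "AE y in ?J. L y = ?L y"
      using AE_joint_law[OF \<kappa> k] by eventually_elim simp
  qed
  also have "\<dots> = (\<Sum>\<theta>\<in>fixed_sum_vectors n k.
        \<integral>x. (\<Sum>\<delta>\<in>binary_vectors n. ?L (\<theta>, \<delta>) * measure (\<kappa> x) {\<delta>}) \<partial>observation_law M f0 f1 n \<theta>)
       / card (fixed_sum_vectors n k)"
    by (rule integral_joint_law[OF \<kappa> k, where B = "\<bar>B\<bar>"])
      (use order_trans[OF B abs_ge_self] in \<open>auto simp: indicator_def\<close>)
  also have "\<dots> = (\<Sum>\<theta>\<in>fixed_sum_vectors n k.
        \<integral>x. (\<Sum>\<delta>\<in>binary_vectors n. L (\<theta>, \<delta>) * measure (\<kappa> x) {\<delta>}) \<partial>observation_law M f0 f1 n \<theta>)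
       / card (fixed_sum_vectors n k)"
    by (intro arg_cong2[where f = "(/)"] sum.cong Bochner_Integration.integral_cong refl) auto
  finally show "(\<integral>y. L y \<partial>?J) = (\<Sum>\<theta>\<in>fixed_sum_vectors n k.
          \<integral>x. (\<Sum>\<delta>\<in>binary_vectors n. L (\<theta>, \<delta>) * measure (\<kappa> x) {\<delta>}) \<partial>observation_law M f0 f1 n \<theta>)
         / card (fixed_sum_vectors n k)" .
qed

end

subsection \<open>The functions a and b\<close>

lemma integral_uniform_measure_prob:
  fixes g :: "'b \<Rightarrow> real"
  assumes P: "prob_space P" and S[measurable]: "S \<in> sets P" and pos: "measure P S > 0"
    and g[measurable]: "g \<in> borel_measurable P"
  shows "(\<integral>x. g x \<partial>uniform_measure P S) = (\<integral>x. g x * indicator S x \<partial>P) / measure P S"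
proof -
  interpret prob_space P by fact
  have "uniform_measure P S = density P (\<lambda>x. ennreal (indicator S x / measure P S))"
    unfolding uniform_measure_def using pos
    by (intro density_cong) (auto simp: emeasure_eq_measure divide_ennreal simp flip: ennreal_indicator)
  then have "(\<integral>x. g x \<partial>uniform_measure P S) = (\<integral>x. (indicator S x / measure P S) * g x \<partial>P)"
    by (simp add: integral_density)
  also have "\<dots> = (\<integral>x. (g x * indicator S x) / measure P S \<partial>P)"
    by (simp add: field_simps)
  finally show ?thesis by simp
qed

section \<open>Neyman-Pearson tests of a given size\<close>

context two_groups
begin

definition q :: "real \<Rightarrow> real" where "q u = lfdr_quantile M f0 f1 \<pi>0 \<pi>1 u"

text \<open>The conditional probability of S_u = 1 given the observation \<open>x\<close>: the coin
  is averaged out, which leaves a randomised test on the sample space of \<open>Q\<close>.\<close>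

definition s :: "real \<Rightarrow> 'a \<Rightarrow> real" where
  "s u x = (if W x < q u then 1 else if W x = q u then p u else 0)"

definition A :: "real \<Rightarrow> real" where "A u = (\<integral>x. W x * s u x \<partial>Q)"

abbreviation a :: "real \<Rightarrow> real" where "a \<equiv> a_fun M f0 f1 \<pi>0 \<pi>1 p"

abbreviation b :: "real \<Rightarrow> real" where "b \<equiv> b_fun M f0 f1 \<pi>0 \<pi>1 p"

lemma measure_Q_space [simp]: "measure Q (space M) = 1"
  using Q.prob_space by simp

lemma integrable_Q:
  fixes g :: "'a \<Rightarrow> real"
  assumes "g \<in> borel_measurable M" "\<And>x. x \<in> space M \<Longrightarrow> \<bar>g x\<bar> \<le> B"
  shows "integrable Q g"
  using assms by (intro Q.integrable_const_bound[where B = B]) auto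

lemma s_measurable [measurable]: "s u \<in> borel_measurable M"
  unfolding s_def by measurable

lemma p_bounds: "u \<in> {0..1} \<Longrightarrow> 0 \<le> p u" "u \<in> {0..1} \<Longrightarrow> p u \<le> 1"
  using tie_breaker unfolding is_tie_breaker_def by fastforce+

lemma s_bounds: "u \<in> {0..1} \<Longrightarrow> 0 \<le> s u x" "u \<in> {0..1} \<Longrightarrow> s u x \<le> 1"
  using p_bounds[of u] by (auto simp: s_def)

lemma q_bounds:
  assumes "u \<in> {0..1}"
  shows "0 \<le> q u" "q u \<le> 1"
proof -
  let ?T = "{t \<in> {0..1}. lfdr_cdf M f0 f1 \<pi>0 \<pi>1 t \<ge> u}"
  \<comment> \<open>Since \<open>W\<close> never exceeds 1, the point 1 belongs to the set whose
    infimum is the quantile, so that infimum is taken over a nonempty set.\<close>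
  have "{x \<in> space M. W x \<le> 1} = space Q"
    using W_bounds by auto
  then have "lfdr_cdf M f0 f1 \<pi>0 \<pi>1 1 = 1"
    unfolding lfdr_cdf_def W_def[symmetric] Q_def[symmetric] by (simp add: Q.prob_space del: space_Q)
  then have "1 \<in> ?T" using assms by simp
  then show "0 \<le> q u" "q u \<le> 1"
    unfolding q_def lfdr_quantile_def
    by (auto intro!: cInf_greatest cInf_lower bdd_belowI[of _ 0])
qed

lemma integrable_s [simp]: "u \<in> {0..1} \<Longrightarrow> integrable Q (s u)"
  using s_bounds by (intro integrable_Q[where B = 1]) auto

lemma integrable_W [simp]: "integrable Q W"
  using W_bounds by (intro integrable_Q[where B = 1]) auto

lemma integrable_W_mult:
  assumes "\<phi> \<in> borel_measurable M" "\<And>x. x \<in> space M \<Longrightarrow> \<bar>\<phi> x\<bar> \<le> 1"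
  shows "integrable Q (\<lambda>x. W x * \<phi> x)"
  using assms W_bounds
  by (intro integrable_Q[where B = 1]) (auto simp: abs_mult intro!: mult_le_one)

lemma integrable_W_s [simp]: "u \<in> {0..1} \<Longrightarrow> integrable Q (\<lambda>x. W x * s u x)"
  using s_bounds by (intro integrable_W_mult) auto

lemma integral_s:
  assumes u: "u \<in> {0..1}"
  shows "(\<integral>x. s u x \<partial>Q) = u"
proof -
  have "(\<integral>x. s u x \<partial>Q) = (\<integral>x. indicator {x \<in> space M. W x < q u} x
      + p u * indicator {x \<in> space M. W x = q u} x \<partial>Q)"
    by (intro Bochner_Integration.integral_cong) (auto simp: s_def)
  also have "\<dots> = (\<integral>x. indicator {x \<in> space M. W x < q u} x \<partial>Q)
      + (\<integral>x. p u * indicator {x \<in> space M. W x = q u} x \<partial>Q)"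
    by (intro Bochner_Integration.integral_add integrable_Q[where B = 1])
      (use p_bounds[OF u] in \<open>auto simp: indicator_def\<close>)
  also have "\<dots> = measure Q {x \<in> space M. W x < q u} + p u * measure Q {x \<in> space M. W x = q u}"
    by (simp add: Int_absorb2 subset_eq)
  also have "\<dots> = u"
    using tie_breaker u unfolding is_tie_breaker_def q_def W_def Q_def by blast
  finally show ?thesis .
qed

lemma integral_component:
  fixes g :: "'a \<Rightarrow> real"
  assumes [measurable]: "g \<in> borel_measurable M"
  shows "(\<integral>x. g x \<partial>component t) = (\<integral>x. posterior t x * g x \<partial>Q) / prior_weight t"
proof -
  have "(\<integral>x. g x \<partial>component t) = (\<integral>x. (posterior t x / prior_weight t) * g x \<partial>Q)"
    unfolding component_eq_density using posterior_nonneg prior_weight_pos[of t]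
    by (subst integral_density) auto
  also have "\<dots> = (\<integral>x. (posterior t x * g x) / prior_weight t \<partial>Q)"
    by simp
  finally show ?thesis by simp
qed

lemma integral_W: "(\<integral>x. W x \<partial>Q) = \<pi>0"
proof -
  interpret C: prob_space "component 0" by (rule prob_space_component)
  have "(\<integral>x. (1::real) \<partial>component 0) = 1" using C.prob_space by simp
  then show ?thesis
    using \<pi>0_pos integral_component[of "\<lambda>_. 1" 0]
    by (simp add: posterior_def prior_weight_def)
qed

text \<open>Pointwise, \<open>(W x - q u) * s u x\<close> is the least possible value of
  \<open>(W x - q u) * \<phi> x\<close>: \<open>s u\<close> is 1 where the factor is negative, 0
  where it is positive, and at a tie the factor vanishes whatever \<open>p u\<close> is. The
  Lagrangian form leaves the size of \<open>\<phi>\<close> free.\<close>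

lemma neyman_pearson:
  assumes u: "u \<in> {0..1}" and [measurable]: "\<phi> \<in> borel_measurable M"
    and \<phi>: "\<And>x. x \<in> space M \<Longrightarrow> 0 \<le> \<phi> x" "\<And>x. x \<in> space M \<Longrightarrow> \<phi> x \<le> 1"
  shows "A u - q u * u \<le> (\<integral>x. W x * \<phi> x \<partial>Q) - q u * (\<integral>x. \<phi> x \<partial>Q)"
proof -
  have [simp]: "integrable Q \<phi>" "integrable Q (\<lambda>x. W x * \<phi> x)"
    using \<phi> by (auto intro!: integrable_Q[where B = 1] integrable_W_mult)
  have "(\<integral>x. W x * s u x - q u * s u x \<partial>Q) \<le> (\<integral>x. W x * \<phi> x - q u * \<phi> x \<partial>Q)"
  proof (rule integral_mono)
    fix x assume "x \<in> space Q"
    then have x: "0 \<le> \<phi> x" "\<phi> x \<le> 1" using \<phi> by auto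
    have "(W x - q u) * s u x \<le> (W x - q u) * \<phi> x"
    proof (cases "W x" "q u" rule: linorder_cases)
      case less
      then show ?thesis using x by (simp add: s_def mult_le_cancel_left1)
    next
      case greater
      then show ?thesis using x by (simp add: s_def)
    qed simp
    then show "W x * s u x - q u * s u x \<le> W x * \<phi> x - q u * \<phi> x"
      by (simp add: algebra_simps)
  qed (use u in auto)
  then show ?thesis
    using u by (simp add: integral_s A_def)
qed

text \<open>\<open>s u\<close> selects the positive part of \<open>q u - W x\<close>, ties
  contributing nothing. Up to sign the mean hinge is the Lagrangian optimum; it reappears as the
  linear term of the Chernoff exponent.\<close>

lemma integral_hinge:
  assumes u: "u \<in> {0..1}"
  shows "(\<integral>x. max 0 (q u - W x) \<partial>Q) = q u * u - A u"
proof -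
  have "(\<integral>x. max 0 (q u - W x) \<partial>Q) = (\<integral>x. q u * s u x - W x * s u x \<partial>Q)"
    by (intro Bochner_Integration.integral_cong) (auto simp: s_def max_def)
  then show ?thesis using u by (simp add: integral_s A_def)
qed

lemma A_le_integral:
  assumes "u \<in> {0..1}" "\<phi> \<in> borel_measurable M"
    "\<And>x. x \<in> space M \<Longrightarrow> 0 \<le> \<phi> x" "\<And>x. x \<in> space M \<Longrightarrow> \<phi> x \<le> 1" "(\<integral>x. \<phi> x \<partial>Q) = u"
  shows "A u \<le> (\<integral>x. W x * \<phi> x \<partial>Q)"
  using neyman_pearson[OF assms(1-4)] assms(5) by simp

lemma A_nonneg: "u \<in> {0..1} \<Longrightarrow> 0 \<le> A u"
  unfolding A_def using W_bounds s_bounds by (intro integral_nonneg_AE AE_I2) auto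

lemma A_le:
  assumes "u \<in> {0..1}" shows "A u \<le> u"
proof -
  have "A u \<le> (\<integral>x. s u x \<partial>Q)"
    unfolding A_def using assms W_bounds s_bounds
    by (intro integral_mono) (auto intro!: mult_left_le_one_le)
  then show ?thesis using assms by (simp add: integral_s)
qed

text \<open>The non-nulls have mass \<open>\<pi>1\<close>, of which \<open>u - A u\<close> is
  selected; the rest is the numerator of \<open>b u\<close>. The integral form shows its
  sign.\<close>

lemma B_eq:
  assumes "u \<in> {0..1}"
  shows "\<pi>1 - u + A u = (\<integral>x. (1 - W x) * (1 - s u x) \<partial>Q)"
proof -
  have "(\<integral>x. (1 - W x) * (1 - s u x) \<partial>Q) = (\<integral>x. 1 - W x - s u x + W x * s u x \<partial>Q)"
    by (intro Bochner_Integration.integral_cong) (auto simp: algebra_simps)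
  also have "\<dots> = \<pi>1 - u + A u"
    using assms \<pi>_sum by (simp add: integral_W integral_s Q.prob_space flip: A_def)
  finally show ?thesis ..
qed

lemma B_nonneg: "u \<in> {0..1} \<Longrightarrow> 0 \<le> \<pi>1 - u + A u"
  unfolding B_eq using W_bounds s_bounds by (intro integral_nonneg_AE AE_I2) auto

lemma A_1: "A 1 = \<pi>0"
proof (rule antisym)
  have "A 1 \<le> (\<integral>x. W x \<partial>Q)"
    unfolding A_def using W_bounds s_bounds[of 1]
    by (intro integral_mono) (auto intro!: mult_right_le_one_le)
  then show "A 1 \<le> \<pi>0" by (simp add: integral_W)
  show "\<pi>0 \<le> A 1" using B_nonneg[of 1] \<pi>_sum by simp
qed

lemma A_0: "A 0 = 0"
  using A_nonneg[of 0] A_le[of 0] by simp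

text \<open>Thinning the test \<open>s v\<close> by the factor \<open>u / v\<close> gives a test of
  size \<open>u\<close>, whose null mass is at least \<open>A u\<close>. Divided by
  \<open>u\<close>, this is the monotonicity of \<open>a\<close>.\<close>

lemma A_scale:
  assumes "0 \<le> u" "u \<le> v" "0 < v" "v \<le> 1"
  shows "A u \<le> (u / v) * A v"
proof -
  have "u * s v x \<le> v" for x
    using mult_mono[of u v "s v x" 1] assms s_bounds[of v x] by simp
  then have "A u \<le> (\<integral>x. W x * ((u / v) * s v x) \<partial>Q)"
    using assms s_bounds[of v]
    by (intro A_le_integral)
      (auto simp: integral_s divide_le_eq_1)
  also have "\<dots> = (\<integral>x. (u / v) * (W x * s v x) \<partial>Q)"
    by (simp add: ac_simps)
  finally show ?thesis by (simp add: A_def)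
qed

lemma A_mono:
  assumes "0 \<le> u" "u \<le> v" "v \<le> 1"
  shows "A u \<le> A v"
proof (cases "v = 0")
  case False
  then have "A u \<le> (u / v) * A v" using assms by (intro A_scale) auto
  also have "\<dots> \<le> 1 * A v"
    using assms False A_nonneg[of v] by (intro mult_right_mono) auto
  finally show ?thesis by simp
qed (use assms in auto)

text \<open>The mirror image: the acceptance probabilities of \<open>s u\<close> are thinned by
  \<open>(1 - v) / (1 - u)\<close>, which gives a competitor of size \<open>v\<close>. Divided by
  \<open>1 - v\<close>, the inequality is the monotonicity of \<open>b\<close>.\<close>

lemma B_scale:
  assumes "0 \<le> u" "u \<le> v" "u < 1" "v \<le> 1"
  shows "\<pi>1 - v + A v \<le> ((1 - v) / (1 - u)) * (\<pi>1 - u + A u)"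
proof -
  let ?c = "(1 - v) / (1 - u)"
  have c: "0 \<le> ?c" "?c \<le> 1" using assms by auto
  have sb: "0 \<le> ?c * (1 - s u x)" "?c * (1 - s u x) \<le> 1" for x
    using c s_bounds[of u x] assms by (auto simp del: times_divide_eq_left intro!: mult_le_one mult_nonneg_nonneg)
  have iB: "integrable Q (\<lambda>x. (1 - W x) * (1 - s u x))"
    using W_bounds s_bounds[of u] assms
    by (intro integrable_Q[where B = 1]) (auto simp: abs_mult intro!: mult_le_one)
  have "A v \<le> (\<integral>x. W x * (1 - ?c * (1 - s u x)) \<partial>Q)"
  proof (rule A_le_integral)
    have "(\<integral>x. 1 - ?c * (1 - s u x) \<partial>Q) = 1 - ?c * (1 - u)"
      using assms by (simp add: integral_s Q.prob_space)
    also have "\<dots> = v" using assms by simp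
    finally show "(\<integral>x. 1 - ?c * (1 - s u x) \<partial>Q) = v" .
    show "1 - ?c * (1 - s u x) \<le> 1" "0 \<le> 1 - ?c * (1 - s u x)" for x
      using sb[of x] by auto
  qed (use assms in auto)
  also have "\<dots> = (\<integral>x. W x - ?c * (1 - s u x) + ?c * ((1 - W x) * (1 - s u x)) \<partial>Q)"
    by (intro Bochner_Integration.integral_cong) (auto simp: algebra_simps)
  also have "\<dots> = \<pi>0 - ?c * (1 - u) + ?c * (\<pi>1 - u + A u)"
    using assms iB by (simp add: integral_W integral_s Q.prob_space B_eq)
  also have "?c * (1 - u) = 1 - v" using assms by simp
  finally show ?thesis using \<pi>_sum by simp
qed

section \<open>Conditional expectations on the coin space\<close>

lemma prob_space_coin: "prob_space (coin_space M f0 f1 \<pi>0 \<pi>1 p u)"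
  unfolding coin_space_def Q_def[symmetric]
  by (intro prob_space_pair prob_space_Q measure_pmf.prob_space_axioms)

lemma selected_sets [measurable]:
  "{\<omega> \<in> space (coin_space M f0 f1 \<pi>0 \<pi>1 p u). selected M f0 f1 \<pi>0 \<pi>1 u \<omega>}
     \<in> sets (coin_space M f0 f1 \<pi>0 \<pi>1 p u)"
  "{\<omega> \<in> space (coin_space M f0 f1 \<pi>0 \<pi>1 p u). \<not> selected M f0 f1 \<pi>0 \<pi>1 u \<omega>}
     \<in> sets (coin_space M f0 f1 \<pi>0 \<pi>1 p u)"
  unfolding selected_def coin_space_def Q_def[symmetric] W_def[symmetric] case_prod_beta
  by measurable

lemma integral_coin_space:
  fixes h :: "'a \<Rightarrow> bool \<Rightarrow> real"
  assumes u: "u \<in> {0..1}"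
    and h[measurable]: "\<And>c. (\<lambda>x. h x c) \<in> borel_measurable M"
    and bd: "\<And>x c. x \<in> space M \<Longrightarrow> \<bar>h x c\<bar> \<le> 1"
  shows "(\<integral>\<omega>. h (fst \<omega>) (snd \<omega>) \<partial>coin_space M f0 f1 \<pi>0 \<pi>1 p u)
    = (\<integral>x. h x True * p u + h x False * (1 - p u) \<partial>Q)"
proof -
  let ?B = "measure_pmf (bernoulli_pmf (p u))"
  interpret P: prob_space "coin_space M f0 f1 \<pi>0 \<pi>1 p u" by (rule prob_space_coin)
  interpret pair_sigma_finite Q ?B
    by (simp add: pair_sigma_finite_def prob_space_imp_sigma_finite prob_space_Q
        measure_pmf.prob_space_axioms)
  have eq: "coin_space M f0 f1 \<pi>0 \<pi>1 p u = Q \<Otimes>\<^sub>M ?B"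
    by (simp add: coin_space_def Q_def)
  \<comment> \<open>Splitting on the coin reduces joint measurability to that of the two
    slices.\<close>
  have h': "(\<lambda>\<omega>. h (fst \<omega>) (snd \<omega>)) = (\<lambda>\<omega>. if snd \<omega> then h (fst \<omega>) True else h (fst \<omega>) False)"
    by auto
  have "integrable (Q \<Otimes>\<^sub>M ?B) (\<lambda>\<omega>. h (fst \<omega>) (snd \<omega>))"
  proof (rule P.integrable_const_bound[where B = 1, unfolded eq])
    show "AE \<omega> in Q \<Otimes>\<^sub>M ?B. norm (h (fst \<omega>) (snd \<omega>)) \<le> 1"
      using bd by (intro AE_I2) (auto simp: space_pair_measure)
    show "(\<lambda>\<omega>. h (fst \<omega>) (snd \<omega>)) \<in> borel_measurable (Q \<Otimes>\<^sub>M ?B)"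
      unfolding h' by measurable
  qed
  from integral_fst'[OF this] show ?thesis
    unfolding eq using p_bounds[OF u] by simp
qed

lemma integral_selected:
  assumes u: "u \<in> {0..1}" and g[measurable]: "g \<in> borel_measurable M"
    and bd: "\<And>x. x \<in> space M \<Longrightarrow> \<bar>g x\<bar> \<le> 1"
  shows "(\<integral>\<omega>. g (fst \<omega>) * indicator {\<omega> \<in> space (coin_space M f0 f1 \<pi>0 \<pi>1 p u).
            selected M f0 f1 \<pi>0 \<pi>1 u \<omega>} \<omega> \<partial>coin_space M f0 f1 \<pi>0 \<pi>1 p u) = (\<integral>x. g x * s u x \<partial>Q)"
    and "(\<integral>\<omega>. g (fst \<omega>) * indicator {\<omega> \<in> space (coin_space M f0 f1 \<pi>0 \<pi>1 p u).
            \<not> selected M f0 f1 \<pi>0 \<pi>1 u \<omega>} \<omega> \<partial>coin_space M f0 f1 \<pi>0 \<pi>1 p u)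
          = (\<integral>x. g x * (1 - s u x) \<partial>Q)"
proof -
  let ?P = "coin_space M f0 f1 \<pi>0 \<pi>1 p u"
  let ?sel = "\<lambda>x c. W x < q u \<or> W x = q u \<and> c"
  have "(\<integral>\<omega>. g (fst \<omega>) * indicator {\<omega> \<in> space ?P. selected M f0 f1 \<pi>0 \<pi>1 u \<omega>} \<omega> \<partial>?P)
      = (\<integral>\<omega>. g (fst \<omega>) * of_bool (?sel (fst \<omega>) (snd \<omega>)) \<partial>?P)"
    by (intro Bochner_Integration.integral_cong)
      (auto simp: selected_def W_def q_def indicator_def case_prod_beta)
  also have "\<dots> = (\<integral>x. g x * of_bool (?sel x True) * p u + g x * of_bool (?sel x False) * (1 - p u) \<partial>Q)"
    by (rule integral_coin_space[OF u]) (use bd in \<open>auto simp: of_bool_def\<close>)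
  also have "\<dots> = (\<integral>x. g x * s u x \<partial>Q)"
    by (intro Bochner_Integration.integral_cong) (auto simp: s_def algebra_simps)
  finally show "(\<integral>\<omega>. g (fst \<omega>) * indicator {\<omega> \<in> space ?P. selected M f0 f1 \<pi>0 \<pi>1 u \<omega>} \<omega> \<partial>?P)
      = (\<integral>x. g x * s u x \<partial>Q)" .
  have "(\<integral>\<omega>. g (fst \<omega>) * indicator {\<omega> \<in> space ?P. \<not> selected M f0 f1 \<pi>0 \<pi>1 u \<omega>} \<omega> \<partial>?P)
      = (\<integral>\<omega>. g (fst \<omega>) * of_bool (\<not> ?sel (fst \<omega>) (snd \<omega>)) \<partial>?P)"
    by (intro Bochner_Integration.integral_cong)
      (auto simp: selected_def W_def q_def indicator_def case_prod_beta)
  also have "\<dots> = (\<integral>x. g x * of_bool (\<not> ?sel x True) * p u + g x * of_bool (\<not> ?sel x False) * (1 - p u) \<partial>Q)"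
    by (rule integral_coin_space[OF u]) (use bd in \<open>auto simp: of_bool_def\<close>)
  also have "\<dots> = (\<integral>x. g x * (1 - s u x) \<partial>Q)"
    by (intro Bochner_Integration.integral_cong) (auto simp: s_def algebra_simps)
  finally show "(\<integral>\<omega>. g (fst \<omega>) * indicator {\<omega> \<in> space ?P. \<not> selected M f0 f1 \<pi>0 \<pi>1 u \<omega>} \<omega> \<partial>?P)
      = (\<integral>x. g x * (1 - s u x) \<partial>Q)" .
qed

lemma W_fst_measurable: "(\<lambda>\<omega>. W (fst \<omega>)) \<in> borel_measurable (coin_space M f0 f1 \<pi>0 \<pi>1 p u)"
  unfolding coin_space_def Q_def[symmetric] by measurable

lemma measure_selected:
  assumes u: "u \<in> {0..1}"
  shows "measure (coin_space M f0 f1 \<pi>0 \<pi>1 p u) {\<omega> \<in> space (coin_space M f0 f1 \<pi>0 \<pi>1 p u).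
            selected M f0 f1 \<pi>0 \<pi>1 u \<omega>} = u"
    and "measure (coin_space M f0 f1 \<pi>0 \<pi>1 p u) {\<omega> \<in> space (coin_space M f0 f1 \<pi>0 \<pi>1 p u).
            \<not> selected M f0 f1 \<pi>0 \<pi>1 u \<omega>} = 1 - u"
  using integral_selected[OF u, of "\<lambda>_. 1"] u
  by (simp_all add: integral_s Q.prob_space Int_absorb2)

lemma a_eq:
  assumes "u \<in> {0<..1}"
  shows "a u = A u / u"
proof -
  let ?P = "coin_space M f0 f1 \<pi>0 \<pi>1 p u"
  let ?S = "{\<omega> \<in> space ?P. selected M f0 f1 \<pi>0 \<pi>1 u \<omega>}"
  have u: "u \<in> {0..1}" "u > 0" using assms by auto
  have "a u = (\<integral>\<omega>. W (fst \<omega>) \<partial>uniform_measure ?P ?S)"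
    using assms by (simp add: a_fun_def Let_def W_def)
  also have "\<dots> = (\<integral>\<omega>. W (fst \<omega>) * indicator ?S \<omega> \<partial>?P) / measure ?P ?S"
    by (rule integral_uniform_measure_prob[OF prob_space_coin selected_sets(1) _ W_fst_measurable])
      (simp only: measure_selected(1)[OF u(1)] u(2))
  also have "\<dots> = A u / u"
    using integral_selected(1)[OF u(1) W_measurable] W_bounds
    by (simp only: measure_selected(1)[OF u(1)] A_def abs_of_nonneg)
  finally show ?thesis .
qed

lemma b_eq:
  assumes "u \<in> {0..<1}"
  shows "b u = (\<pi>1 - u + A u) / (1 - u)"
proof -
  let ?P = "coin_space M f0 f1 \<pi>0 \<pi>1 p u"
  let ?S = "{\<omega> \<in> space ?P. \<not> selected M f0 f1 \<pi>0 \<pi>1 u \<omega>}"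
  have u: "u \<in> {0..1}" "u < 1" using assms by auto
  have "b u = (\<integral>\<omega>. 1 - W (fst \<omega>) \<partial>uniform_measure ?P ?S)"
    using assms by (simp add: b_fun_def Let_def W_def)
  also have "\<dots> = (\<integral>\<omega>. (1 - W (fst \<omega>)) * indicator ?S \<omega> \<partial>?P) / measure ?P ?S"
    by (rule integral_uniform_measure_prob[OF prob_space_coin selected_sets(2)])
      (use u in \<open>auto simp: measure_selected(2)[OF u(1)] intro!: borel_measurable_diff W_fst_measurable\<close>)
  also have "(\<integral>\<omega>. (1 - W (fst \<omega>)) * indicator ?S \<omega> \<partial>?P) = (\<integral>x. (1 - W x) * (1 - s u x) \<partial>Q)"
    by (rule integral_selected(2)[OF u(1), of "\<lambda>x. 1 - W x"])
      (use W_bounds in \<open>auto simp: abs_le_iff add_increasing2\<close>)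
  finally show ?thesis
    by (simp only: measure_selected(2)[OF u(1)] B_eq[OF u(1)])
qed

lemma a_0 [simp]: "a 0 = 0" and b_1 [simp]: "b 1 = 0"
  by (simp_all add: a_fun_def b_fun_def)

lemma a_1: "a 1 = \<pi>0"
  by (simp add: a_eq A_1)

lemma a_nonneg: "u \<in> {0..1} \<Longrightarrow> 0 \<le> a u"
  using A_nonneg[of u] by (cases "u = 0") (auto simp: a_eq)

lemma b_nonneg: "u \<in> {0..1} \<Longrightarrow> 0 \<le> b u"
  using B_nonneg[of u] by (cases "u = 1") (auto simp: b_eq)

section \<open>Monotonicity of the error curves, and tests without false discoveries\<close>

lemma a_mono:
  assumes "0 \<le> u" "u \<le> v" "v \<le> 1"
  shows "a u \<le> a v"
proof (cases "u = 0")
  case True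
  then show ?thesis using a_nonneg[of v] assms by simp
next
  case False
  then have "0 < u" "0 < v" using assms by auto
  then show ?thesis
    using A_scale[of u v] assms by (simp add: a_eq field_simps)
qed

lemma b_antimono:
  assumes "0 \<le> u" "u \<le> v" "v \<le> 1"
  shows "b v \<le> b u"
proof (cases "v = 1")
  case True
  then show ?thesis using b_nonneg[of u] assms by simp
next
  case False
  then have "u < 1" "v < 1" using assms by auto
  then have "b v = (\<pi>1 - v + A v) / (1 - v)" "b u = (\<pi>1 - u + A u) / (1 - u)"
    using assms by (auto simp: b_eq)
  moreover have "(\<pi>1 - v + A v) / (1 - v) \<le> (((1 - v) / (1 - u)) * (\<pi>1 - u + A u)) / (1 - v)"
    using assms \<open>u < 1\<close> \<open>v < 1\<close> by (intro divide_right_mono B_scale) auto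
  moreover have "(((1 - v) / (1 - u)) * (\<pi>1 - u + A u)) / (1 - v) = (\<pi>1 - u + A u) / (1 - u)"
    using \<open>v < 1\<close> by simp
  ultimately show ?thesis by simp
qed

lemma a_le: "u \<in> {0..1} \<Longrightarrow> a u \<le> \<pi>0"
  using a_mono[of u 1] by (simp add: a_1)

lemma b_0: "b 0 = \<pi>1"
  by (simp add: b_eq A_0)

lemma b_le: "u \<in> {0..1} \<Longrightarrow> b u \<le> \<pi>1"
  using b_antimono[of 0 u] by (simp add: b_0)

text \<open>The tie-breaker \<open>p\<close> is chosen separately for each \<open>u\<close>, without
  any regularity; measurability comes from monotonicity alone.\<close>

lemma ab_measurable:
  "a \<in> borel_measurable (restrict_space borel {0..1})"
  "b \<in> borel_measurable (restrict_space borel {0..1})"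
proof -
  show "a \<in> borel_measurable (restrict_space borel {0..1})"
    by (rule borel_measurable_mono_on_fnc) (auto simp: mono_on_def intro!: a_mono)
  have "(\<lambda>u. - b u) \<in> borel_measurable (restrict_space borel {0..1})"
    by (rule borel_measurable_mono_on_fnc) (auto simp: mono_on_def intro!: b_antimono)
  then show "b \<in> borel_measurable (restrict_space borel {0..1})"
    using borel_measurable_uminus[of "\<lambda>u. - b u"] by simp
qed

text \<open>The largest size of a test without false discoveries: \<open>A\<close> vanishes at
  \<open>u0\<close> and is positive beyond it. It determines the optimum at level 0.\<close>

definition u0 :: real where "u0 = measure Q {x \<in> space M. W x = 0}"

text \<open>If \<open>W\<close> vanished almost surely, so would its mean
  \<open>\<pi>0\<close>.\<close>

lemma u0_bounds: "0 \<le> u0" "u0 < 1"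
proof -
  show "0 \<le> u0" by (simp add: u0_def)
  show "u0 < 1"
  proof (rule ccontr)
    assume "\<not> u0 < 1"
    then have "u0 = 1" using Q.prob_le_1 by (simp add: u0_def antisym not_less)
    then have "AE x in Q. x \<in> {x \<in> space M. W x = 0}"
      unfolding u0_def by (intro Q.AE_prob_1) auto
    then have "AE x in Q. W x = 0" by auto
    then have "(\<integral>x. W x \<partial>Q) = (\<integral>x. 0 \<partial>Q)"
      by (intro integral_cong_AE) auto
    then show False using integral_W \<pi>0_pos by simp
  qed
qed

lemma A_u0: "A u0 = 0"
proof -
  have "A u0 \<le> (\<integral>x. W x * indicator {x \<in> space M. W x = 0} x \<partial>Q)"
    using u0_bounds by (intro A_le_integral) (auto simp: u0_def Int_absorb2)
  also have "\<dots> = (\<integral>x. 0 \<partial>Q)"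
    by (intro Bochner_Integration.integral_cong) (auto simp: indicator_def)
  finally show ?thesis using A_nonneg[of u0] u0_bounds by simp
qed

lemma a_u0: "a u0 = 0"
  using u0_bounds A_u0 by (cases "u0 = 0") (auto simp: a_eq)

text \<open>If \<open>A u\<close> were 0, the test \<open>s u\<close> would reject almost surely
  only where \<open>W\<close> vanishes, and its size would be at most \<open>u0\<close>.\<close>

lemma A_pos:
  assumes "u0 < u" "u \<le> 1"
  shows "0 < A u"
proof (rule ccontr)
  have u: "u \<in> {0..1}" using assms u0_bounds by auto
  assume "\<not> 0 < A u"
  then have "(\<integral>x. W x * s u x \<partial>Q) = 0" using A_nonneg[OF u] by (simp add: A_def)
  then have "AE x in Q. W x * s u x = 0"
    using u W_bounds s_bounds by (subst (asm) integral_nonneg_eq_0_iff_AE) auto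
  then have "AE x in Q. s u x \<le> indicator {x \<in> space M. W x = 0} x"
    by (rule AE_mp[OF _ AE_I2]) (use s_bounds[OF u] in \<open>auto simp: indicator_def\<close>)
  then have "(\<integral>x. s u x \<partial>Q) \<le> (\<integral>x. indicator {x \<in> space M. W x = 0} x \<partial>Q)"
    using u s_bounds[OF u] by (intro integral_mono_AE integrable_Q[where B = 1]) (auto simp: indicator_def)
  then show False
    using assms u by (simp add: integral_s u0_def Int_absorb2)
qed

end

subsection \<open>The convex minorant\<close>

context two_groups
begin

abbreviation laws :: "real measure set" where
  "laws \<equiv> space (prob_algebra (restrict_space borel {0..1}))"

abbreviation bs :: "real \<Rightarrow> real" where "bs \<equiv> b_star M f0 f1 \<pi>0 \<pi>1 p"

abbreviation bss :: "real \<Rightarrow> real" where "bss \<equiv> b_star_star M f0 f1 \<pi>0 \<pi>1 p"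

lemma law_space:
  assumes "N \<in> laws"
  shows "prob_space N" "sets N = sets (restrict_space borel {0..1})" "space N = {0..1}"
  using assms sets_eq_imp_space_eq[of N "restrict_space borel {0..1}"]
  by (auto simp: space_prob_algebra space_restrict_space)

lemma abs_ab_le: "u \<in> {0..1} \<Longrightarrow> \<bar>a u\<bar> \<le> 1" "u \<in> {0..1} \<Longrightarrow> \<bar>b u\<bar> \<le> 1"
  using a_nonneg[of u] a_le[of u] b_nonneg[of u] b_le[of u] \<pi>_less_1 by auto

lemma law_integrable [simp]:
  assumes N: "N \<in> laws"
  shows "integrable N a" "integrable N b"
proof -
  interpret prob_space N by (rule law_space[OF N])
  have [measurable]: "a \<in> borel_measurable N" "b \<in> borel_measurable N"
    using ab_measurable measurable_cong_sets[OF law_space(2)[OF N] refl] by auto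
  show "integrable N a" "integrable N b"
    by (auto intro!: integrable_const_bound[where B = 1] AE_I2 simp: law_space[OF N] abs_ab_le)
qed

lemma law_integral_nonneg:
  assumes N: "N \<in> laws"
  shows "0 \<le> (\<integral>u. b u \<partial>N)"
  using b_nonneg by (intro integral_nonneg_AE AE_I2) (auto simp: law_space[OF N])

lemma bss_le:
  assumes "N \<in> laws" "(\<integral>u. a u \<partial>N) \<le> \<alpha>"
  shows "bss \<alpha> \<le> (\<integral>u. b u \<partial>N)"
  unfolding b_star_star_def using assms
  by (intro cINF_lower bdd_belowI2[where m = 0]) (auto intro: law_integral_nonneg)

lemma point_law:
  assumes "u \<in> {0..1}"
  shows "return (restrict_space borel {0..1}) u \<in> laws"
    and "(\<integral>v. a v \<partial>return (restrict_space borel {0..1}) u) = a u"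
    and "(\<integral>v. b v \<partial>return (restrict_space borel {0..1}) u) = b u"
  using assms ab_measurable
  by (auto simp: space_prob_algebra prob_space_return space_restrict_space integral_return)

lemma bss_greatest:
  assumes "0 \<le> \<alpha>" "\<And>N. N \<in> laws \<Longrightarrow> (\<integral>u. a u \<partial>N) \<le> \<alpha> \<Longrightarrow> y \<le> (\<integral>u. b u \<partial>N)"
  shows "y \<le> bss \<alpha>"
  unfolding b_star_star_def
proof (rule cINF_greatest)
  show "{N \<in> laws. (\<integral>u. a u \<partial>N) \<le> \<alpha>} \<noteq> {}"
    using point_law[of 0] assms(1) by auto
qed (use assms in auto)

lemma bss_le_b: "u \<in> {0..1} \<Longrightarrow> a u \<le> \<alpha> \<Longrightarrow> bss \<alpha> \<le> b u"
  using bss_le[OF point_law(1), of u \<alpha>] by (simp add: point_law)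

lemma bss_nonneg: "0 \<le> \<alpha> \<Longrightarrow> 0 \<le> bss \<alpha>"
  by (rule bss_greatest) (auto intro: law_integral_nonneg)

lemma bss_antimono: "0 \<le> \<alpha> \<Longrightarrow> \<alpha> \<le> \<beta> \<Longrightarrow> bss \<beta> \<le> bss \<alpha>"
  by (rule bss_greatest) (auto intro: bss_le)

lemma bss_1: "bss 1 = 0"
  using bss_nonneg[of 1] bss_le_b[of 1 1] a_1 \<pi>_less_1 by simp

lemma mixed_law:
  assumes N1: "N1 \<in> laws" and N2: "N2 \<in> laws" and t: "0 \<le> t" "t \<le> 1"
  obtains N where "N \<in> laws"
    "(\<integral>u. a u \<partial>N) = t * (\<integral>u. a u \<partial>N1) + (1 - t) * (\<integral>u. a u \<partial>N2)"
    "(\<integral>u. b u \<partial>N) = t * (\<integral>u. b u \<partial>N1) + (1 - t) * (\<integral>u. b u \<partial>N2)"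
proof -
  let ?B = "measure_pmf (bernoulli_pmf t)" and ?f = "\<lambda>c. if c then N1 else N2"
  let ?N = "?B \<bind> ?f"
  have f: "?f \<in> count_space UNIV \<rightarrow>\<^sub>M prob_algebra (restrict_space borel {0..1})"
    using N1 N2 by auto
  have B: "?B \<in> space (prob_algebra (count_space UNIV))"
    by (simp add: space_prob_algebra measure_pmf.prob_space_axioms)
  have "?N \<in> laws"
    using prob_space_bind'[OF B f] sets_bind'[OF B f] by (simp add: space_prob_algebra)
  moreover have "(\<integral>u. g u \<partial>?N) = t * (\<integral>u. g u \<partial>N1) + (1 - t) * (\<integral>u. g u \<partial>N2)"
    if g: "g \<in> borel_measurable (restrict_space borel {0..1})" "\<And>u. u \<in> {0..1} \<Longrightarrow> \<bar>g u\<bar> \<le> 1"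
    for g :: "real \<Rightarrow> real"
  proof -
    have "(\<integral>u. g u \<partial>?N) = (\<integral>c. (\<integral>u. g u \<partial>?f c) \<partial>?B)"
      by (rule integral_bind[OF g(1), where B = 1 and B' = 1])
        (use g measurable_prob_algebraD[OF f] law_space[OF N1] law_space[OF N2] in
          \<open>auto simp: space_restrict_space measure_pmf.finite_measure_axioms
            prob_space.emeasure_space_1\<close>)
    then show ?thesis using t by (simp add: integral_bernoulli_pmf mult.commute)
  qed
  ultimately show thesis using ab_measurable abs_ab_le by (intro that[of ?N]) auto
qed

lemma bss_convex: "convex_on {0..1} bss"
proof (rule convex_onI)
  fix t \<alpha>1 \<alpha>2 :: real
  assume t: "0 < t" "t < 1" and \<alpha>: "\<alpha>1 \<in> {0..1}" "\<alpha>2 \<in> {0..1}"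
  have step: "bss ((1 - t) * \<alpha>1 + t * \<alpha>2) \<le> (1 - t) * (\<integral>u. b u \<partial>N1) + t * (\<integral>u. b u \<partial>N2)"
    if N1: "N1 \<in> laws" "(\<integral>u. a u \<partial>N1) \<le> \<alpha>1" and N2: "N2 \<in> laws" "(\<integral>u. a u \<partial>N2) \<le> \<alpha>2" for N1 N2
  proof -
    obtain N where N: "N \<in> laws"
      "(\<integral>u. a u \<partial>N) = (1 - t) * (\<integral>u. a u \<partial>N1) + (1 - (1 - t)) * (\<integral>u. a u \<partial>N2)"
      "(\<integral>u. b u \<partial>N) = (1 - t) * (\<integral>u. b u \<partial>N1) + (1 - (1 - t)) * (\<integral>u. b u \<partial>N2)"
      using mixed_law[OF N1(1) N2(1), of "1 - t"] t by auto
    have "(\<integral>u. a u \<partial>N) \<le> (1 - t) * \<alpha>1 + t * \<alpha>2"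
      unfolding N(2) using t N1 N2 by (intro add_mono mult_left_mono) auto
    from bss_le[OF N(1) this] show ?thesis by (simp add: N(3))
  qed
  \<comment> \<open>The bound is solved for one integral at a time, because
    \<open>bss_greatest\<close> passes to the infimum over a single law; \<open>t\<close> and
    \<open>1 - t\<close> are positive, which permits the divisions.\<close>
  have "(bss ((1 - t) * \<alpha>1 + t * \<alpha>2) - t * (\<integral>u. b u \<partial>N2)) / (1 - t) \<le> bss \<alpha>1"
    if "N2 \<in> laws" "(\<integral>u. a u \<partial>N2) \<le> \<alpha>2" for N2
    using step[OF _ _ that] t \<alpha> by (intro bss_greatest) (auto simp: divide_le_eq algebra_simps)
  then have "(bss ((1 - t) * \<alpha>1 + t * \<alpha>2) - (1 - t) * bss \<alpha>1) / t \<le> bss \<alpha>2"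
    using t \<alpha> by (intro bss_greatest) (auto simp: divide_le_eq algebra_simps)
  then show "bss ((1 - t) *\<^sub>R \<alpha>1 + t *\<^sub>R \<alpha>2) \<le> (1 - t) * bss \<alpha>1 + t * bss \<alpha>2"
    using t by (simp add: divide_le_eq algebra_simps)
qed simp

text \<open>A supporting line of \<open>C\<close> at the interior point \<open>\<alpha>\<close> lies
  below every point \<open>(a u, b u)\<close>; if it does not increase, averaging over a law gives
  the claim. The bound on \<open>C\<close> is asked for only at levels strictly above
  \<open>a u\<close>, which is all that a test with vanishing error supplies; the gap is closed
  along the line.\<close>

lemma convex_le_bss:
  assumes C: "convex_on {0..1} C" and \<alpha>: "0 < \<alpha>" "\<alpha> < 1"
    and Cb: "\<And>u \<beta>. u \<in> {0..1} \<Longrightarrow> a u < \<beta> \<Longrightarrow> \<beta> \<le> 1 \<Longrightarrow> C \<beta> \<le> b u"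
  shows "C \<alpha> \<le> bss \<alpha>"
proof -
  obtain k where k: "\<And>y. y \<in> {0..1} \<Longrightarrow> C \<alpha> + k * (y - \<alpha>) \<le> C y"
    using convex_le_Inf_differential[OF C, of \<alpha>] \<alpha> by (auto simp: interior_atLeastAtMost_real)
  have line: "C \<alpha> + k * (a u - \<alpha>) \<le> b u" if u: "u \<in> {0..1}" for u
  proof (rule field_le_epsilon)
    fix e :: real assume e: "0 < e"
    \<comment> \<open>The first entry keeps the level in [0, 1], with room to spare because
      \<open>a u \<le> \<pi>0 < 1\<close>; the second makes the change along a line of slope
      \<open>k\<close> at most \<open>e\<close>.\<close>
    define h where "h = min (1 - a u) (e / (\<bar>k\<bar> + 1))"
    have h: "0 < h" "a u + h \<le> 1" "h \<le> e / (\<bar>k\<bar> + 1)"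
      using e a_le[OF u] \<pi>_less_1 by (auto simp: h_def)
    have "- k * h \<le> (\<bar>k\<bar> + 1) * h"
      using h by (intro mult_right_mono) auto
    also have "\<dots> \<le> e" using h(3) by (simp add: field_simps)
    finally have "- k * h \<le> e" .
    moreover have "C \<alpha> + k * (a u + h - \<alpha>) \<le> C (a u + h)"
      using h a_nonneg[OF u] by (intro k) auto
    moreover have "C (a u + h) \<le> b u" using h by (intro Cb u) auto
    ultimately show "C \<alpha> + k * (a u - \<alpha>) \<le> b u + e" by (simp add: algebra_simps)
  qed
  show ?thesis
  proof (rule bss_greatest)
    fix N assume N: "N \<in> laws" "(\<integral>u. a u \<partial>N) \<le> \<alpha>"
    interpret prob_space N by (rule law_space[OF N(1)])
    show "C \<alpha> \<le> (\<integral>u. b u \<partial>N)"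
    proof (cases "k \<le> 0")
      case True
      have "C \<alpha> \<le> C \<alpha> + k * ((\<integral>u. a u \<partial>N) - \<alpha>)"
        using True N(2) by (simp add: mult_nonpos_nonpos)
      also have "\<dots> = (\<integral>u. C \<alpha> + k * (a u - \<alpha>) \<partial>N)"
        using N(1) by (simp add: prob_space)
      also have "\<dots> \<le> (\<integral>u. b u \<partial>N)"
        using N(1) line by (intro integral_mono) (auto simp: law_space[OF N(1)])
      finally show ?thesis .
    next
      case False
      \<comment> \<open>For an increasing line the constraint on the mean of \<open>a\<close> points
        the wrong way. Following the line up to level 1 helps instead, since \<open>b 1 = 0\<close>
        caps it there.\<close>
      then have "C \<alpha> \<le> C \<alpha> + k * (1 - \<alpha>)" using \<alpha> by simp
      also have "\<dots> \<le> C 1" by (rule k) simp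
      also have "C 1 \<le> b 1" by (rule Cb) (simp_all add: a_1 \<pi>_less_1)
      also have "\<dots> \<le> (\<integral>u. b u \<partial>N)" using law_integral_nonneg[OF N(1)] by simp
      finally show ?thesis .
    qed
  qed (use \<alpha> in simp)
qed

text \<open>Convexity gives no continuity at level 0, so a line is constructed by hand. Just above
  \<open>u0\<close> lies a size \<open>u'\<close> with \<open>a u' > 0\<close>, and
  \<open>b u' - a u / a u'\<close> stays below \<open>b u\<close> for all \<open>u\<close>: up to
  \<open>u'\<close> because \<open>b\<close> is antimonotone, beyond it because the left side is not
  positive. Averaging shows that a small mean of \<open>a\<close> can lower the mean of
  \<open>b\<close> only slightly.\<close>

lemma bss_near_0:
  assumes "0 < \<zeta>"
  obtains \<epsilon> where "0 < \<epsilon>" "b u0 - \<zeta> \<le> bss \<epsilon>"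
proof -
  \<comment> \<open>The first entry keeps \<open>u'\<close> below 1; the second makes
    \<open>h / (1 - u0)\<close>, which bounds the drop of \<open>b\<close> from \<open>u0\<close> to
    \<open>u'\<close>, at most \<open>\<zeta> / 2\<close>.\<close>
  define h where "h = min ((1 - u0) / 2) (\<zeta> * (1 - u0) / 2)"
  define u' where "u' = u0 + h"
  have h: "0 < h" using assms u0_bounds by (simp add: h_def)
  have h2: "h \<le> (1 - u0) / 2" unfolding h_def by (rule min.cobounded1)
  have h3: "h \<le> \<zeta> * (1 - u0) / 2" unfolding h_def by (rule min.cobounded2)
  have u': "u0 < u'" "u' < 1" "0 < u'" "u' \<in> {0..1}"
    using h h2 u0_bounds by (auto simp: u'_def)
  have pos: "0 < a u'" using u' A_pos[of u'] by (simp add: a_eq)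
  have "b u0 - \<zeta> / 2 \<le> b u0 - h / (1 - u0)"
    using h3 u0_bounds by (simp add: field_simps)
  also have "\<dots> = (\<pi>1 - u' + A u0) / (1 - u0)"
    using u0_bounds by (simp add: b_eq u'_def diff_divide_distrib[symmetric] algebra_simps)
  also have "\<dots> \<le> (\<pi>1 - u' + A u') / (1 - u0)"
    using u0_bounds u' A_mono[of u0 u'] by (intro divide_right_mono) auto
  also have "\<dots> \<le> (\<pi>1 - u' + A u') / (1 - u')"
    using u' u0_bounds B_nonneg[of u'] by (intro divide_left_mono) auto
  also have "\<dots> = b u'" using u' by (simp add: b_eq)
  finally have bu': "b u0 - \<zeta> / 2 \<le> b u'" .
  \<comment> \<open>Chosen so that \<open>\<epsilon> / a u'\<close> is the remaining half of
    \<open>\<zeta>\<close>.\<close>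
  define \<epsilon> where "\<epsilon> = a u' * \<zeta> / 2"
  have \<epsilon>: "0 < \<epsilon>" using assms pos by (simp add: \<epsilon>_def)
  have "b u' - \<zeta> / 2 \<le> bss \<epsilon>"
  proof (rule bss_greatest)
    fix N assume N: "N \<in> laws" "(\<integral>u. a u \<partial>N) \<le> \<epsilon>"
    interpret prob_space N by (rule law_space[OF N(1)])
    have line: "b u' - a u / a u' \<le> b u" if u: "u \<in> {0..1}" for u
    proof (cases "u \<le> u'")
      case True
      then have "b u' \<le> b u" using u u' by (intro b_antimono) auto
      moreover have "0 \<le> a u / a u'" using pos a_nonneg[OF u] by simp
      ultimately show ?thesis by linarith
    next
      case False
      then have "1 \<le> a u / a u'" using u u' pos by (auto intro!: a_mono)
      then show ?thesis using b_nonneg[OF u] b_le[OF u'(4)] \<pi>_less_1 by linarith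
    qed
    have "b u' - \<zeta> / 2 \<le> b u' - (\<integral>u. a u \<partial>N) / a u'"
      using N(2) pos by (simp add: \<epsilon>_def field_simps)
    also have "\<dots> = (\<integral>u. b u' - a u / a u' \<partial>N)"
      using N(1) by (simp add: prob_space)
    also have "\<dots> \<le> (\<integral>u. b u \<partial>N)"
      using N(1) line by (intro integral_mono) (auto simp: law_space[OF N(1)])
    finally show "b u' - \<zeta> / 2 \<le> (\<integral>u. b u \<partial>N)" .
  qed (use \<epsilon> in simp)
  then show thesis using bu' \<epsilon> by (intro that[of \<epsilon>]) auto
qed

lemma bss_0: "bss 0 = b u0"
proof (rule antisym)
  show "bss 0 \<le> b u0" using u0_bounds by (intro bss_le_b) (auto simp: a_u0)
  show "b u0 \<le> bss 0"
  proof (rule field_le_epsilon)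
    fix e :: real assume "0 < e"
    then obtain \<epsilon> where "0 < \<epsilon>" "b u0 - e \<le> bss \<epsilon>" by (rule bss_near_0)
    then show "b u0 \<le> bss 0 + e" using bss_antimono[of 0 \<epsilon>] by simp
  qed
qed

text \<open>The law built from a rule meets the level only up to an error, which this absorbs. In
  the interior it is the continuity of convex functions, at 0 the line constructed above.\<close>

lemma bss_right_continuous:
  assumes \<alpha>: "0 \<le> \<alpha>" "\<alpha> < 1" and \<zeta>: "0 < \<zeta>"
  obtains \<epsilon> where "0 < \<epsilon>" "bss \<alpha> - \<zeta> \<le> bss (\<alpha> + \<epsilon>)"
proof (cases "\<alpha> = 0")
  case True
  obtain \<epsilon> where "0 < \<epsilon>" "b u0 - \<zeta> \<le> bss \<epsilon>" using \<zeta> by (rule bss_near_0)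
  then show thesis using True by (intro that[of \<epsilon>]) (auto simp: bss_0)
next
  case False
  have "continuous_on {0<..<1} bss"
    by (rule convex_on_continuous) (auto intro: convex_on_subset[OF bss_convex])
  then have "isCont bss \<alpha>"
    using False \<alpha> by (auto simp: continuous_on_eq_continuous_at)
  then obtain d where d: "0 < d" "\<And>x. dist x \<alpha> < d \<Longrightarrow> dist (bss x) (bss \<alpha>) < \<zeta>"
    using \<zeta> unfolding continuous_at_eps_delta by (metis dist_norm)
  have "dist (bss (\<alpha> + d / 2)) (bss \<alpha>) < \<zeta>"
    using d(1) by (intro d(2)) (simp add: dist_real_def)
  then show thesis using d(1) by (intro that[of "d / 2"]) (auto simp: dist_real_def)
qed

section \<open>Comparison with the function \<open>bs\<close>\<close>

lemma bs_le: "u \<in> {0..1} \<Longrightarrow> a u \<le> \<alpha> \<Longrightarrow> bs \<alpha> \<le> b u"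
  unfolding b_star_def by (intro cINF_lower bdd_belowI2[where m = 0]) (auto intro: b_nonneg)

lemma bss_le_bs: "0 \<le> \<alpha> \<Longrightarrow> bss \<alpha> \<le> bs \<alpha>"
  unfolding b_star_def by (rule cINF_greatest) (auto intro: bss_le_b exI[of _ 0])

text \<open>Supporting lines are available only in the interior. At 0 and 1 a competitor is compared
  with \<open>bs\<close> itself, which there is at most \<open>b u0\<close> and \<open>b 1\<close>,
  the values of \<open>bss\<close>.\<close>

lemma bss_eq_minorant:
  assumes \<alpha>: "\<alpha> \<in> {0..1}"
  shows "bss \<alpha> = greatest_convex_minorant bs \<alpha>"
  unfolding greatest_convex_minorant_def
proof (rule cSup_eq_maximum[symmetric])
  show "bss \<alpha> \<in> (\<lambda>C. C \<alpha>) ` {C. convex_on {0..1} C \<and> (\<forall>y\<in>{0..1}. C y \<le> bs y)}"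
    using bss_convex bss_le_bs by auto
next
  fix y assume "y \<in> (\<lambda>C. C \<alpha>) ` {C. convex_on {0..1} C \<and> (\<forall>y\<in>{0..1}. C y \<le> bs y)}"
  then obtain C where y: "y = C \<alpha>" and C: "convex_on {0..1} C" "\<And>y. y \<in> {0..1} \<Longrightarrow> C y \<le> bs y"
    by auto
  consider "\<alpha> = 0" | "\<alpha> = 1" | "0 < \<alpha>" "\<alpha> < 1" using \<alpha> by fastforce
  then show "y \<le> bss \<alpha>"
  proof cases
    case 1
    then show ?thesis
      using C(2)[of 0] bs_le[of u0 0] u0_bounds by (simp add: y bss_0 a_u0)
  next
    case 2
    then show ?thesis
      using C(2)[of 1] bs_le[of 1 1] \<pi>_less_1 by (simp add: y bss_1 a_1)
  next
    case 3
    show ?thesis unfolding y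
    proof (rule convex_le_bss[OF C(1) 3])
      fix u \<beta> assume u: "u \<in> {0..1}" "a u < \<beta>" "\<beta> \<le> 1"
      then show "C \<beta> \<le> b u"
        using C(2)[of \<beta>] bs_le[of u \<beta>] a_nonneg[of u] by auto
    qed
  qed
qed

end

subsection \<open>Exponential bounds\<close>

text \<open>For negative y = -z the claim follows from \<open>1 + z \<le> exp z\<close> and (1 - z +
  z^2) (1 + z) = 1 + z^3, which is at least 1.\<close>

lemma exp_le_quadratic:
  fixes y :: real
  assumes "y \<le> 1"
  shows "exp y \<le> 1 + y + y\<^sup>2"
proof (cases "0 \<le> y")
  case True
  then show ?thesis using exp_bound assms by simp
next
  case False
  define z where "z = - y"
  have z: "0 < z" using False by (simp add: z_def)
  have "1 \<le> (1 - z + z\<^sup>2) * (1 + z)"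
    using z by (simp add: algebra_simps power2_eq_square)
  also have "\<dots> \<le> (1 - z + z\<^sup>2) * exp z"
  proof (rule mult_left_mono)
    show "1 + z \<le> exp z" by simp
    have "1 - z + z\<^sup>2 = (1 - z / 2)\<^sup>2 + 3 * z\<^sup>2 / 4"
      by (simp add: power2_eq_square algebra_simps)
    then show "0 \<le> 1 - z + z\<^sup>2" by simp
  qed
  finally have "exp (- z) \<le> 1 - z + z\<^sup>2"
    by (simp add: exp_minus field_simps)
  then show ?thesis by (simp add: z_def)
qed

text \<open>The binomial law with success probability \<open>k / n\<close> has its mode at
  \<open>k\<close>, and the largest of \<open>n + 1\<close> probabilities is at least their average.
  The polynomial loss is negligible against exponentials, so Stirling's formula is avoided.\<close>

lemma binomial_mode_lower:
  assumes k: "k \<le> n" and n: "0 < n"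
  shows "1 \<le> real (n + 1) * (real (n choose k) * (k / n) ^ k * (1 - k / n) ^ (n - k))"
proof (cases "k = 0 \<or> k = n")
  case True
  then show ?thesis using n by auto
next
  case False
  define r where "r = real k / real n"
  have r: "0 < r" "r < 1" using False k n by (auto simp: r_def)
  define T where "T j = real (n choose j) * r ^ j * (1 - r) ^ (n - j)" for j
  have T_nonneg: "0 \<le> T j" for j using r by (simp add: T_def)
  \<comment> \<open>The ratio of consecutive terms, cleared of denominators: whether the terms rise
    or fall depends on how \<open>Suc j * (1 - r)\<close> compares with \<open>(n - j) * r\<close>,
    and the change occurs at \<open>k\<close>.\<close>
  have ratio: "T (Suc j) * (real (Suc j) * (1 - r)) = T j * (real (n - j) * r)" if "j < n" for j
  proof -
    have "Suc j * (n choose Suc j) = (n choose j) * (n - j)"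
      using that by (metis binomial_absorb_comp binomial_absorption mult.commute)
    then have "real (Suc j) * real (n choose Suc j) = real (n choose j) * real (n - j)"
      by (metis of_nat_mult)
    moreover have "(1 - r) ^ (n - j) = (1 - r) ^ (n - Suc j) * (1 - r)"
      using that by (metis Suc_diff_Suc power_Suc2)
    moreover have "T (Suc j) * (real (Suc j) * (1 - r))
        = (real (Suc j) * real (n choose Suc j)) * r ^ Suc j * ((1 - r) ^ (n - Suc j) * (1 - r))"
      by (simp only: T_def ac_simps)
    ultimately have "T (Suc j) * (real (Suc j) * (1 - r))
        = (real (n choose j) * real (n - j)) * r ^ Suc j * (1 - r) ^ (n - j)"
      by (simp only:)
    then show ?thesis by (simp only: T_def power_Suc ac_simps)
  qed
  have rn: "r * real n = real k" using n by (simp add: r_def)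
  have up: "T j \<le> T (Suc j)" if "j < k" for j
  proof -
    have le: "real (Suc j) * (1 - r) \<le> real (n - j) * r"
    proof -
      have "real (Suc j) * (1 - r) \<le> real k * (1 - r)"
        using that r by (intro mult_right_mono) auto
      also have "\<dots> = r * real n - real k * r" by (simp add: rn algebra_simps)
      also have "\<dots> \<le> real (n - j) * r"
        using that k r by (simp add: of_nat_diff algebra_simps)
      finally show ?thesis .
    qed
    have "T j * (real (Suc j) * (1 - r)) \<le> T (Suc j) * (real (Suc j) * (1 - r))"
      using ratio[of j] le that k T_nonneg[of j] by (simp add: mult_left_mono)
    then show ?thesis using r by (simp add: mult_le_cancel_right)
  qed
  have down: "T (Suc j) \<le> T j" if "k \<le> j" "j < n" for j
  proof -
    have le: "real (n - j) * r \<le> real (Suc j) * (1 - r)"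
    proof -
      have "real (n - j) * r \<le> real (n - k) * r"
        using that r by (intro mult_right_mono) auto
      also have "\<dots> = real k * (1 - r)"
        using k rn by (simp add: of_nat_diff algebra_simps)
      also have "\<dots> \<le> real (Suc j) * (1 - r)"
        using that r by (intro mult_right_mono) auto
      finally show ?thesis .
    qed
    have "T (Suc j) * (real (Suc j) * (1 - r)) \<le> T j * (real (Suc j) * (1 - r))"
      using ratio[of j] le that T_nonneg[of j] by (simp add: mult_left_mono)
    then show ?thesis using r by (simp add: mult_le_cancel_right)
  qed
  have max: "T j \<le> T k" if j: "j \<le> n" for j
  proof (cases "j \<le> k")
    case True
    then show ?thesis
      by (induction rule: inc_induct) (auto intro: up order_trans)
  next
    case False
    then have "k \<le> j" by simp
    then show ?thesis using j
      by (induction rule: dec_induct) (auto intro: order_trans[OF down])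
  qed
  have "1 = (r + (1 - r)) ^ n" by simp
  also have "\<dots> = (\<Sum>j\<le>n. T j)" unfolding T_def by (rule binomial_ring)
  also have "\<dots> \<le> (\<Sum>j\<le>n. T k)" by (intro sum_mono max) simp
  also have "\<dots> = real (n + 1) * T k" by simp
  finally show ?thesis by (simp add: T_def r_def)
qed

text \<open>The mode bound concerns success probability \<open>r n = k n / n\<close>; replacing it
  by \<open>P1\<close> costs the factor \<open>exp (n * H (r n))\<close>. Here \<open>H x\<close> is
  minus the Kullback-Leibler divergence of the Bernoulli laws with parameters \<open>x\<close> and
  \<open>P1\<close>, which tends to 0 along \<open>r n\<close>.\<close>

lemma binomial_prob_subexponential:
  fixes P0 P1 c :: real and k :: "nat \<Rightarrow> nat"
  assumes P: "0 < P0" "0 < P1" "P0 + P1 = 1" and k: "\<And>n. k n \<le> n"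
    and lim: "(\<lambda>n. real (k n) / real n) \<longlonglongrightarrow> P1" and c: "0 < c"
  shows "\<forall>\<^sub>F n in sequentially.
    exp (- c * n) \<le> real (n + 1) * (real (n choose k n) * P1 ^ k n * P0 ^ (n - k n))"
proof -
  define r where "r n = real (k n) / real n" for n
  define H where "H x = x * ln (P1 / x) + (1 - x) * ln (P0 / (1 - x))" for x
  have "(\<lambda>n. H (r n)) \<longlonglongrightarrow> H P1"
    unfolding H_def r_def using P by (intro tendsto_intros lim) auto
  moreover have "H P1 = 0"
    using P by (simp add: H_def eq_diff_eq[symmetric])
  ultimately have "\<forall>\<^sub>F n in sequentially. - c < H (r n)"
    using c by (intro order_tendstoD(1)[where y = "H P1"]) auto
  moreover have "\<forall>\<^sub>F n in sequentially. 0 < r n" "\<forall>\<^sub>F n in sequentially. r n < 1"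
    unfolding r_def using P by (auto intro: order_tendstoD[OF lim])
  ultimately show ?thesis using eventually_gt_at_top[of 0]
  proof eventually_elim
    case (elim n)
    have "exp (- c * n) \<le> exp (H (r n) * n)"
      using elim mult_right_mono[of "- c" "H (r n)" "real n"] by simp
    also have "H (r n) * n = k n * ln (P1 / r n) + (n - k n) * ln (P0 / (1 - r n))"
      using elim k[of n] by (simp add: H_def r_def field_simps of_nat_diff)
    also have "exp \<dots> = (P1 / r n) ^ k n * (P0 / (1 - r n)) ^ (n - k n)"
      using elim P by (simp add: exp_add exp_of_nat_mult)
    also have "\<dots> \<le> (P1 / r n) ^ k n * (P0 / (1 - r n)) ^ (n - k n)
        * (real (n + 1) * (real (n choose k n) * r n ^ k n * (1 - r n) ^ (n - k n)))"
      using mult_left_mono[OF binomial_mode_lower[OF k, of n, folded r_def],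
          of "(P1 / r n) ^ k n * (P0 / (1 - r n)) ^ (n - k n)"] elim P by simp
    also have "\<dots> = real (n + 1) * (real (n choose k n) * P1 ^ k n * P0 ^ (n - k n))"
      using elim by (simp add: power_divide)
    finally show ?case .
  qed
qed

text \<open>One factor \<open>n + 1\<close> will come from the union over the possible numbers of
  discoveries, the other from the mode bound.\<close>

lemma poly_times_exp_tendsto_0:
  fixes c :: real
  assumes c: "0 < c"
  shows "(\<lambda>n. real (n + 1) ^ 2 * exp (- c * real n)) \<longlonglongrightarrow> 0"
proof (rule tendsto_sandwich[where f = "\<lambda>_. 0"
      and h = "\<lambda>n. (4 / c\<^sup>2) * ((c * real n) ^ 2 / exp (c * real n))"])
  have "filterlim (\<lambda>n. c * real n) at_top sequentially"
    using c by (intro filterlim_tendsto_pos_mult_at_top[OF tendsto_const _ filterlim_real_sequentially])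
  from filterlim_compose[OF tendsto_power_div_exp_0[of 2] this]
  have "(\<lambda>n. (4 / c\<^sup>2) * ((c * real n) ^ 2 / exp (c * real n))) \<longlonglongrightarrow> (4 / c\<^sup>2) * 0"
    by (intro tendsto_intros)
  then show "(\<lambda>n. (4 / c\<^sup>2) * ((c * real n) ^ 2 / exp (c * real n))) \<longlonglongrightarrow> 0" by simp
  show "\<forall>\<^sub>F n in sequentially. real (n + 1) ^ 2 * exp (- c * real n)
      \<le> (4 / c\<^sup>2) * ((c * real n) ^ 2 / exp (c * real n))"
    using eventually_gt_at_top[of 0]
  proof eventually_elim
    case (elim n)
    have "real (n + 1) ^ 2 \<le> (2 * real n) ^ 2"
      using elim by (intro power_mono) auto
    then show ?case
      using c by (simp add: exp_minus field_simps power_mult_distrib)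
  qed
qed auto

subsection \<open>Change of measure to the i.i.d. model\<close>

definition false_discoveries :: "nat \<Rightarrow> (nat \<Rightarrow> nat) \<Rightarrow> (nat \<Rightarrow> nat) \<Rightarrow> real" where
  "false_discoveries n \<theta> \<delta> = (\<Sum>i<n. real (\<delta> i) * (1 - real (\<theta> i)))"

definition discoveries :: "nat \<Rightarrow> (nat \<Rightarrow> nat) \<Rightarrow> nat" where
  "discoveries n \<delta> = (\<Sum>i<n. \<delta> i)"

lemma discoveries_le: "\<delta> \<in> binary_vectors n \<Longrightarrow> discoveries n \<delta> \<le> n"
  using sum_mono[of "{..<n}" \<delta> "\<lambda>_. 1"] binary_vectorsD[of \<delta> n]
  by (force simp: discoveries_def)

context two_groups
begin

text \<open>The conditional probability of \<open>\<theta>\<close> given all observations in the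
  i.i.d. model. The division by prior weights that would make it a density of \<open>x\<close> is
  postponed, which keeps it between 0 and 1.\<close>

definition likelihood :: "nat \<Rightarrow> (nat \<Rightarrow> nat) \<Rightarrow> (nat \<Rightarrow> 'a) \<Rightarrow> real" where
  "likelihood n \<theta> x = (\<Prod>i<n. posterior (\<theta> i) (x i))"

lemma likelihood_measurable [measurable]:
  "likelihood n \<theta> \<in> borel_measurable (PiM {..<n} (\<lambda>_. M))"
  unfolding likelihood_def by measurable

lemma posterior_le_1: "x \<in> space M \<Longrightarrow> posterior t x \<le> 1"
  using W_bounds[of x] by (simp add: posterior_def)

lemma likelihood_bounds:
  assumes "x \<in> space (PiM {..<n} (\<lambda>_. M))"
  shows "0 \<le> likelihood n \<theta> x" "likelihood n \<theta> x \<le> 1"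
  using assms posterior_nonneg posterior_le_1 unfolding likelihood_def
  by (auto intro!: prod_nonneg prod_le_1 simp: space_PiM PiE_iff)

text \<open>The i.i.d. prior depends on \<open>\<theta>\<close> only through its sum. Conditioned on
  the sum it is therefore uniform, and one constant normalises all likelihoods.\<close>

lemma prod_prior_weight:
  assumes "\<theta> \<in> fixed_sum_vectors n k"
  shows "(\<Prod>i<n. prior_weight (\<theta> i)) = \<pi>1 ^ k * \<pi>0 ^ (n - k)"
proof -
  note \<theta> = fixed_sum_vectorsD[OF assms]
  have "prior_weight (\<theta> i) = \<pi>1 ^ \<theta> i * \<pi>0 ^ (1 - \<theta> i)" if "i < n" for i
    using binary_vectorsD[OF \<theta>(1) that] by (auto simp: prior_weight_def)
  then have "(\<Prod>i<n. prior_weight (\<theta> i)) = \<pi>1 ^ (\<Sum>i<n. \<theta> i) * \<pi>0 ^ (\<Sum>i<n. 1 - \<theta> i)"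
    by (simp add: prod.distrib power_sum)
  moreover have "(\<Sum>i<n. 1 - \<theta> i) = n - k"
  proof -
    have "(\<Sum>i<n. 1 - \<theta> i) = (\<Sum>i<n. 1) - (\<Sum>i<n. \<theta> i)"
      using binary_vectorsD[OF \<theta>(1)] by (intro sum_subtractf_nat) force
    then show ?thesis by (simp add: \<theta>(2))
  qed
  ultimately show ?thesis by (simp add: \<theta>(2))
qed

lemma integral_observation_law:
  fixes g :: "(nat \<Rightarrow> 'a) \<Rightarrow> real"
  assumes g: "g \<in> borel_measurable (PiM {..<n} (\<lambda>_. M))" and \<theta>: "\<theta> \<in> fixed_sum_vectors n k"
  shows "(\<integral>x. g x \<partial>observation_law M f0 f1 n \<theta>)
    = (\<integral>x. likelihood n \<theta> x * g x \<partial>PiM {..<n} (\<lambda>_. Q)) / (\<pi>1 ^ k * \<pi>0 ^ (n - k))"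
proof -
  let ?c = "\<pi>1 ^ k * \<pi>0 ^ (n - k)"
  have c: "0 < ?c" using \<pi>0_pos \<pi>1_pos by simp
  have sp: "space (PiM {..<n} (\<lambda>_. Q)) = space (PiM {..<n} (\<lambda>_. M))"
    by (rule sets_eq_imp_space_eq[OF sets_PiM_Q])
  have "observation_law M f0 f1 n \<theta>
      = density (PiM {..<n} (\<lambda>_. Q)) (\<lambda>x. ennreal (likelihood n \<theta> x / ?c))"
    unfolding observation_law_eq_density
  proof (rule density_cong; measurable?; intro AE_I2)
    fix x assume x: "x \<in> space (PiM {..<n} (\<lambda>_. Q))"
    then have "(\<Prod>i<n. ennreal (posterior (\<theta> i) (x i) / prior_weight (\<theta> i)))
        = ennreal (\<Prod>i<n. posterior (\<theta> i) (x i) / prior_weight (\<theta> i))"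
      using posterior_nonneg prior_weight_pos
      by (intro prod_ennreal) (auto simp: space_PiM PiE_iff intro!: divide_nonneg_pos)
    also have "(\<Prod>i<n. posterior (\<theta> i) (x i) / prior_weight (\<theta> i)) = likelihood n \<theta> x / ?c"
      by (simp add: prod_dividef likelihood_def prod_prior_weight[OF \<theta>])
    finally show "(\<Prod>i<n. ennreal (posterior (\<theta> i) (x i) / prior_weight (\<theta> i)))
        = ennreal (likelihood n \<theta> x / ?c)" .
  qed
  then have "(\<integral>x. g x \<partial>observation_law M f0 f1 n \<theta>)
      = (\<integral>x. (likelihood n \<theta> x / ?c) * g x \<partial>PiM {..<n} (\<lambda>_. Q))"
    using c g likelihood_bounds
    by (simp, subst integral_density) (auto simp: sp intro!: AE_I2 divide_nonneg_pos)
  then show ?thesis by simp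
qed

text \<open>With \<open>d = 1\<close> the quantity multiplied by \<open>l\<close> is
  \<open>t - 1\<close> under the null and \<open>t\<close> otherwise, on average
  \<open>t - W x\<close>; with \<open>d = 0\<close> it is 0. The positive part covers both cases, so
  the bound no longer involves the decision. All exponents are at most \<open>l\<close> in absolute
  value, whence the quadratic term.\<close>

lemma posterior_exp_moment:
  fixes l t :: real
  assumes x: "x \<in> space M" and l: "0 \<le> l" "l \<le> 1" and t: "0 \<le> t" "t \<le> 1" and d: "d = 0 \<or> d = 1"
  shows "(\<Sum>v\<in>{0, 1}. posterior v x * exp (- l * (real d * (1 - real v) - t * real d)))
    \<le> 1 + l * max 0 (t - W x) + l\<^sup>2"
proof (cases "d = 0")
  case True
  then show ?thesis using l by (simp add: posterior_def)
next
  case False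
  then have d: "d = 1" using d by simp
  have w: "0 \<le> W x" "W x \<le> 1" using W_bounds[OF x] by auto
  have sq: "(l * t)\<^sup>2 \<le> l\<^sup>2" "(l * (1 - t))\<^sup>2 \<le> l\<^sup>2"
    using l t by (auto intro!: power_mono mult_right_le_one_le)
  have "exp (- (l * (1 - t))) \<le> 1 - l * (1 - t) + l\<^sup>2"
  proof -
    have "0 \<le> l * (1 - t)" using l t by simp
    then show ?thesis
      using exp_le_quadratic[of "- (l * (1 - t))"] sq(2) by (simp only: power2_minus) linarith
  qed
  moreover have "exp (l * t) \<le> 1 + l * t + l\<^sup>2"
    using exp_le_quadratic[of "l * t"] sq l t mult_le_one[of l t] by linarith
  ultimately have "W x * exp (- (l * (1 - t))) + (1 - W x) * exp (l * t)
      \<le> W x * (1 - l * (1 - t) + l\<^sup>2) + (1 - W x) * (1 + l * t + l\<^sup>2)"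
    using w by (intro add_mono mult_left_mono) auto
  also have "\<dots> = 1 + l * (t - W x) + l\<^sup>2"
    by (simp add: algebra_simps)
  also have "\<dots> \<le> 1 + l * max 0 (t - W x) + l\<^sup>2"
    using l by (intro add_mono mult_left_mono) auto
  finally show ?thesis
    by (simp add: posterior_def d algebra_simps)
qed

lemma hinge_bounds:
  assumes "u \<in> {0..1}" "x \<in> space M"
  shows "0 \<le> max 0 (q u - W x)" "max 0 (q u - W x) \<le> 1"
  using q_bounds[OF assms(1)] W_bounds[OF assms(2)] by auto

text \<open>Dropping the constraint \<open>\<Sum>\<theta> = k\<close> turns the sum over \<open>\<theta>\<close> into
  the i.i.d. model, where it factorises over the coordinates, at the price of the normalisation
  \<open>\<pi>1 ^ k * \<pi>0 ^ (n - k)\<close>.\<close>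

lemma likelihood_exp_moment:
  fixes l t :: real
  assumes x: "x \<in> space (PiM {..<n} (\<lambda>_. M))" and l: "0 \<le> l" "l \<le> 1" and t: "0 \<le> t" "t \<le> 1"
    and \<delta>: "\<delta> \<in> binary_vectors n"
  shows "(\<Sum>\<theta>\<in>fixed_sum_vectors n k. likelihood n \<theta> x
      * exp (- l * (false_discoveries n \<theta> \<delta> - t * real (discoveries n \<delta>))))
    \<le> (\<Prod>i<n. 1 + l * max 0 (t - W (x i)) + l\<^sup>2)"
proof -
  let ?e = "\<lambda>i v. posterior v (x i) * exp (- l * (real (\<delta> i) * (1 - real v) - t * real (\<delta> i)))"
  have xi: "x i \<in> space M" if "i < n" for i
    using x that by (auto simp: space_PiM PiE_iff)
  have prod_e: "likelihood n \<theta> x * exp (- l * (false_discoveries n \<theta> \<delta> - t * real (discoveries n \<delta>)))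
      = (\<Prod>i<n. ?e i (\<theta> i))" for \<theta>
  proof -
    have "- l * (false_discoveries n \<theta> \<delta> - t * real (discoveries n \<delta>))
        = (\<Sum>i<n. - l * (real (\<delta> i) * (1 - real (\<theta> i)) - t * real (\<delta> i)))"
      by (simp only: false_discoveries_def discoveries_def of_nat_sum sum_distrib_left
          sum_subtractf[symmetric])
    then show ?thesis
      by (simp only: likelihood_def prod.distrib exp_sum[OF finite_lessThan])
  qed
  have nonneg: "0 \<le> (\<Prod>i<n. ?e i (\<theta> i))" for \<theta>
    using xi posterior_nonneg by (intro prod_nonneg) auto
  have "(\<Sum>\<theta>\<in>fixed_sum_vectors n k. likelihood n \<theta> x
      * exp (- l * (false_discoveries n \<theta> \<delta> - t * real (discoveries n \<delta>))))
      = (\<Sum>\<theta>\<in>fixed_sum_vectors n k. \<Prod>i<n. ?e i (\<theta> i))"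
    by (simp only: prod_e)
  also have "\<dots> \<le> (\<Sum>\<theta>\<in>binary_vectors n. \<Prod>i<n. ?e i (\<theta> i))"
    using nonneg by (intro sum_mono2) (auto simp: fixed_sum_vectors_def)
  also have "\<dots> = (\<Prod>i<n. \<Sum>v\<in>{0, 1}. ?e i v)"
    unfolding binary_vectors_def by (rule prod_sum_PiE[symmetric]) auto
  also have "\<dots> \<le> (\<Prod>i<n. 1 + l * max 0 (t - W (x i)) + l\<^sup>2)"
  proof (intro prod_mono conjI)
    fix i assume "i \<in> {..<n}"
    then have i: "i < n" by simp
    show "0 \<le> (\<Sum>v\<in>{0, 1}. ?e i v)"
      using posterior_nonneg[OF xi[OF i]] by (intro sum_nonneg) auto
    show "(\<Sum>v\<in>{0, 1}. ?e i v) \<le> 1 + l * max 0 (t - W (x i)) + l\<^sup>2"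
      using posterior_exp_moment[OF xi[OF i] l t] binary_vectorsD[OF \<delta> i] by blast
  qed
  finally show ?thesis .
qed

lemma hinge_exp_moment:
  assumes u: "u \<in> {0..1}" and l: "0 \<le> l" "l \<le> 1"
  shows "integrable (PiM {..<n} (\<lambda>_. Q)) (\<lambda>x. \<Prod>i<n. 1 + l * max 0 (q u - W (x i)) + l\<^sup>2)"
    and "(\<integral>x. (\<Prod>i<n. 1 + l * max 0 (q u - W (x i)) + l\<^sup>2) \<partial>PiM {..<n} (\<lambda>_. Q))
      \<le> exp (real n * (l * (q u * u - A u) + l\<^sup>2))"
proof -
  let ?h = "\<lambda>x. 1 + l * max 0 (q u - W x) + l\<^sup>2"
  have ih: "integrable Q (\<lambda>x. max 0 (q u - W x))"
    using hinge_bounds[OF u] by (intro integrable_Q[where B = 1]) auto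
  then have ih': "integrable Q ?h" by auto
  show "integrable (PiM {..<n} (\<lambda>_. Q)) (\<lambda>x. \<Prod>i<n. ?h (x i))"
    using ih' by (intro QP.product_integrable_prod) auto
  have int_h: "(\<integral>x. ?h x \<partial>Q) = 1 + (l * (q u * u - A u) + l\<^sup>2)"
    using ih by (simp add: integral_hinge[OF u])
  have "0 \<le> (\<integral>x. ?h x \<partial>Q)"
    using l by (intro integral_nonneg_AE AE_I2) auto
  moreover have "(\<integral>x. ?h x \<partial>Q) \<le> exp (l * (q u * u - A u) + l\<^sup>2)"
    unfolding int_h by (rule exp_ge_add_one_self)
  ultimately have "(\<integral>x. ?h x \<partial>Q) ^ n \<le> exp (l * (q u * u - A u) + l\<^sup>2) ^ n"
    by (intro power_mono)
  moreover have "(\<integral>x. (\<Prod>i<n. ?h (x i)) \<partial>PiM {..<n} (\<lambda>_. Q)) = (\<integral>x. ?h x \<partial>Q) ^ n"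
    using ih' by (subst QP.product_integral_prod) auto
  ultimately show "(\<integral>x. (\<Prod>i<n. ?h (x i)) \<partial>PiM {..<n} (\<lambda>_. Q))
      \<le> exp (real n * (l * (q u * u - A u) + l\<^sup>2))"
    by (simp add: exp_of_nat_mult)
qed

definition deficient :: "nat \<Rightarrow> real \<Rightarrow> ((nat \<Rightarrow> nat) \<times> (nat \<Rightarrow> nat)) set" where
  "deficient n \<eta> = {(\<theta>, \<delta>).
     false_discoveries n \<theta> \<delta> < real n * (A (real (discoveries n \<delta>) / real n) - \<eta>)}"

text \<open>The denominator is the i.i.d. probability that exactly \<open>k\<close> states are 1,
  the price of conditioning. The factor \<open>n + 1\<close> is the union over the values of
  \<open>discoveries n \<delta>\<close>, each of which has its own multiplier
  \<open>q (U j)\<close>. The bound does not depend on the rule.\<close>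

lemma deficient_prob_le:
  assumes \<kappa>: "\<kappa> \<in> decision_rules M n" and k: "k \<le> n" and n: "0 < n" and \<eta>: "0 < \<eta>" "\<eta> \<le> 1"
  shows "(\<integral>y. indicator (deficient n \<eta>) y \<partial>joint_law M f0 f1 n k \<kappa>)
    \<le> (real n + 1) * exp (- (real n * \<eta>\<^sup>2 / 4)) / (real (n choose k) * \<pi>1 ^ k * \<pi>0 ^ (n - k))"
proof -
  let ?Qn = "PiM {..<n} (\<lambda>_. Q)" and ?D = "binary_vectors n" and ?\<Theta> = "fixed_sum_vectors n k"
  define w where "w \<delta> x = measure (\<kappa> x) {\<delta>}" for \<delta> x
  \<comment> \<open>Minimises \<open>l\<^sup>2 - l * \<eta>\<close>, with minimum
    \<open>- \<eta>\<^sup>2 / 4\<close>.\<close>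
  define l where "l = \<eta> / 2"
  define c where "c = \<pi>1 ^ k * \<pi>0 ^ (n - k)"
  define U where "U j = real j / real n" for j :: nat
  define H where "H j x = (\<Prod>i<n. 1 + l * max 0 (q (U j) - W (x i)) + l\<^sup>2)" for j x
  \<comment> \<open>This prefactor converts the Lagrangian exponent into the deficit of false
    discoveries: since \<open>n * U j = j\<close>, the two terms with \<open>q (U j)\<close> cancel
    when \<open>j\<close> discoveries are made.\<close>
  define g where "g j = exp (- l * (real n * (q (U j) * U j - A (U j)) + real n * \<eta>))" for j
  have Qn: "finite_measure ?Qn"
    by (intro prob_space.finite_measure prob_space_PiM prob_space_Q)
  have sp: "space ?Qn = space (PiM {..<n} (\<lambda>_. M))"
    by (rule sets_eq_imp_space_eq[OF sets_PiM_Q])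
  have c: "0 < c" using \<pi>0_pos \<pi>1_pos by (simp add: c_def)
  have l: "0 \<le> l" "l \<le> 1" using \<eta> by (auto simp: l_def)
  have U: "U j \<in> {0..1}" if "j \<le> n" for j using that n by (auto simp: U_def)
  have w: "is_rule_weights M n w"
    unfolding w_def by (rule is_rule_weights_kernel[OF \<kappa>])
  note [measurable] = is_rule_weightsD(1)[OF w]
  have w_bounds: "0 \<le> w \<delta> x" "w \<delta> x \<le> 1" if "\<delta> \<in> ?D" "x \<in> space ?Qn" for \<delta> x
    using is_rule_weightsD[OF w] that by (auto simp: sp)
  have H_nonneg: "0 \<le> H j x" for j x
    unfolding H_def using l by (intro prod_nonneg) (auto intro!: add_nonneg_nonneg)
  have integrable_H: "integrable ?Qn (H j)" if "j \<le> n" for j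
    unfolding H_def by (rule hinge_exp_moment(1)[OF U[OF that] l])
  have integrable_w: "integrable ?Qn (\<lambda>x. likelihood n \<theta> x * w \<delta> x)" if "\<delta> \<in> ?D" for \<theta> \<delta>
    using that w_bounds likelihood_bounds
    by (intro finite_measure.integrable_const_bound[OF Qn, where B = 1] AE_I2)
      (auto simp: sp abs_mult intro!: mult_le_one)
  have chernoff: "indicator (deficient n \<eta>) (\<theta>, \<delta>)
      \<le> g (discoveries n \<delta>)
        * exp (- l * (false_discoveries n \<theta> \<delta> - q (U (discoveries n \<delta>)) * real (discoveries n \<delta>)))"
    for \<theta> \<delta>
  proof -
    have "real n * U (discoveries n \<delta>) = real (discoveries n \<delta>)"
      using n by (simp add: U_def)
    then have "g (discoveries n \<delta>)
        * exp (- l * (false_discoveries n \<theta> \<delta> - q (U (discoveries n \<delta>)) * real (discoveries n \<delta>)))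
        = exp (- l * (false_discoveries n \<theta> \<delta> - real n * (A (U (discoveries n \<delta>)) - \<eta>)))"
      by (simp add: g_def algebra_simps flip: exp_add)
    moreover have "0 \<le> - l * (false_discoveries n \<theta> \<delta> - real n * (A (U (discoveries n \<delta>)) - \<eta>))"
      if "(\<theta>, \<delta>) \<in> deficient n \<eta>"
      using that l by (intro mult_nonpos_nonpos) (auto simp: deficient_def U_def)
    ultimately show ?thesis by (simp add: indicator_def)
  qed
  have "(\<integral>x. (\<Sum>j\<le>n. g j * H j x) \<partial>?Qn) = (\<Sum>j\<le>n. \<integral>x. g j * H j x \<partial>?Qn)"
    by (rule Bochner_Integration.integral_sum) (use integrable_H in simp)
  also have "\<dots> = (\<Sum>j\<le>n. g j * (\<integral>x. H j x \<partial>?Qn))"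
    by (simp only: integral_mult_right_zero)
  also have "\<dots> \<le> (\<Sum>j\<le>n. exp (- (real n * \<eta>\<^sup>2 / 4)))"
  proof (intro sum_mono)
    fix j assume "j \<in> {..n}"
    then have "g j * (\<integral>x. H j x \<partial>?Qn) \<le> g j * exp (real n * (l * (q (U j) * U j - A (U j)) + l\<^sup>2))"
      unfolding H_def by (intro mult_left_mono hinge_exp_moment(2) U l) (auto simp: g_def)
    also have "\<dots> = exp (- (real n * \<eta>\<^sup>2 / 4))"
      by (simp add: g_def l_def power2_eq_square field_simps flip: exp_add)
    finally show "g j * (\<integral>x. H j x \<partial>?Qn) \<le> exp (- (real n * \<eta>\<^sup>2 / 4))" .
  qed
  also have "\<dots> = (real n + 1) * exp (- (real n * \<eta>\<^sup>2 / 4))" by simp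
  finally have H_le: "(\<integral>x. (\<Sum>j\<le>n. g j * H j x) \<partial>?Qn) \<le> (real n + 1) * exp (- (real n * \<eta>\<^sup>2 / 4))" .
  have J_eq: "(\<integral>y. indicator (deficient n \<eta>) y \<partial>joint_law M f0 f1 n k \<kappa>)
      = (\<Sum>\<theta>\<in>?\<Theta>. \<integral>x. (\<Sum>\<delta>\<in>?D. indicator (deficient n \<eta>) (\<theta>, \<delta>) * w \<delta> x)
           \<partial>observation_law M f0 f1 n \<theta>) / card ?\<Theta>"
    unfolding w_def by (rule joint_law_integral_support(2)[OF \<kappa> k, of _ 1]) (auto simp: indicator_def)
  have "(\<Sum>\<theta>\<in>?\<Theta>. \<integral>x. (\<Sum>\<delta>\<in>?D. indicator (deficient n \<eta>) (\<theta>, \<delta>) * w \<delta> x)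
           \<partial>observation_law M f0 f1 n \<theta>)
      = (\<Sum>\<theta>\<in>?\<Theta>. (\<integral>x. likelihood n \<theta> x * (\<Sum>\<delta>\<in>?D. indicator (deficient n \<eta>) (\<theta>, \<delta>) * w \<delta> x) \<partial>?Qn) / c)"
    unfolding c_def by (intro sum.cong refl integral_observation_law) measurable
  also have "\<dots> = (\<integral>x. (\<Sum>\<theta>\<in>?\<Theta>. likelihood n \<theta> x * (\<Sum>\<delta>\<in>?D. indicator (deficient n \<eta>) (\<theta>, \<delta>) * w \<delta> x)) \<partial>?Qn) / c"
    using integrable_w
    by (subst Bochner_Integration.integral_sum)
      (auto simp: sum_divide_distrib sum_distrib_left mult.left_commute)
  also have "\<dots> \<le> (\<integral>x. (\<Sum>j\<le>n. g j * H j x) \<partial>?Qn) / c"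
  proof (intro divide_right_mono integral_mono)
    show "integrable ?Qn (\<lambda>x. \<Sum>\<theta>\<in>?\<Theta>. likelihood n \<theta> x * (\<Sum>\<delta>\<in>?D. indicator (deficient n \<eta>) (\<theta>, \<delta>) * w \<delta> x))"
      unfolding sum_distrib_left
    proof (intro Bochner_Integration.integrable_sum)
      fix \<theta> \<delta> assume "\<delta> \<in> ?D"
      from integrable_mult_right[OF integrable_w[OF this], of "indicator (deficient n \<eta>) (\<theta>, \<delta>)" \<theta>]
      show "integrable ?Qn (\<lambda>x. likelihood n \<theta> x * (indicator (deficient n \<eta>) (\<theta>, \<delta>) * w \<delta> x))"
        by (simp only: mult.left_commute)
    qed
    show "integrable ?Qn (\<lambda>x. \<Sum>j\<le>n. g j * H j x)"
      using integrable_H by auto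
    fix x assume x: "x \<in> space ?Qn"
    have "(\<Sum>\<theta>\<in>?\<Theta>. likelihood n \<theta> x * (\<Sum>\<delta>\<in>?D. indicator (deficient n \<eta>) (\<theta>, \<delta>) * w \<delta> x))
        = (\<Sum>\<delta>\<in>?D. w \<delta> x * (\<Sum>\<theta>\<in>?\<Theta>. likelihood n \<theta> x * indicator (deficient n \<eta>) (\<theta>, \<delta>)))"
      unfolding sum_distrib_left by (subst sum.swap) (simp add: ac_simps)
    also have "\<dots> \<le> (\<Sum>\<delta>\<in>?D. w \<delta> x * (\<Sum>j\<le>n. g j * H j x))"
    proof (intro sum_mono mult_left_mono)
      fix \<delta> assume \<delta>: "\<delta> \<in> ?D"
      let ?j = "discoveries n \<delta>"
      have j: "?j \<le> n" by (rule discoveries_le[OF \<delta>])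
      have "(\<Sum>\<theta>\<in>?\<Theta>. likelihood n \<theta> x * indicator (deficient n \<eta>) (\<theta>, \<delta>))
          \<le> (\<Sum>\<theta>\<in>?\<Theta>. likelihood n \<theta> x * (g ?j
               * exp (- l * (false_discoveries n \<theta> \<delta> - q (U ?j) * real ?j))))"
        using x likelihood_bounds by (intro sum_mono mult_left_mono chernoff) (auto simp: sp)
      also have "\<dots> = g ?j * (\<Sum>\<theta>\<in>?\<Theta>. likelihood n \<theta> x
               * exp (- l * (false_discoveries n \<theta> \<delta> - q (U ?j) * real ?j)))"
        by (simp add: sum_distrib_left ac_simps)
      also have "\<dots> \<le> g ?j * H ?j x"
        unfolding H_def using q_bounds[OF U[OF j]] x
        by (intro mult_left_mono likelihood_exp_moment l \<delta>) (auto simp: sp g_def)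
      \<comment> \<open>Enlarging the single term to the sum over all \<open>j\<close> removes
        \<open>\<delta>\<close> from the bound, so that the weights of the rule can be summed to
        1.\<close>
      also have "\<dots> \<le> (\<Sum>j\<le>n. g j * H j x)"
        using j H_nonneg by (intro member_le_sum) (auto simp: g_def)
      finally show "(\<Sum>\<theta>\<in>?\<Theta>. likelihood n \<theta> x * indicator (deficient n \<eta>) (\<theta>, \<delta>))
          \<le> (\<Sum>j\<le>n. g j * H j x)" .
    qed (use w_bounds x in auto)
    also have "\<dots> = (\<Sum>j\<le>n. g j * H j x)"
      using is_rule_weightsD(3)[OF w] x by (simp add: sp flip: sum_distrib_right)
    finally show "(\<Sum>\<theta>\<in>?\<Theta>. likelihood n \<theta> x * (\<Sum>\<delta>\<in>?D. indicator (deficient n \<eta>) (\<theta>, \<delta>) * w \<delta> x))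
        \<le> (\<Sum>j\<le>n. g j * H j x)" .
  qed (use c in simp)
  also have "\<dots> \<le> ((real n + 1) * exp (- (real n * \<eta>\<^sup>2 / 4))) / c"
    using H_le c by (intro divide_right_mono) auto
  finally have "(\<integral>y. indicator (deficient n \<eta>) y \<partial>joint_law M f0 f1 n k \<kappa>)
      \<le> ((real n + 1) * exp (- (real n * \<eta>\<^sup>2 / 4))) / c / card ?\<Theta>"
    unfolding J_eq by (intro divide_right_mono) auto
  then show ?thesis
    by (simp only: card_fixed_sum_vectors c_def divide_divide_eq_left ac_simps)
qed

end

subsection \<open>Lower bound for every rule\<close>

definition FDP :: "nat \<Rightarrow> (nat \<Rightarrow> nat) \<times> (nat \<Rightarrow> nat) \<Rightarrow> real" where
  "FDP n = (\<lambda>(\<theta>, \<delta>). (\<Sum>i<n. real (\<delta> i) * (1 - real (\<theta> i))) / max 1 (\<Sum>i<n. real (\<delta> i)))"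

definition FNP :: "nat \<Rightarrow> (nat \<Rightarrow> nat) \<times> (nat \<Rightarrow> nat) \<Rightarrow> real" where
  "FNP n = (\<lambda>(\<theta>, \<delta>). (\<Sum>i<n. (1 - real (\<delta> i)) * real (\<theta> i)) / max 1 (\<Sum>i<n. 1 - real (\<delta> i)))"

lemma FDP_eq:
  "FDP n (\<theta>, \<delta>) = false_discoveries n \<theta> \<delta> / max 1 (real (discoveries n \<delta>))"
  by (simp add: FDP_def false_discoveries_def discoveries_def)

lemma FNP_eq:
  assumes "\<theta> \<in> fixed_sum_vectors n k"
  shows "FNP n (\<theta>, \<delta>) = (real k - real (discoveries n \<delta>) + false_discoveries n \<theta> \<delta>)
    / max 1 (real n - real (discoveries n \<delta>))"
proof -
  have "real k = (\<Sum>i<n. real (\<theta> i))"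
    using fixed_sum_vectorsD(2)[OF assms] by (metis of_nat_sum)
  then have "(\<Sum>i<n. (1 - real (\<delta> i)) * real (\<theta> i))
      = real k - real (discoveries n \<delta>) + false_discoveries n \<theta> \<delta>"
    by (simp add: false_discoveries_def discoveries_def algebra_simps sum.distrib sum_subtractf)
  then show ?thesis
    by (simp add: FNP_def discoveries_def sum_subtractf)
qed

lemma false_discoveries_bounds:
  assumes "\<theta> \<in> binary_vectors n" "\<delta> \<in> binary_vectors n"
  shows "0 \<le> false_discoveries n \<theta> \<delta>" "false_discoveries n \<theta> \<delta> \<le> real (discoveries n \<delta>)"
proof -
  have "0 \<le> real (\<delta> i) * (1 - real (\<theta> i)) \<and> real (\<delta> i) * (1 - real (\<theta> i)) \<le> real (\<delta> i)"
    if "i < n" for i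
    using binary_vectorsD[OF assms(1) that] binary_vectorsD[OF assms(2) that] by auto
  then show "0 \<le> false_discoveries n \<theta> \<delta>" "false_discoveries n \<theta> \<delta> \<le> real (discoveries n \<delta>)"
    unfolding false_discoveries_def discoveries_def of_nat_sum
    by (auto intro!: sum_nonneg sum_mono)
qed

lemma false_nondiscoveries_bounds:
  assumes \<theta>: "\<theta> \<in> fixed_sum_vectors n k" and \<delta>: "\<delta> \<in> binary_vectors n"
  shows "0 \<le> real k - real (discoveries n \<delta>) + false_discoveries n \<theta> \<delta>"
    and "real k - real (discoveries n \<delta>) + false_discoveries n \<theta> \<delta> \<le> real n - real (discoveries n \<delta>)"
proof -
  note \<theta>' = fixed_sum_vectorsD[OF \<theta>]
  have k: "real k = (\<Sum>i<n. real (\<theta> i))"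
    using \<theta>'(2) by (metis of_nat_sum)
  have eq: "real k - real (discoveries n \<delta>) + false_discoveries n \<theta> \<delta>
      = (\<Sum>i<n. (1 - real (\<delta> i)) * real (\<theta> i))"
    by (simp add: k false_discoveries_def discoveries_def algebra_simps sum.distrib sum_subtractf)
  have n: "real n - real (discoveries n \<delta>) = (\<Sum>i<n. 1 - real (\<delta> i))"
    by (simp add: discoveries_def sum_subtractf)
  have "0 \<le> (1 - real (\<delta> i)) * real (\<theta> i) \<and> (1 - real (\<delta> i)) * real (\<theta> i) \<le> 1 - real (\<delta> i)"
    if "i < n" for i
    using binary_vectorsD[OF \<theta>'(1) that] binary_vectorsD[OF \<delta> that] by auto
  then show "0 \<le> real k - real (discoveries n \<delta>) + false_discoveries n \<theta> \<delta>"
    "real k - real (discoveries n \<delta>) + false_discoveries n \<theta> \<delta> \<le> real n - real (discoveries n \<delta>)"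
    unfolding eq n by (auto intro!: sum_nonneg sum_mono)
qed

lemma FDP_bounds:
  assumes "\<theta> \<in> fixed_sum_vectors n k" "\<delta> \<in> binary_vectors n"
  shows "0 \<le> FDP n (\<theta>, \<delta>)" "FDP n (\<theta>, \<delta>) \<le> 1"
proof -
  have "0 < max 1 (real (discoveries n \<delta>))" by simp
  then show "0 \<le> FDP n (\<theta>, \<delta>)" "FDP n (\<theta>, \<delta>) \<le> 1"
    using false_discoveries_bounds[OF fixed_sum_vectorsD(1)[OF assms(1)] assms(2)]
    unfolding FDP_eq by (simp_all only: zero_le_divide_iff divide_le_eq_1_pos le_max_iff_disj) simp_all
qed

lemma FNP_bounds:
  assumes "\<theta> \<in> fixed_sum_vectors n k" "\<delta> \<in> binary_vectors n"
  shows "0 \<le> FNP n (\<theta>, \<delta>)" "FNP n (\<theta>, \<delta>) \<le> 1"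
proof -
  have "0 < max 1 (real n - real (discoveries n \<delta>))" by simp
  then show "0 \<le> FNP n (\<theta>, \<delta>)" "FNP n (\<theta>, \<delta>) \<le> 1"
    using false_nondiscoveries_bounds[OF assms] unfolding FNP_eq[OF assms(1)]
    by (simp_all only: zero_le_divide_iff divide_le_eq_1_pos le_max_iff_disj) simp_all
qed

lemma abs_FDP_FNP_le:
  assumes "\<theta> \<in> fixed_sum_vectors n k" "\<delta> \<in> binary_vectors n"
  shows "\<bar>FDP n (\<theta>, \<delta>)\<bar> \<le> 1" "\<bar>FNP n (\<theta>, \<delta>)\<bar> \<le> 1"
  using FDP_bounds[OF assms] FNP_bounds[OF assms] by simp_all

context two_groups
begin

lemma FDR_eq_FDP: "FDR M f0 f1 n k \<kappa> = (\<integral>y. FDP n y \<partial>joint_law M f0 f1 n k \<kappa>)"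
  by (simp add: FDR_def FDP_def)

lemma FNR_eq_FNP: "FNR M f0 f1 n k \<kappa> = (\<integral>y. FNP n y \<partial>joint_law M f0 f1 n k \<kappa>)"
  by (simp add: FNR_def FNP_def)

lemma integrable_FDP_FNP:
  assumes "\<kappa> \<in> decision_rules M n" "k \<le> n"
  shows "integrable (joint_law M f0 f1 n k \<kappa>) (FDP n)"
    and "integrable (joint_law M f0 f1 n k \<kappa>) (FNP n)"
  by (rule joint_law_integral_support(1)[OF assms, where B = 1], erule abs_FDP_FNP_le, assumption)+

lemma FDR_FNR_bounds:
  assumes "\<kappa> \<in> decision_rules M n" "k \<le> n"
  shows "0 \<le> FDR M f0 f1 n k \<kappa>" "0 \<le> FNR M f0 f1 n k \<kappa>"
proof -
  let ?J = "joint_law M f0 f1 n k \<kappa>"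
  interpret J: prob_space ?J by (rule prob_space_joint_law[OF assms(1)])
  have "AE y in ?J. 0 \<le> FDP n y \<and> 0 \<le> FNP n y"
    using AE_joint_law[OF assms] by eventually_elim (auto simp: FDP_bounds FNP_bounds)
  then show "0 \<le> FDR M f0 f1 n k \<kappa>" "0 \<le> FNR M f0 f1 n k \<kappa>"
    unfolding FDR_eq_FDP FNR_eq_FNP by (auto intro!: integral_nonneg_AE)
qed

text \<open>Truncating the fraction of discoveries to \<open>0\<close> or \<open>1\<close> near the end points exploits
  \<open>a 0 = 0\<close> and \<open>b 1 = 0\<close>: there the realised proportions, whose denominators are small, are
  bounded below trivially.\<close>

definition truncate :: "real \<Rightarrow> real \<Rightarrow> real" where
  "truncate \<epsilon> u = (if u < \<epsilon> then 0 else if 1 - \<epsilon> < u then 1 else u)"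

text \<open>Away from the end points the denominators \<open>u\<close> and \<open>1 - u\<close> are
  at least \<open>\<epsilon>\<close>, so errors \<open>\<epsilon>\<^sup>2\<close> in the numerators
  cost \<open>\<epsilon>\<close> each: one for the false discoveries, and for the false
  non-discoveries a second one from \<open>k / n\<close>. Truncation adds at most one more
  \<open>\<epsilon>\<close>.\<close>

lemma proportions_lower_bound:
  assumes \<theta>: "\<theta> \<in> fixed_sum_vectors n k" and \<delta>: "\<delta> \<in> binary_vectors n" and n: "0 < n"
    and \<epsilon>: "0 < \<epsilon>" "\<epsilon> \<le> 1 / 2" and near: "\<bar>real k / real n - \<pi>1\<bar> \<le> \<epsilon>\<^sup>2"
    and good: "(\<theta>, \<delta>) \<notin> deficient n (\<epsilon>\<^sup>2)"
  defines "u \<equiv> real (discoveries n \<delta>) / real n"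
  shows "a (truncate \<epsilon> u) \<le> FDP n (\<theta>, \<delta>) + 2 * \<epsilon>"
    and "b (truncate \<epsilon> u) \<le> FNP n (\<theta>, \<delta>) + 3 * \<epsilon>"
proof -
  let ?F = "false_discoveries n \<theta> \<delta>" and ?K = "discoveries n \<delta>"
  have u: "u \<in> {0..1}" using discoveries_le[OF \<delta>] n by (auto simp: u_def)
  have K: "real ?K = real n * u" using n by (simp add: u_def)
  have F: "real n * (A u - \<epsilon>\<^sup>2) \<le> ?F"
    using good by (simp add: deficient_def u_def)
  have a_low: "a u \<le> FDP n (\<theta>, \<delta>) + \<epsilon>" if "\<epsilon> \<le> u"
  proof -
    have u0: "0 < u" using that \<epsilon> by simp
    then have "0 < real ?K" using K n by simp
    then have "1 \<le> real ?K" by simp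
    then have "max 1 (real ?K) = real n * u" using K by (metis max_def order_antisym)
    then have "FDP n (\<theta>, \<delta>) = ?F / (real n * u)" by (simp add: FDP_eq)
    also have "\<dots> \<ge> real n * (A u - \<epsilon>\<^sup>2) / (real n * u)"
      using F u0 n by (intro divide_right_mono) auto
    also have "real n * (A u - \<epsilon>\<^sup>2) / (real n * u) = a u - \<epsilon> * (\<epsilon> / u)"
      using n u0 u by (simp add: a_eq diff_divide_distrib power2_eq_square)
    finally have "a u - \<epsilon> * (\<epsilon> / u) \<le> FDP n (\<theta>, \<delta>)" .
    moreover have "\<epsilon> * (\<epsilon> / u) \<le> \<epsilon> * 1"
      using that \<epsilon> u0 by (intro mult_left_mono) auto
    ultimately show ?thesis by simp
  qed
  have b_low: "b u \<le> FNP n (\<theta>, \<delta>) + 2 * \<epsilon>" if "u \<le> 1 - \<epsilon>"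
  proof -
    have u1: "u < 1" using that \<epsilon> by simp
    have "real n - real ?K = real n * (1 - u)" using K by (simp add: algebra_simps)
    moreover have "real ?K < real n" using u1 K n by simp
    then have "real (Suc ?K) \<le> real n" by (simp only: of_nat_le_iff of_nat_less_iff Suc_le_eq)
    then have "1 \<le> real n - real ?K" by simp
    ultimately have "FNP n (\<theta>, \<delta>) = (real k - real ?K + ?F) / (real n * (1 - u))"
      by (simp add: FNP_eq[OF \<theta>])
    also have "\<dots> \<ge> (real n * (\<pi>1 - u + A u - 2 * \<epsilon>\<^sup>2)) / (real n * (1 - u))"
    proof (rule divide_right_mono)
      have "real n * (\<pi>1 - \<epsilon>\<^sup>2) \<le> real n * (real k / real n)"
        using near by (intro mult_left_mono) auto
      then have "real n * (\<pi>1 - \<epsilon>\<^sup>2) \<le> real k" using n by simp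
      then show "real n * (\<pi>1 - u + A u - 2 * \<epsilon>\<^sup>2) \<le> real k - real ?K + ?F"
        using F K by (simp add: algebra_simps)
    qed (use u1 in simp)
    also have "(real n * (\<pi>1 - u + A u - 2 * \<epsilon>\<^sup>2)) / (real n * (1 - u)) = b u - 2 * \<epsilon> * (\<epsilon> / (1 - u))"
      using n u1 u by (simp add: b_eq diff_divide_distrib power2_eq_square)
    finally have "b u - 2 * \<epsilon> * (\<epsilon> / (1 - u)) \<le> FNP n (\<theta>, \<delta>)" .
    moreover have "2 * \<epsilon> * (\<epsilon> / (1 - u)) \<le> 2 * \<epsilon> * 1"
      using that \<epsilon> u1 by (intro mult_left_mono) auto
    ultimately show ?thesis by simp
  qed
  note bd = FDP_bounds(1)[OF \<theta> \<delta>] FNP_bounds(1)[OF \<theta> \<delta>]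
  consider "u < \<epsilon>" | "1 - \<epsilon> < u" "\<epsilon> \<le> u" | "\<epsilon> \<le> u" "u \<le> 1 - \<epsilon>" by linarith
  then have "a (truncate \<epsilon> u) \<le> FDP n (\<theta>, \<delta>) + 2 * \<epsilon> \<and> b (truncate \<epsilon> u) \<le> FNP n (\<theta>, \<delta>) + 3 * \<epsilon>"
  proof cases
    case 1
    have u1: "u < 1" using 1 \<epsilon> by simp
    \<comment> \<open>The truncated fraction is 0. For \<open>a 0 = 0\<close> nothing has to be
      shown, and \<open>b u\<close> is below \<open>b 0\<close> by at most
      \<open>\<epsilon>\<close>.\<close>
    have "b 0 - \<epsilon> \<le> \<pi>1 - u + A u" using 1 A_nonneg[OF u] by (simp add: b_0)
    also have "\<dots> \<le> (\<pi>1 - u + A u) / (1 - u)"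
      using B_nonneg[OF u] u u1 by (simp add: pos_le_divide_eq mult_left_le)
    also have "\<dots> = b u" using u u1 by (simp add: b_eq)
    finally show ?thesis using 1 b_low bd \<epsilon> by (simp add: truncate_def)
  next
    case 2
    have u0: "0 < u" using 2 \<epsilon> by simp
    \<comment> \<open>Symmetrically the truncated fraction is 1, \<open>b 1 = 0\<close> is trivial,
      and \<open>a u\<close> is below \<open>a 1\<close> by at most
      \<open>\<epsilon>\<close>.\<close>
    have "a 1 - \<epsilon> \<le> A u" using 2 B_nonneg[OF u] \<pi>_sum by (simp add: a_1)
    also have "\<dots> \<le> A u / u"
      using A_nonneg[OF u] u u0 by (simp add: pos_le_divide_eq mult_left_le)
    also have "\<dots> = a u" using u u0 by (simp add: a_eq)
    finally show ?thesis using 2 a_low bd \<epsilon> by (simp add: truncate_def)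
  next
    case 3
    then show ?thesis using a_low b_low \<epsilon> by (simp add: truncate_def)
  qed
  then show "a (truncate \<epsilon> u) \<le> FDP n (\<theta>, \<delta>) + 2 * \<epsilon>"
    "b (truncate \<epsilon> u) \<le> FNP n (\<theta>, \<delta>) + 3 * \<epsilon>" by auto
qed

text \<open>The law of the truncated fraction competes in the infimum defining \<open>bss\<close>.
  The pointwise comparison costs \<open>2 * \<epsilon>\<close> and \<open>3 * \<epsilon>\<close>; on
  the deficient event everything is bounded by 1, so it adds its probability, at most
  \<open>\<epsilon>\<close>.\<close>

lemma converse_bound:
  assumes \<kappa>: "\<kappa> \<in> decision_rules M n" and k: "k \<le> n" and n: "0 < n"
    and \<epsilon>: "0 < \<epsilon>" "\<epsilon> \<le> 1 / 2" and near: "\<bar>real k / real n - \<pi>1\<bar> \<le> \<epsilon>\<^sup>2"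
    and bad: "(\<integral>y. indicator (deficient n (\<epsilon>\<^sup>2)) y \<partial>joint_law M f0 f1 n k \<kappa>) \<le> \<epsilon>"
  shows "bss (FDR M f0 f1 n k \<kappa> + 3 * \<epsilon>) \<le> FNR M f0 f1 n k \<kappa> + 4 * \<epsilon>"
proof -
  let ?J = "joint_law M f0 f1 n k \<kappa>"
  let ?I = "\<lambda>y. indicator (deficient n (\<epsilon>\<^sup>2)) y :: real"
  define U where "U = (\<lambda>(\<theta> :: nat \<Rightarrow> nat, \<delta>). truncate \<epsilon> (real (discoveries n \<delta>) / real n))"
  let ?N = "distr ?J (restrict_space borel {0..1}) U"
  interpret J: prob_space ?J by (rule prob_space_joint_law[OF \<kappa>])
  have sets_J: "sets ?J = UNIV" by (rule prob_space_joint_law[OF \<kappa>])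
  then have sp_J: "space ?J = UNIV" using sets.sets_into_space[of UNIV ?J] by auto
  have U_range: "U y \<in> {0..1}" for y
    using \<epsilon> by (auto simp: U_def truncate_def split: prod.split)
  have U: "U \<in> ?J \<rightarrow>\<^sub>M restrict_space borel {0..1}"
    using U_range by (auto simp: measurable_def sets_J sp_J space_restrict_space)
  have N: "?N \<in> laws"
    using J.prob_space_distr[OF U] by (simp add: space_prob_algebra)
  have int_N: "(\<integral>u. a u \<partial>?N) = (\<integral>y. a (U y) \<partial>?J)" "(\<integral>u. b u \<partial>?N) = (\<integral>y. b (U y) \<partial>?J)"
    using U ab_measurable by (auto intro!: integral_distr)
  have int_ab: "integrable ?J (\<lambda>y. a (U y))" "integrable ?J (\<lambda>y. b (U y))"
    using law_integrable[OF N] U ab_measurable by (auto simp: integrable_distr_eq)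
  have int_I: "integrable ?J ?I"
    by (intro J.integrable_const_bound[where B = 1] borel_measurable_indicator) (auto simp: sets_J)
  note int = integrable_FDP_FNP[OF \<kappa> k] int_ab int_I
  have "AE y in ?J. a (U y) \<le> FDP n y + 2 * \<epsilon> + ?I y \<and> b (U y) \<le> FNP n y + 3 * \<epsilon> + ?I y"
    using AE_joint_law[OF \<kappa> k]
  proof eventually_elim
    case (elim y)
    then obtain \<theta> \<delta> where y: "y = (\<theta>, \<delta>)" "\<theta> \<in> fixed_sum_vectors n k" "\<delta> \<in> binary_vectors n" by auto
    show ?case
    proof (cases "y \<in> deficient n (\<epsilon>\<^sup>2)")
      case True
      then show ?thesis
        using abs_ab_le[OF U_range[of y]] FDP_bounds[OF y(2,3)] FNP_bounds[OF y(2,3)] \<epsilon>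
        by (simp only: indicator_simps y(1)) linarith
    next
      case False
      then show ?thesis
        using proportions_lower_bound[OF y(2,3) n \<epsilon> near] by (simp add: y(1) U_def)
    qed
  qed
  then have "(\<integral>y. a (U y) \<partial>?J) \<le> (\<integral>y. FDP n y + 2 * \<epsilon> + ?I y \<partial>?J)"
    "(\<integral>y. b (U y) \<partial>?J) \<le> (\<integral>y. FNP n y + 3 * \<epsilon> + ?I y \<partial>?J)"
    using int by (auto intro!: integral_mono_AE simp del: Bochner_Integration.integral_add)
  moreover have "(\<integral>y. FDP n y + 2 * \<epsilon> + ?I y \<partial>?J) = FDR M f0 f1 n k \<kappa> + 2 * \<epsilon> + (\<integral>y. ?I y \<partial>?J)"
    "(\<integral>y. FNP n y + 3 * \<epsilon> + ?I y \<partial>?J) = FNR M f0 f1 n k \<kappa> + 3 * \<epsilon> + (\<integral>y. ?I y \<partial>?J)"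
    using int by (simp_all add: FDR_eq_FDP FNR_eq_FNP J.prob_space)
  ultimately have "(\<integral>u. a u \<partial>?N) \<le> FDR M f0 f1 n k \<kappa> + 3 * \<epsilon>"
    "(\<integral>u. b u \<partial>?N) \<le> FNR M f0 f1 n k \<kappa> + 4 * \<epsilon>"
    unfolding int_N using bad by linarith+
  then show ?thesis by (rule order_trans[OF bss_le[OF N]])
qed

text \<open>This rule is feasible at every nonnegative level, so \<open>FNR_opt\<close> is the
  infimum of a nonempty set.\<close>

definition no_discoveries :: "nat \<Rightarrow> (nat \<Rightarrow> 'a) \<Rightarrow> (nat \<Rightarrow> nat) measure" where
  "no_discoveries n = kernel_of_weights n (\<lambda>\<delta> x. of_bool (\<delta> = (\<lambda>i\<in>{..<n}. 0)))"

lemma no_discoveries: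
  assumes "k \<le> n"
  shows "no_discoveries n \<in> decision_rules M n" "FDR M f0 f1 n k (no_discoveries n) = 0"
proof -
  let ?z = "\<lambda>i\<in>{..<n}. 0 :: nat" and ?w = "\<lambda>\<delta> x. of_bool (\<delta> = (\<lambda>i\<in>{..<n}. 0 :: nat)) :: real"
  have z: "?z \<in> binary_vectors n" by (auto simp: binary_vectors_def)
  have w: "is_rule_weights M n ?w"
    using z by (auto simp: is_rule_weights_def of_bool_def sum.delta)
  then show rule: "no_discoveries n \<in> decision_rules M n"
    unfolding no_discoveries_def by (rule kernel_of_weights_decision_rule)
  have "(\<Sum>\<delta>\<in>binary_vectors n. FDP n (\<theta>, \<delta>) * measure (no_discoveries n x) {\<delta>}) = 0"
    if "x \<in> space (PiM {..<n} (\<lambda>_. M))" for \<theta> x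
  proof (rule sum.neutral, rule ballI)
    fix \<delta> assume "\<delta> \<in> binary_vectors n"
    then show "FDP n (\<theta>, \<delta>) * measure (no_discoveries n x) {\<delta>} = 0"
      using measure_kernel_of_weights[OF w that]
      by (cases "\<delta> = ?z") (simp_all add: no_discoveries_def FDP_def)
  qed
  then have "(\<integral>x. (\<Sum>\<delta>\<in>binary_vectors n. FDP n (\<theta>, \<delta>) * measure (no_discoveries n x) {\<delta>})
      \<partial>observation_law M f0 f1 n \<theta>) = (\<integral>x. 0 \<partial>observation_law M f0 f1 n \<theta>)" for \<theta>
    by (intro Bochner_Integration.integral_cong) auto
  moreover have "FDR M f0 f1 n k (no_discoveries n)
      = (\<Sum>\<theta>\<in>fixed_sum_vectors n k.
          \<integral>x. (\<Sum>\<delta>\<in>binary_vectors n. FDP n (\<theta>, \<delta>) * measure (no_discoveries n x) {\<delta>})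
            \<partial>observation_law M f0 f1 n \<theta>) / card (fixed_sum_vectors n k)"
    unfolding FDR_eq_FDP
    by (intro joint_law_integral_support(2)[OF rule assms, where B = 1] abs_FDP_FNP_le)
  ultimately show "FDR M f0 f1 n k (no_discoveries n) = 0" by simp
qed

section \<open>The optimal rate and its asymptotic lower bound\<close>

lemma FNR_opt_le:
  assumes "\<kappa> \<in> decision_rules M n" "FDR M f0 f1 n k \<kappa> \<le> \<alpha>" "k \<le> n"
  shows "FNR_opt M f0 f1 n k \<alpha> \<le> FNR M f0 f1 n k \<kappa>"
  unfolding FNR_opt_def using assms FDR_FNR_bounds(2)
  by (intro cINF_lower bdd_belowI2[where m = 0]) auto

lemma FNR_opt_greatest:
  assumes "0 \<le> \<alpha>" "k \<le> n"
    "\<And>\<kappa>. \<kappa> \<in> decision_rules M n \<Longrightarrow> FDR M f0 f1 n k \<kappa> \<le> \<alpha> \<Longrightarrow> y \<le> FNR M f0 f1 n k \<kappa>"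
  shows "y \<le> FNR_opt M f0 f1 n k \<alpha>"
  unfolding FNR_opt_def
proof (rule cINF_greatest)
  show "{\<kappa> \<in> decision_rules M n. FDR M f0 f1 n k \<kappa> \<le> \<alpha>} \<noteq> {}"
    using no_discoveries[OF assms(2)] assms(1) by auto
qed (use assms in auto)

lemma FNR_opt_nonneg: "0 \<le> \<alpha> \<Longrightarrow> k \<le> n \<Longrightarrow> 0 \<le> FNR_opt M f0 f1 n k \<alpha>"
  by (rule FNR_opt_greatest) (simp_all add: FDR_FNR_bounds(2))

lemma deficient_prob_tendsto_0:
  fixes \<eta> \<epsilon> :: real
  assumes n1: "\<And>n. n1 n \<le> n" and lim: "(\<lambda>n. real (n1 n) / real n) \<longlonglongrightarrow> \<pi>1"
    and \<eta>: "0 < \<eta>" "\<eta> \<le> 1" and \<epsilon>: "0 < \<epsilon>"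
  shows "\<forall>\<^sub>F n in sequentially. \<forall>\<kappa>\<in>decision_rules M n.
    (\<integral>y. indicator (deficient n \<eta>) y \<partial>joint_law M f0 f1 n (n1 n) \<kappa>) \<le> \<epsilon>"
proof -
  \<comment> \<open>Half of the Chernoff rate \<open>\<eta>\<^sup>2 / 4\<close>: one half pays for
    the lower bound on the conditioning probability, the other makes the quotient vanish.\<close>
  define c where "c = \<eta>\<^sup>2 / 8"
  have c: "0 < c" using \<eta> by (simp add: c_def)
  have "\<forall>\<^sub>F n in sequentially. real (n + 1) ^ 2 * exp (- c * real n) < \<epsilon>"
    by (rule order_tendstoD(2)[OF poly_times_exp_tendsto_0[OF c] \<epsilon>])
  moreover have "\<forall>\<^sub>F n in sequentially. exp (- c * real n)
      \<le> real (n + 1) * (real (n choose n1 n) * \<pi>1 ^ n1 n * \<pi>0 ^ (n - n1 n))"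
    by (rule binomial_prob_subexponential[OF \<pi>0_pos \<pi>1_pos \<pi>_sum n1 lim c])
  ultimately show ?thesis using eventually_gt_at_top[of 0]
  proof eventually_elim
    case (elim n)
    define P where "P = real (n choose n1 n) * \<pi>1 ^ n1 n * \<pi>0 ^ (n - n1 n)"
    have P: "0 < P" using n1[of n] \<pi>0_pos \<pi>1_pos by (simp add: P_def)
    have "(real n + 1) * exp (- (real n * \<eta>\<^sup>2 / 4)) / P
        = (real n + 1) * exp (- c * real n) * exp (- c * real n) / P"
      by (simp add: c_def field_simps flip: exp_add)
    also have "\<dots> \<le> (real n + 1) * exp (- c * real n) * (real (n + 1) * P) / P"
      using elim(2)[folded P_def] P by (intro divide_right_mono mult_left_mono) auto
    also have "\<dots> = real (n + 1) ^ 2 * exp (- c * real n)"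
      using P by (simp add: power2_eq_square)
    finally have "(real n + 1) * exp (- (real n * \<eta>\<^sup>2 / 4)) / P \<le> \<epsilon>" using elim(1) by simp
    then show ?case
      using deficient_prob_le[OF _ n1 elim(3) \<eta>, folded P_def] by (meson order_trans)
  qed
qed

lemma FNR_opt_eventually_ge:
  assumes n1: "\<And>n. n1 n \<le> n" and lim: "(\<lambda>n. real (n1 n) / real n) \<longlonglongrightarrow> \<pi>1"
    and \<alpha>: "0 \<le> \<alpha>" "\<alpha> < 1" and \<zeta>: "0 < \<zeta>"
  shows "\<forall>\<^sub>F n in sequentially. bss \<alpha> - \<zeta> \<le> FNR_opt M f0 f1 n (n1 n) \<alpha>"
proof -
  obtain e where e: "0 < e" "bss \<alpha> - \<zeta> / 2 \<le> bss (\<alpha> + e)"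
    using bss_right_continuous[OF \<alpha>, of "\<zeta> / 2"] \<zeta> by auto
  \<comment> \<open>The converse bound raises the level by \<open>3 * \<epsilon>\<close>, which
    \<open>e\<close> must cover, and the rate by \<open>4 * \<epsilon>\<close>, which the second
    half of \<open>\<zeta>\<close> must cover.\<close>
  define \<epsilon> where "\<epsilon> = min (1 / 2) (min (e / 3) (\<zeta> / 8))"
  have \<epsilon>: "0 < \<epsilon>" "\<epsilon> \<le> 1 / 2" "3 * \<epsilon> \<le> e" "4 * \<epsilon> \<le> \<zeta> / 2"
  proof -
    have "\<epsilon> \<le> min (e / 3) (\<zeta> / 8)" unfolding \<epsilon>_def by (rule min.cobounded2)
    then show "3 * \<epsilon> \<le> e" "4 * \<epsilon> \<le> \<zeta> / 2" by auto
    show "\<epsilon> \<le> 1 / 2" unfolding \<epsilon>_def by (rule min.cobounded1)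
    show "0 < \<epsilon>" using e(1) \<zeta> by (simp add: \<epsilon>_def)
  qed
  have "\<forall>\<^sub>F n in sequentially. dist (real (n1 n) / real n) \<pi>1 < \<epsilon>\<^sup>2"
    using \<epsilon>(1) by (intro tendstoD[OF lim]) simp
  moreover have "\<forall>\<^sub>F n in sequentially. \<forall>\<kappa>\<in>decision_rules M n.
      (\<integral>y. indicator (deficient n (\<epsilon>\<^sup>2)) y \<partial>joint_law M f0 f1 n (n1 n) \<kappa>) \<le> \<epsilon>"
    using \<epsilon> by (intro deficient_prob_tendsto_0 n1 lim) (auto simp: power_le_one)
  ultimately show ?thesis using eventually_gt_at_top[of 0]
  proof eventually_elim
    case (elim n)
    show ?case
    proof (rule FNR_opt_greatest[OF \<alpha>(1) n1])
      fix \<kappa> assume \<kappa>: "\<kappa> \<in> decision_rules M n" "FDR M f0 f1 n (n1 n) \<kappa> \<le> \<alpha>"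
      have "bss \<alpha> - \<zeta> / 2 \<le> bss (FDR M f0 f1 n (n1 n) \<kappa> + 3 * \<epsilon>)"
        using e(2) bss_antimono[of "FDR M f0 f1 n (n1 n) \<kappa> + 3 * \<epsilon>" "\<alpha> + e"]
          FDR_FNR_bounds(1)[OF \<kappa>(1) n1] \<kappa>(2) \<epsilon> by linarith
      also have "\<dots> \<le> FNR M f0 f1 n (n1 n) \<kappa> + 4 * \<epsilon>"
        using elim \<kappa>(1) by (intro converse_bound n1 \<epsilon>) (auto simp: dist_real_def)
      finally show "bss \<alpha> - \<zeta> \<le> FNR M f0 f1 n (n1 n) \<kappa>" using \<epsilon>(4) by simp
    qed
  qed
qed

end

subsection \<open>Randomised Neyman--Pearson rules\<close>

text \<open>For a Bernoulli variable V with parameter \<open>r\<close>, the variable c (V - r) is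
  centred and at most 1 in absolute value, so the linear terms of the quadratic bound cancel, for
  either sign of \<open>l\<close>.\<close>

lemma bernoulli_exp_moment:
  fixes r c l :: real
  assumes r: "0 \<le> r" "r \<le> 1" and c: "0 \<le> c" "c \<le> 1" and l: "\<bar>l\<bar> \<le> 1"
  shows "r * exp (l * (c * (1 - r))) + (1 - r) * exp (l * (c * (0 - r))) \<le> exp (l\<^sup>2)"
proof -
  have bound: "exp (l * (c * z)) \<le> 1 + l * (c * z) + l\<^sup>2" if z: "\<bar>z\<bar> \<le> 1" for z
  proof -
    have cz: "\<bar>c * z\<bar> \<le> 1" using c z by (simp add: abs_mult mult_le_one)
    then have "\<bar>l * (c * z)\<bar> \<le> \<bar>l\<bar>"
      unfolding abs_mult[of l] by (rule mult_right_le_one_le[OF abs_ge_zero abs_ge_zero])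
    then have "(l * (c * z))\<^sup>2 \<le> l\<^sup>2" "l * (c * z) \<le> 1"
      using l by (simp add: abs_le_square_iff, linarith)
    then show ?thesis using exp_le_quadratic[of "l * (c * z)"] by linarith
  qed
  have "r * exp (l * (c * (1 - r))) + (1 - r) * exp (l * (c * (0 - r)))
      \<le> r * (1 + l * (c * (1 - r)) + l\<^sup>2) + (1 - r) * (1 + l * (c * (0 - r)) + l\<^sup>2)"
    using r by (intro add_mono mult_left_mono bound) auto
  also have "\<dots> = 1 + l\<^sup>2" by (simp add: algebra_simps)
  also have "\<dots> \<le> exp (l\<^sup>2)" by (rule exp_ge_add_one_self)
  finally show ?thesis .
qed

text \<open>Exponential moments factor over the coordinates, and
  \<open>\<bar>y\<bar> \<le> exp y + exp (- y)\<close> turns them into a bound on the mean absolute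
  value, without the cross terms of a variance. The coefficients \<open>c\<close> are to be
  \<open>1 - \<theta> i\<close> for false discoveries and 1 for all discoveries.\<close>

lemma bernoulli_sum_abs_le:
  fixes r c :: "nat \<Rightarrow> real"
  assumes r: "\<And>i. i < n \<Longrightarrow> 0 \<le> r i \<and> r i \<le> 1" and c: "\<And>i. i < n \<Longrightarrow> 0 \<le> c i \<and> c i \<le> 1"
    and n: "0 < n"
  shows "(\<Sum>\<delta>\<in>binary_vectors n. \<bar>\<Sum>i<n. c i * (real (\<delta> i) - r i)\<bar>
      * (\<Prod>i<n. if \<delta> i = 0 then 1 - r i else r i)) \<le> 2 * exp 1 * sqrt n"
proof -
  let ?S = "\<lambda>\<delta>. \<Sum>i<n. c i * (real (\<delta> i) - r i)"
  let ?w = "\<lambda>\<delta>. \<Prod>i<n. if \<delta> i = (0::nat) then 1 - r i else r i"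
  \<comment> \<open>At this scale the product of \<open>n\<close> factors
    \<open>exp (l\<^sup>2)\<close> is \<open>exp 1\<close>, and dividing by \<open>l\<close> at the
    end produces the square root.\<close>
  define l where "l = 1 / sqrt n"
  have l: "0 < l" "l \<le> 1" "l\<^sup>2 = 1 / n" using n by (auto simp: l_def power_divide)
  have w: "0 \<le> ?w \<delta>" for \<delta> using r by (intro prod_nonneg) auto
  have mgf: "(\<Sum>\<delta>\<in>binary_vectors n. exp (m * ?S \<delta>) * ?w \<delta>) \<le> exp 1" if m: "\<bar>m\<bar> = l" for m
  proof -
    have m2: "m\<^sup>2 = 1 / n" using m l(3) by (metis power2_abs)
    let ?e = "\<lambda>i v. exp (m * (c i * (real v - r i))) * (if v = (0::nat) then 1 - r i else r i)"
    have "(\<Sum>\<delta>\<in>binary_vectors n. exp (m * ?S \<delta>) * ?w \<delta>) = (\<Sum>\<delta>\<in>binary_vectors n. \<Prod>i<n. ?e i (\<delta> i))"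
      by (simp only: sum_distrib_left exp_sum[OF finite_lessThan] prod.distrib)
    also have "\<dots> = (\<Prod>i<n. \<Sum>v\<in>{0, 1}. ?e i v)"
      unfolding binary_vectors_def by (rule prod_sum_PiE[symmetric]) auto
    also have "\<dots> \<le> (\<Prod>i<n. exp (m\<^sup>2))"
    proof (intro prod_mono conjI)
      fix i assume "i \<in> {..<n}"
      then have i: "0 \<le> r i" "r i \<le> 1" "0 \<le> c i" "c i \<le> 1" using r[of i] c[of i] by auto
      show "0 \<le> (\<Sum>v\<in>{0, 1}. ?e i v)" using i by (intro sum_nonneg) auto
      show "(\<Sum>v\<in>{0, 1}. ?e i v) \<le> exp (m\<^sup>2)"
        using bernoulli_exp_moment[OF i, of m] m l(2) by (simp add: mult.commute add.commute)
    qed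
    also have "\<dots> = exp 1" using n by (simp add: m2 flip: exp_of_nat_mult)
    finally show ?thesis .
  qed
  have "l * (\<Sum>\<delta>\<in>binary_vectors n. \<bar>?S \<delta>\<bar> * ?w \<delta>)
      = (\<Sum>\<delta>\<in>binary_vectors n. l * (\<bar>?S \<delta>\<bar> * ?w \<delta>))"
    by (rule sum_distrib_left)
  also have "\<dots> \<le> (\<Sum>\<delta>\<in>binary_vectors n. exp (l * ?S \<delta>) * ?w \<delta> + exp (- l * ?S \<delta>) * ?w \<delta>)"
  proof (rule sum_mono)
    fix \<delta>
    have "\<bar>y\<bar> \<le> exp y + exp (- y)" for y :: real
      using exp_ge_add_one_self[of y] exp_ge_add_one_self[of "- y"] exp_gt_zero[of y] exp_gt_zero[of "- y"]
      by linarith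
    from mult_right_mono[OF this[of "l * ?S \<delta>"] w[of \<delta>]]
    show "l * (\<bar>?S \<delta>\<bar> * ?w \<delta>) \<le> exp (l * ?S \<delta>) * ?w \<delta> + exp (- l * ?S \<delta>) * ?w \<delta>"
      using l(1) by (simp add: abs_mult distrib_right mult.assoc)
  qed
  also have "\<dots> \<le> exp 1 + exp 1"
    unfolding sum.distrib using l(1) by (intro add_mono mgf) auto
  finally have "l * (\<Sum>\<delta>\<in>binary_vectors n. \<bar>?S \<delta>\<bar> * ?w \<delta>) \<le> 2 * exp 1" by simp
  then show ?thesis using n by (simp add: l_def divide_le_eq)
qed

text \<open>Replaces a random denominator by a deterministic one. As \<open>F\<close> does not
  exceed \<open>max 1 K\<close>, the quotient moves up by at most the relative error of the
  denominator; the extra 1 pays for the maximum.\<close>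

lemma ratio_le:
  fixes F K m :: real
  assumes F: "0 \<le> F" "F \<le> K" and m: "0 < m"
  shows "F / max 1 K \<le> F / m + (\<bar>K - m\<bar> + 1) / m"
proof -
  let ?D = "max 1 K"
  have D: "0 < ?D" "F \<le> ?D" using F by auto
  have "m - ?D \<le> \<bar>K - m\<bar> + 1" by (auto simp: max_def)
  then have "(F / ?D) * (m - ?D) \<le> (F / ?D) * (\<bar>K - m\<bar> + 1)"
    using F D by (intro mult_left_mono) auto
  also have "\<dots> \<le> 1 * (\<bar>K - m\<bar> + 1)"
    using F D by (intro mult_right_mono) (simp_all add: divide_le_eq_1_pos)
  finally have "(F / ?D) * m \<le> F + (\<bar>K - m\<bar> + 1)"
    using D by (simp add: right_diff_distrib)
  then show ?thesis
    using m by (simp add: pos_le_divide_eq flip: add_divide_distrib)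
qed

context two_groups
begin

definition test_weights :: "nat \<Rightarrow> real \<Rightarrow> (nat \<Rightarrow> nat) \<Rightarrow> (nat \<Rightarrow> 'a) \<Rightarrow> real" where
  "test_weights n u \<delta> x = (\<Prod>i<n. if \<delta> i = 0 then 1 - s u (x i) else s u (x i))"

definition test_rule :: "nat \<Rightarrow> real \<Rightarrow> (nat \<Rightarrow> 'a) \<Rightarrow> (nat \<Rightarrow> nat) measure" where
  "test_rule n u = kernel_of_weights n (test_weights n u)"

definition rejection_prob :: "real \<Rightarrow> nat \<Rightarrow> real" where
  "rejection_prob u t = (\<integral>x. s u x \<partial>component t)"

lemma test_weights:
  assumes u: "u \<in> {0..1}"
  shows "is_rule_weights M n (test_weights n u)"
  unfolding is_rule_weights_def
proof (intro conjI ballI)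
  fix \<delta> :: "nat \<Rightarrow> nat"
  show "test_weights n u \<delta> \<in> borel_measurable (PiM {..<n} (\<lambda>_. M))"
  proof -
    have "(\<lambda>x. if \<delta> i = 0 then 1 - s u (x i) else s u (x i)) \<in> borel_measurable (PiM {..<n} (\<lambda>_. M))"
      if "i < n" for i
      using that by (cases "\<delta> i = 0") auto
    then show ?thesis unfolding test_weights_def by (intro borel_measurable_prod) auto
  qed
  show "0 \<le> test_weights n u \<delta> x" for x
    unfolding test_weights_def using s_bounds[OF u] by (intro prod_nonneg) auto
next
  fix x
  have "(\<Sum>\<delta>\<in>binary_vectors n. test_weights n u \<delta> x)
      = (\<Prod>i<n. \<Sum>v\<in>{0, 1 :: nat}. if v = 0 then 1 - s u (x i) else s u (x i))"
    unfolding test_weights_def binary_vectors_def by (rule prod_sum_PiE[symmetric]) auto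
  then show "(\<Sum>\<delta>\<in>binary_vectors n. test_weights n u \<delta> x) = 1" by simp
qed

lemma test_rule: "u \<in> {0..1} \<Longrightarrow> test_rule n u \<in> decision_rules M n"
  unfolding test_rule_def by (rule kernel_of_weights_decision_rule[OF test_weights])

lemma integrable_s_component: "u \<in> {0..1} \<Longrightarrow> integrable (component t) (s u)"
  using s_bounds
  by (intro finite_measure.integrable_const_bound[where B = 1] prob_space.finite_measure
      prob_space_component) auto

lemma rejection_prob_bounds:
  assumes u: "u \<in> {0..1}"
  shows "0 \<le> rejection_prob u t" "rejection_prob u t \<le> 1"
proof -
  interpret C: prob_space "component t" by (rule prob_space_component)
  show "0 \<le> rejection_prob u t"
    unfolding rejection_prob_def using s_bounds[OF u] by (intro integral_nonneg_AE AE_I2) auto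
  have "rejection_prob u t \<le> (\<integral>x. 1 \<partial>component t)"
    unfolding rejection_prob_def using s_bounds[OF u] integrable_s_component[OF u]
    by (intro integral_mono) auto
  then show "rejection_prob u t \<le> 1" using C.prob_space by simp
qed

lemma rejection_prob_0: "rejection_prob u 0 = A u / \<pi>0"
  by (simp add: rejection_prob_def integral_component posterior_def prior_weight_def A_def)

lemma rejection_prob_1:
  assumes u: "u \<in> {0..1}"
  shows "rejection_prob u 1 = (u - A u) / \<pi>1"
proof -
  have "(\<integral>x. (1 - W x) * s u x \<partial>Q) = (\<integral>x. s u x - W x * s u x \<partial>Q)"
    by (simp add: left_diff_distrib)
  also have "\<dots> = u - A u" using u by (simp add: integral_s A_def)
  finally show ?thesis by (simp add: rejection_prob_def integral_component posterior_def prior_weight_def)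
qed

text \<open>The test acts on each coordinate separately and the observations are independent given
  \<open>\<theta>\<close>. Once they are integrated out, the decisions are independent Bernoulli
  variables with parameters \<open>rejection_prob u (\<theta> i)\<close>.\<close>

lemma integral_test_weights:
  assumes u: "u \<in> {0..1}"
  shows "integrable (observation_law M f0 f1 n \<theta>) (test_weights n u \<delta>)"
    and "(\<integral>x. test_weights n u \<delta> x \<partial>observation_law M f0 f1 n \<theta>)
      = (\<Prod>i<n. if \<delta> i = 0 then 1 - rejection_prob u (\<theta> i) else rejection_prob u (\<theta> i))"
proof -
  interpret C: product_prob_space "\<lambda>i. component (\<theta> i)" "{..<n}"
    by (simp add: product_prob_space_def product_prob_space_axioms_def
        product_sigma_finite_def prob_space_imp_sigma_finite prob_space_component)
  let ?g = "\<lambda>i x. if \<delta> i = 0 then 1 - s u x else s u x"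
  have int: "integrable (component t) (?g i)" for i t
    using integrable_s_component[OF u, of t] prob_space.finite_measure[OF prob_space_component, of t]
    by (cases "\<delta> i = 0") (auto intro!: finite_measure.integrable_const)
  have val: "(\<integral>x. ?g i x \<partial>component t) = (if \<delta> i = 0 then 1 - rejection_prob u t else rejection_prob u t)" for i t
  proof -
    interpret D: prob_space "component t" by (rule prob_space_component)
    show ?thesis using integrable_s_component[OF u, of t] D.prob_space by (simp add: rejection_prob_def)
  qed
  show "integrable (observation_law M f0 f1 n \<theta>) (test_weights n u \<delta>)"
    unfolding observation_law_eq_PiM test_weights_def
    by (rule C.product_integrable_prod[of _ ?g]) (use int in auto)
  have "(\<integral>x. test_weights n u \<delta> x \<partial>observation_law M f0 f1 n \<theta>)
      = (\<Prod>i<n. \<integral>x. ?g i x \<partial>component (\<theta> i))"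
    unfolding observation_law_eq_PiM test_weights_def
    by (rule C.product_integral_prod[of _ ?g]) (use int in auto)
  then show "(\<integral>x. test_weights n u \<delta> x \<partial>observation_law M f0 f1 n \<theta>)
      = (\<Prod>i<n. if \<delta> i = 0 then 1 - rejection_prob u (\<theta> i) else rejection_prob u (\<theta> i))"
    by (simp only: val)
qed

lemma integral_joint_test_rule:
  fixes L :: "(nat \<Rightarrow> nat) \<times> (nat \<Rightarrow> nat) \<Rightarrow> real"
  assumes u: "u \<in> {0..1}" and k: "k \<le> n"
    and B: "\<And>\<theta> \<delta>. \<theta> \<in> fixed_sum_vectors n k \<Longrightarrow> \<delta> \<in> binary_vectors n \<Longrightarrow> \<bar>L (\<theta>, \<delta>)\<bar> \<le> B"
  shows "(\<integral>y. L y \<partial>joint_law M f0 f1 n k (test_rule n u))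
    = (\<Sum>\<theta>\<in>fixed_sum_vectors n k. \<Sum>\<delta>\<in>binary_vectors n. L (\<theta>, \<delta>)
        * (\<Prod>i<n. if \<delta> i = 0 then 1 - rejection_prob u (\<theta> i) else rejection_prob u (\<theta> i))) / card (fixed_sum_vectors n k)"
proof -
  have "(\<integral>x. (\<Sum>\<delta>\<in>binary_vectors n. L (\<theta>, \<delta>) * measure (test_rule n u x) {\<delta>})
        \<partial>observation_law M f0 f1 n \<theta>)
      = (\<Sum>\<delta>\<in>binary_vectors n. L (\<theta>, \<delta>)
        * (\<Prod>i<n. if \<delta> i = 0 then 1 - rejection_prob u (\<theta> i) else rejection_prob u (\<theta> i)))" for \<theta>
  proof -
    have "(\<integral>x. (\<Sum>\<delta>\<in>binary_vectors n. L (\<theta>, \<delta>) * measure (test_rule n u x) {\<delta>})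
        \<partial>observation_law M f0 f1 n \<theta>)
      = (\<integral>x. (\<Sum>\<delta>\<in>binary_vectors n. L (\<theta>, \<delta>) * test_weights n u \<delta> x) \<partial>observation_law M f0 f1 n \<theta>)"
      by (intro Bochner_Integration.integral_cong sum.cong refl)
        (simp add: test_rule_def measure_kernel_of_weights[OF test_weights[OF u]])
    also have "\<dots> = (\<Sum>\<delta>\<in>binary_vectors n. \<integral>x. L (\<theta>, \<delta>) * test_weights n u \<delta> x \<partial>observation_law M f0 f1 n \<theta>)"
      by (intro Bochner_Integration.integral_sum integrable_mult_right integral_test_weights(1)[OF u])
    finally show ?thesis by (simp only: integral_mult_right_zero integral_test_weights(2)[OF u])
  qed
  then show ?thesis
    using joint_law_integral_support(2)[where L = L, OF test_rule[OF u] k B] by simp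
qed

lemma sum_fixed_sum_vectors:
  fixes g :: "nat \<Rightarrow> real"
  assumes \<theta>: "\<theta> \<in> fixed_sum_vectors n k"
  shows "(\<Sum>i<n. g (\<theta> i)) = real (n - k) * g 0 + real k * g 1"
proof -
  note \<theta>' = fixed_sum_vectorsD[OF \<theta>]
  have "(\<Sum>i<n. g (\<theta> i)) = (\<Sum>i<n. g 0 + real (\<theta> i) * (g 1 - g 0))"
    using binary_vectorsD[OF \<theta>'(1)] by (intro sum.cong) force+
  also have "\<dots> = real n * g 0 + real (\<Sum>i<n. \<theta> i) * (g 1 - g 0)"
    by (simp add: sum.distrib sum_distrib_right)
  finally have eq: "(\<Sum>i<n. g (\<theta> i)) = real n * g 0 + real k * (g 1 - g 0)" by (simp add: \<theta>'(2))
  have "k \<le> n"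
    using \<theta>'(2) sum_mono[of "{..<n}" \<theta> "\<lambda>_. 1"] binary_vectorsD[OF \<theta>'(1)] by force
  then show ?thesis unfolding eq by (simp add: of_nat_diff algebra_simps)
qed

text \<open>The first term is the fluctuation of the two counts, \<open>2 * exp 1 / sqrt n\<close>
  for each; the others are the biases of their means, caused by \<open>k / n\<close> differing from
  \<open>\<pi>1\<close>.\<close>

definition test_error :: "nat \<Rightarrow> nat \<Rightarrow> real \<Rightarrow> real" where
  "test_error n k u = 4 * exp 1 / sqrt n + \<bar>real (n - k) / n * rejection_prob u 0 - A u\<bar>
     + \<bar>(real (n - k) * rejection_prob u 0 + real k * rejection_prob u 1) / n - u\<bar>"

definition deviation :: "nat \<Rightarrow> real \<Rightarrow> (nat \<Rightarrow> nat) \<times> (nat \<Rightarrow> nat) \<Rightarrow> real" where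
  "deviation n u = (\<lambda>(\<theta>, \<delta>).
     \<bar>false_discoveries n \<theta> \<delta> / n - A u\<bar> + \<bar>real (discoveries n \<delta>) / n - u\<bar>)"

text \<open>The bound holds for each \<open>\<theta>\<close> separately, since the means of both
  counts depend on \<open>\<theta>\<close> only through its sum.\<close>

lemma test_rule_concentration:
  assumes u: "u \<in> {0..1}" and k: "k \<le> n" and n: "0 < n"
  shows "(\<integral>y. deviation n u y \<partial>joint_law M f0 f1 n k (test_rule n u)) \<le> test_error n k u"
proof -
  let ?w = "\<lambda>\<theta> \<delta>. \<Prod>i<n. if \<delta> i = (0::nat) then 1 - rejection_prob u (\<theta> i) else rejection_prob u (\<theta> i)"
  let ?L = "\<lambda>\<theta> \<delta>. \<bar>false_discoveries n \<theta> \<delta> / n - A u\<bar> + \<bar>real (discoveries n \<delta>) / n - u\<bar>"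
  let ?\<Theta> = "fixed_sum_vectors n k" and ?D = "binary_vectors n"
  let ?e0 = "\<bar>real (n - k) / n * rejection_prob u 0 - A u\<bar>"
  let ?e1 = "\<bar>(real (n - k) * rejection_prob u 0 + real k * rejection_prob u 1) / n - u\<bar>"
  have per_\<theta>: "(\<Sum>\<delta>\<in>?D. ?L \<theta> \<delta> * ?w \<theta> \<delta>) \<le> test_error n k u" if \<theta>: "\<theta> \<in> ?\<Theta>" for \<theta>
  proof -
    note \<theta>' = fixed_sum_vectorsD[OF \<theta>]
    let ?S0 = "\<lambda>\<delta>. \<Sum>i<n. (1 - real (\<theta> i)) * (real (\<delta> i) - rejection_prob u (\<theta> i))"
    let ?S1 = "\<lambda>\<delta>. \<Sum>i<n. 1 * (real (\<delta> i) - rejection_prob u (\<theta> i))"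
    have w: "0 \<le> ?w \<theta> \<delta>" for \<delta>
      using rejection_prob_bounds[OF u] by (intro prod_nonneg) auto
    have w_sum: "(\<Sum>\<delta>\<in>?D. ?w \<theta> \<delta>) = 1"
    proof -
      have "(\<Sum>\<delta>\<in>?D. ?w \<theta> \<delta>)
          = (\<Prod>i<n. \<Sum>v\<in>{0, 1 :: nat}. if v = 0 then 1 - rejection_prob u (\<theta> i) else rejection_prob u (\<theta> i))"
        unfolding binary_vectors_def by (rule prod_sum_PiE[symmetric]) auto
      then show ?thesis by simp
    qed
    have S0: "false_discoveries n \<theta> \<delta> = ?S0 \<delta> + real (n - k) * rejection_prob u 0" for \<delta>
    proof -
      have "false_discoveries n \<theta> \<delta> = ?S0 \<delta> + (\<Sum>i<n. (1 - real (\<theta> i)) * rejection_prob u (\<theta> i))"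
        unfolding false_discoveries_def sum.distrib[symmetric]
        by (intro sum.cong) (simp_all add: algebra_simps)
      then show ?thesis
        using sum_fixed_sum_vectors[OF \<theta>, of "\<lambda>t. (1 - real t) * rejection_prob u t"] by simp
    qed
    have S1: "real (discoveries n \<delta>) = ?S1 \<delta> + (real (n - k) * rejection_prob u 0 + real k * rejection_prob u 1)" for \<delta>
    proof -
      have "real (discoveries n \<delta>) = ?S1 \<delta> + (\<Sum>i<n. rejection_prob u (\<theta> i))"
        by (simp add: discoveries_def sum_subtractf)
      then show ?thesis using sum_fixed_sum_vectors[OF \<theta>, of "rejection_prob u"] by simp
    qed
    have L_le: "?L \<theta> \<delta> \<le> \<bar>?S0 \<delta>\<bar> / n + \<bar>?S1 \<delta>\<bar> / n + (?e0 + ?e1)" for \<delta>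
    proof -
      have "false_discoveries n \<theta> \<delta> / n - A u = ?S0 \<delta> / n + (real (n - k) / n * rejection_prob u 0 - A u)"
        unfolding S0 by (simp add: add_divide_distrib)
      then have "\<bar>false_discoveries n \<theta> \<delta> / n - A u\<bar> \<le> \<bar>?S0 \<delta> / n\<bar> + ?e0"
        by (simp only: abs_triangle_ineq)
      moreover have "real (discoveries n \<delta>) / n - u
          = ?S1 \<delta> / n + ((real (n - k) * rejection_prob u 0 + real k * rejection_prob u 1) / n - u)"
        unfolding S1 by (simp add: add_divide_distrib)
      then have "\<bar>real (discoveries n \<delta>) / n - u\<bar> \<le> \<bar>?S1 \<delta> / n\<bar> + ?e1"
        by (simp only: abs_triangle_ineq)
      moreover have "\<bar>?S0 \<delta> / n\<bar> = \<bar>?S0 \<delta>\<bar> / n" "\<bar>?S1 \<delta> / n\<bar> = \<bar>?S1 \<delta>\<bar> / n"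
        by (simp_all only: abs_divide abs_of_nat)
      ultimately show ?thesis by linarith
    qed
    have "(\<Sum>\<delta>\<in>?D. ?L \<theta> \<delta> * ?w \<theta> \<delta>)
        \<le> (\<Sum>\<delta>\<in>?D. (\<bar>?S0 \<delta>\<bar> / n + \<bar>?S1 \<delta>\<bar> / n + (?e0 + ?e1)) * ?w \<theta> \<delta>)"
      by (intro sum_mono mult_right_mono L_le w)
    also have "\<dots> = (\<Sum>\<delta>\<in>?D. \<bar>?S0 \<delta>\<bar> * ?w \<theta> \<delta>) / n + (\<Sum>\<delta>\<in>?D. \<bar>?S1 \<delta>\<bar> * ?w \<theta> \<delta>) / n
        + (?e0 + ?e1) * (\<Sum>\<delta>\<in>?D. ?w \<theta> \<delta>)"
      by (simp only: distrib_right sum.distrib sum_divide_distrib sum_distrib_left times_divide_eq_left)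
    also have "\<dots> \<le> (2 * exp 1 * sqrt n) / n + (2 * exp 1 * sqrt n) / n + (?e0 + ?e1) * 1"
      unfolding w_sum
      by (intro add_mono divide_right_mono bernoulli_sum_abs_le n order_refl)
        (use rejection_prob_bounds[OF u] binary_vectorsD[OF \<theta>'(1)] in force)+
    also have "\<dots> = test_error n k u"
    proof -
      have "sqrt n / n = 1 / sqrt n"
        using n by (simp add: real_div_sqrt field_simps)
      then have "(2 * exp 1 * sqrt n) / n = 2 * exp 1 / sqrt n"
        by (metis times_divide_eq_right mult.right_neutral)
      then show ?thesis by (simp add: test_error_def)
    qed
    finally show ?thesis .
  qed
  have "\<bar>?L \<theta> \<delta>\<bar> \<le> 4" if "\<theta> \<in> ?\<Theta>" "\<delta> \<in> ?D" for \<theta> \<delta>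
  proof -
    have "0 \<le> false_discoveries n \<theta> \<delta> / n" "false_discoveries n \<theta> \<delta> / n \<le> 1"
      "0 \<le> real (discoveries n \<delta>) / n" "real (discoveries n \<delta>) / n \<le> 1"
      using false_discoveries_bounds[OF fixed_sum_vectorsD(1)[OF that(1)] that(2)]
        discoveries_le[OF that(2)] n by (auto simp: divide_le_eq_1_pos)
    moreover have "0 \<le> A u" "A u \<le> 1" "0 \<le> u" "u \<le> 1"
      using A_nonneg[OF u] A_le[OF u] u by auto
    ultimately have "\<bar>false_discoveries n \<theta> \<delta> / n - A u\<bar> \<le> 1" "\<bar>real (discoveries n \<delta>) / n - u\<bar> \<le> 1"
      by linarith+
    then show ?thesis by simp
  qed
  then have "(\<integral>(\<theta>, \<delta>). ?L \<theta> \<delta> \<partial>joint_law M f0 f1 n k (test_rule n u))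
      = (\<Sum>\<theta>\<in>?\<Theta>. \<Sum>\<delta>\<in>?D. ?L \<theta> \<delta> * ?w \<theta> \<delta>) / card ?\<Theta>"
    by (subst integral_joint_test_rule[OF u k, of _ 4]) auto
  also have "\<dots> \<le> (\<Sum>\<theta>\<in>?\<Theta>. test_error n k u) / card ?\<Theta>"
    by (intro divide_right_mono sum_mono per_\<theta>) auto
  also have "\<dots> = test_error n k u"
    using k by (simp add: card_fixed_sum_vectors)
  finally show ?thesis by (simp add: deviation_def)
qed

lemma integrable_deviation:
  assumes \<kappa>: "\<kappa> \<in> decision_rules M n" and k: "k \<le> n"
  shows "integrable (joint_law M f0 f1 n k \<kappa>) (deviation n u)"
proof (rule joint_law_integral_support(1)[OF \<kappa> k])
  fix \<theta> \<delta> assume "\<theta> \<in> fixed_sum_vectors n k" "\<delta> \<in> binary_vectors n"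
  then show "\<bar>deviation n u (\<theta>, \<delta>)\<bar>
      \<le> Max ((\<lambda>y. \<bar>deviation n u y\<bar>) ` (fixed_sum_vectors n k \<times> binary_vectors n))"
    by (intro Max_ge) auto
qed

lemma FDP_le_deviation:
  assumes \<theta>: "\<theta> \<in> fixed_sum_vectors n k" and \<delta>: "\<delta> \<in> binary_vectors n" and n: "0 < n"
    and u: "0 < u" "u \<le> 1"
  shows "FDP n (\<theta>, \<delta>) \<le> a u + (deviation n u (\<theta>, \<delta>) + 1 / n) / u"
proof -
  let ?F = "false_discoveries n \<theta> \<delta>" and ?K = "real (discoveries n \<delta>)"
  have m: "0 < n * u" using n u by simp
  have "FDP n (\<theta>, \<delta>) \<le> ?F / (n * u) + (\<bar>?K - n * u\<bar> + 1) / (n * u)"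
    unfolding FDP_eq
    by (rule ratio_le[OF false_discoveries_bounds[OF fixed_sum_vectorsD(1)[OF \<theta>] \<delta>] m])
  also have "?F / (n * u) = (?F / n) / u" by simp
  also have "(\<bar>?K - n * u\<bar> + 1) / (n * u) = (\<bar>?K / n - u\<bar> + 1 / n) / u"
  proof -
    have "?K / n - u = (?K - n * u) / n" using n by (simp add: diff_divide_distrib)
    then have "\<bar>?K / n - u\<bar> = \<bar>?K - n * u\<bar> / n" by (simp only: abs_divide abs_of_nat)
    then show ?thesis by (simp add: add_divide_distrib)
  qed
  also have "(?F / n) / u + (\<bar>?K / n - u\<bar> + 1 / n) / u
      = (?F / n + \<bar>?K / n - u\<bar> + 1 / n) / u"
    by (simp add: add_divide_distrib)
  also have "\<dots> \<le> (A u + deviation n u (\<theta>, \<delta>) + 1 / n) / u"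
    using u by (intro divide_right_mono) (auto simp: deviation_def)
  also have "\<dots> = a u + (deviation n u (\<theta>, \<delta>) + 1 / n) / u"
    using u by (simp add: a_eq add_divide_distrib)
  finally show ?thesis .
qed

text \<open>The deviation counts twice because the number of discoveries enters the numerator as
  well as the denominator.\<close>

lemma FNP_le_deviation:
  assumes \<theta>: "\<theta> \<in> fixed_sum_vectors n k" and \<delta>: "\<delta> \<in> binary_vectors n" and n: "0 < n"
    and u: "0 \<le> u" "u < 1"
  shows "FNP n (\<theta>, \<delta>) \<le> b u + (2 * deviation n u (\<theta>, \<delta>) + \<bar>k / n - \<pi>1\<bar> + 1 / n) / (1 - u)"
proof -
  let ?F = "false_discoveries n \<theta> \<delta>" and ?K = "real (discoveries n \<delta>)"
  let ?G = "real k - ?K + ?F"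
  have m: "0 < n * (1 - u)" using n u by simp
  have "FNP n (\<theta>, \<delta>) \<le> ?G / (n * (1 - u)) + (\<bar>(n - ?K) - n * (1 - u)\<bar> + 1) / (n * (1 - u))"
    unfolding FNP_eq[OF \<theta>] by (rule ratio_le[OF false_nondiscoveries_bounds[OF \<theta> \<delta>] m])
  also have "?G / (n * (1 - u)) = (?G / n) / (1 - u)" by simp
  also have "(\<bar>(n - ?K) - n * (1 - u)\<bar> + 1) / (n * (1 - u)) = (\<bar>?K / n - u\<bar> + 1 / n) / (1 - u)"
  proof -
    have "\<bar>(n - ?K) - n * (1 - u)\<bar> = \<bar>?K - n * u\<bar>" by (simp add: algebra_simps abs_minus_commute)
    moreover have "?K / n - u = (?K - n * u) / n" using n by (simp add: diff_divide_distrib)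
    then have "\<bar>?K / n - u\<bar> = \<bar>?K - n * u\<bar> / n" by (simp only: abs_divide abs_of_nat)
    ultimately show ?thesis by (simp add: add_divide_distrib)
  qed
  also have "(?G / n) / (1 - u) + (\<bar>?K / n - u\<bar> + 1 / n) / (1 - u)
      = (?G / n + \<bar>?K / n - u\<bar> + 1 / n) / (1 - u)"
    by (simp add: add_divide_distrib)
  also have "\<dots> \<le> (\<pi>1 - u + A u + (2 * deviation n u (\<theta>, \<delta>) + \<bar>k / n - \<pi>1\<bar> + 1 / n)) / (1 - u)"
  proof (rule divide_right_mono)
    have "?G / n = k / n - ?K / n + ?F / n" by (simp add: add_divide_distrib diff_divide_distrib)
    moreover have "k / n - \<pi>1 \<le> \<bar>k / n - \<pi>1\<bar>" "u - ?K / n \<le> \<bar>?K / n - u\<bar>"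
      "?F / n - A u \<le> \<bar>?F / n - A u\<bar>" "0 \<le> \<bar>?F / n - A u\<bar>"
      by simp_all
    moreover have "deviation n u (\<theta>, \<delta>) = \<bar>?F / n - A u\<bar> + \<bar>?K / n - u\<bar>"
      by (simp add: deviation_def)
    ultimately show "?G / n + \<bar>?K / n - u\<bar> + 1 / n
        \<le> \<pi>1 - u + A u + (2 * deviation n u (\<theta>, \<delta>) + \<bar>k / n - \<pi>1\<bar> + 1 / n)"
      by linarith
  qed (use u in simp)
  also have "\<dots> = b u + (2 * deviation n u (\<theta>, \<delta>) + \<bar>k / n - \<pi>1\<bar> + 1 / n) / (1 - u)"
    using u by (simp add: b_eq add_divide_distrib)
  finally show ?thesis .
qed

lemma test_rule_rates_le:
  assumes u: "u \<in> {0..1}" and k: "k \<le> n" and n: "0 < n"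
  shows "0 < u \<Longrightarrow> FDR M f0 f1 n k (test_rule n u) \<le> a u + (test_error n k u + 1 / n) / u"
    and "u < 1 \<Longrightarrow> FNR M f0 f1 n k (test_rule n u)
      \<le> b u + (2 * test_error n k u + \<bar>k / n - \<pi>1\<bar> + 1 / n) / (1 - u)"
proof -
  let ?J = "joint_law M f0 f1 n k (test_rule n u)"
  note rule = test_rule[OF u, of n]
  interpret J: prob_space ?J by (rule prob_space_joint_law[OF rule])
  note int = integrable_FDP_FNP[OF rule k] integrable_deviation[OF rule k, of u]
  note dev = test_rule_concentration[OF u k n]
  show "FDR M f0 f1 n k (test_rule n u) \<le> a u + (test_error n k u + 1 / n) / u" if u': "0 < u"
  proof -
    have "FDR M f0 f1 n k (test_rule n u) \<le> (\<integral>y. a u + (deviation n u y + 1 / n) / u \<partial>?J)"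
      unfolding FDR_eq_FDP
    proof (rule integral_mono_AE)
      show "AE y in ?J. FDP n y \<le> a u + (deviation n u y + 1 / n) / u"
        using AE_joint_law[OF rule k]
        by eventually_elim (use FDP_le_deviation[OF _ _ n u'] u in auto)
    qed (use int in auto)
    also have "\<dots> = a u + ((\<integral>y. deviation n u y \<partial>?J) + 1 / n) / u"
      using int by (simp add: J.prob_space)
    also have "\<dots> \<le> a u + (test_error n k u + 1 / n) / u"
      using dev u' by (intro add_left_mono divide_right_mono add_right_mono) auto
    finally show ?thesis .
  qed
  show "FNR M f0 f1 n k (test_rule n u)
      \<le> b u + (2 * test_error n k u + \<bar>k / n - \<pi>1\<bar> + 1 / n) / (1 - u)" if u': "u < 1"
  proof -
    have "FNR M f0 f1 n k (test_rule n u)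
        \<le> (\<integral>y. b u + (2 * deviation n u y + \<bar>k / n - \<pi>1\<bar> + 1 / n) / (1 - u) \<partial>?J)"
      unfolding FNR_eq_FNP
    proof (rule integral_mono_AE)
      show "AE y in ?J. FNP n y \<le> b u + (2 * deviation n u y + \<bar>k / n - \<pi>1\<bar> + 1 / n) / (1 - u)"
        using AE_joint_law[OF rule k]
        by eventually_elim (use FNP_le_deviation[OF _ _ n _ u'] u in auto)
    qed (use int in auto)
    also have "\<dots> = b u + (2 * (\<integral>y. deviation n u y \<partial>?J) + \<bar>k / n - \<pi>1\<bar> + 1 / n) / (1 - u)"
      using int by (simp add: J.prob_space)
    also have "\<dots> \<le> b u + (2 * test_error n k u + \<bar>k / n - \<pi>1\<bar> + 1 / n) / (1 - u)"
      using dev u' by (intro add_left_mono divide_right_mono add_right_mono) auto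
    finally show ?thesis .
  qed
qed

text \<open>Level 0 demands that the rate vanish exactly for each \<open>n\<close>. If
  \<open>A u = 0\<close>, the test almost surely never rejects under the null, so a decision with a
  false discovery has weight 0.\<close>

lemma test_rule_FDR_0:
  assumes u: "u \<in> {0..1}" and k: "k \<le> n" and A0: "A u = 0"
  shows "FDR M f0 f1 n k (test_rule n u) = 0"
proof -
  have zero: "FDP n (\<theta>, \<delta>) * (\<Prod>i<n. if \<delta> i = 0 then 1 - rejection_prob u (\<theta> i) else rejection_prob u (\<theta> i)) = 0"
    if \<theta>: "\<theta> \<in> fixed_sum_vectors n k" for \<theta> \<delta>
  proof (cases "\<exists>i<n. \<delta> i \<noteq> 0 \<and> \<theta> i = 0")
    case True
    then obtain i where "i < n" "\<delta> i \<noteq> 0" "\<theta> i = 0" by auto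
    then have "(\<Prod>i<n. if \<delta> i = 0 then 1 - rejection_prob u (\<theta> i) else rejection_prob u (\<theta> i)) = 0"
      by (intro prod_zero bexI[of _ i]) (auto simp: rejection_prob_0 A0)
    then show ?thesis by simp
  next
    case False
    have "real (\<delta> i) * (1 - real (\<theta> i)) = 0" if "i < n" for i
      using False that binary_vectorsD[OF fixed_sum_vectorsD(1)[OF \<theta>] that] by auto
    then have "false_discoveries n \<theta> \<delta> = 0"
      unfolding false_discoveries_def by (intro sum.neutral) simp
    then show ?thesis by (simp add: FDP_eq)
  qed
  have "(\<Sum>\<theta>\<in>fixed_sum_vectors n k. \<Sum>\<delta>\<in>binary_vectors n. FDP n (\<theta>, \<delta>)
      * (\<Prod>i<n. if \<delta> i = 0 then 1 - rejection_prob u (\<theta> i) else rejection_prob u (\<theta> i))) = 0"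
    by (intro sum.neutral ballI zero)
  then show ?thesis
    unfolding FDR_eq_FDP
    by (subst integral_joint_test_rule[where L = "FDP n", OF u k abs_FDP_FNP_le(1)])
      (assumption, assumption, simp only: div_0)
qed

text \<open>Covers the size at which the deviation bound would divide by \<open>1 - u = 0\<close>:
  the test of size 1 rejects every coordinate almost surely, and nothing is missed.\<close>

lemma test_rule_FNR_0:
  assumes k: "k \<le> n"
  shows "FNR M f0 f1 n k (test_rule n 1) = 0"
proof -
  have pow: "rejection_prob 1 t = 1" if "t = 0 \<or> t = 1" for t
    using that \<pi>0_pos \<pi>1_pos \<pi>_sum rejection_prob_1[of 1] by (auto simp: rejection_prob_0 A_1 divide_eq_1_iff)
  have zero: "FNP n (\<theta>, \<delta>) * (\<Prod>i<n. if \<delta> i = 0 then 1 - rejection_prob 1 (\<theta> i) else rejection_prob 1 (\<theta> i)) = 0"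
    if \<theta>: "\<theta> \<in> fixed_sum_vectors n k" and \<delta>: "\<delta> \<in> binary_vectors n" for \<theta> \<delta>
  proof (cases "\<exists>i<n. \<delta> i = 0")
    case True
    then obtain i where i: "i < n" "\<delta> i = 0" by auto
    then have "rejection_prob 1 (\<theta> i) = 1"
      using pow binary_vectorsD[OF fixed_sum_vectorsD(1)[OF \<theta>]] by blast
    then have "(\<Prod>i<n. if \<delta> i = 0 then 1 - rejection_prob 1 (\<theta> i) else rejection_prob 1 (\<theta> i)) = 0"
      using i by (intro prod_zero bexI[of _ i]) auto
    then show ?thesis by simp
  next
    case False
    have "(1 - real (\<delta> i)) * real (\<theta> i) = 0" if "i < n" for i
      using False that binary_vectorsD[OF \<delta> that] by auto
    then have "(\<Sum>i<n. (1 - real (\<delta> i)) * real (\<theta> i)) = 0" by (intro sum.neutral) simp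
    then show ?thesis by (simp add: FNP_def)
  qed
  have "(\<Sum>\<theta>\<in>fixed_sum_vectors n k. \<Sum>\<delta>\<in>binary_vectors n. FNP n (\<theta>, \<delta>)
      * (\<Prod>i<n. if \<delta> i = 0 then 1 - rejection_prob 1 (\<theta> i) else rejection_prob 1 (\<theta> i))) = 0"
    by (intro sum.neutral ballI zero)
  moreover have "(1 :: real) \<in> {0..1}" by simp
  ultimately show ?thesis
    unfolding FNR_eq_FNP
    by (subst integral_joint_test_rule[where L = "FNP n", OF _ k abs_FDP_FNP_le(2)])
      (assumption, assumption, assumption, simp only: div_0)
qed

section \<open>Asymptotic upper bounds and mixtures of rules\<close>

lemma test_error_tendsto_0:
  assumes n1: "\<And>n. n1 n \<le> n" and lim: "(\<lambda>n. real (n1 n) / real n) \<longlonglongrightarrow> \<pi>1"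
    and u: "u \<in> {0..1}"
  shows "(\<lambda>n. test_error n (n1 n) u) \<longlonglongrightarrow> 0"
proof -
  define E where "E n = 4 * exp 1 * sqrt (inverse (real n))
      + \<bar>(1 - real (n1 n) / real n) * rejection_prob u 0 - A u\<bar>
      + \<bar>(1 - real (n1 n) / real n) * rejection_prob u 0 + real (n1 n) / real n * rejection_prob u 1 - u\<bar>" for n
  have "E \<longlonglongrightarrow> 4 * exp 1 * sqrt 0 + \<bar>(1 - \<pi>1) * rejection_prob u 0 - A u\<bar>
      + \<bar>(1 - \<pi>1) * rejection_prob u 0 + \<pi>1 * rejection_prob u 1 - u\<bar>"
    unfolding E_def by (intro tendsto_intros lim LIMSEQ_inverse_real_of_nat lim_inverse_n)
  moreover have "(1 - \<pi>1) * rejection_prob u 0 = A u"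
  proof -
    have "1 - \<pi>1 = \<pi>0" using \<pi>_sum by simp
    then show ?thesis using \<pi>0_pos by (simp only: rejection_prob_0) simp
  qed
  moreover have "\<pi>1 * rejection_prob u 1 = u - A u"
    unfolding rejection_prob_1[OF u] using \<pi>1_pos by simp
  ultimately have "E \<longlonglongrightarrow> 0" by simp
  moreover have "\<forall>\<^sub>F n in sequentially. E n = test_error n (n1 n) u"
    using eventually_gt_at_top[of 0]
  proof eventually_elim
    case (elim n)
    have "real (n - n1 n) / n = 1 - real (n1 n) / n"
      using elim n1[of n] by (simp add: of_nat_diff diff_divide_distrib)
    moreover have "(real (n - n1 n) * rejection_prob u 0 + real (n1 n) * rejection_prob u 1) / n
        = real (n - n1 n) / n * rejection_prob u 0 + real (n1 n) / n * rejection_prob u 1"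
      by (simp add: add_divide_distrib)
    ultimately show ?case
      by (simp add: E_def test_error_def real_sqrt_inverse divide_inverse)
  qed
  ultimately show ?thesis by (rule Lim_transform_eventually)
qed

text \<open>A test becomes feasible in two ways: strict slack in the level eventually absorbs its
  error, or \<open>A u = 0\<close> and its false discovery rate is exactly 0, so that even level 0
  is met.\<close>

lemma FNR_opt_eventually_le:
  assumes n1: "\<And>n. n1 n \<le> n" and lim: "(\<lambda>n. real (n1 n) / real n) \<longlonglongrightarrow> \<pi>1"
    and u: "u \<in> {0..1}" and \<beta>: "a u < \<beta> \<or> A u = 0 \<and> 0 \<le> \<beta>" and \<zeta>: "0 < \<zeta>"
  shows "\<forall>\<^sub>F n in sequentially. FNR_opt M f0 f1 n (n1 n) \<beta> \<le> b u + \<zeta>"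
proof -
  note err = test_error_tendsto_0[OF n1 lim u]
  have FDR_le: "\<forall>\<^sub>F n in sequentially. FDR M f0 f1 n (n1 n) (test_rule n u) \<le> \<beta>"
  proof (cases "A u = 0")
    case True
    then have "0 \<le> \<beta>" using \<beta> a_nonneg[OF u] by auto
    then show ?thesis using test_rule_FDR_0[OF u n1 True] by simp
  next
    case False
    then have u': "0 < u" using u A_0 by (cases "u = 0") auto
    have "(\<lambda>n. a u + (test_error n (n1 n) u + inverse (real n)) / u) \<longlonglongrightarrow> a u + (0 + 0) / u"
      using u' by (intro tendsto_intros err lim_inverse_n) simp
    then have "\<forall>\<^sub>F n in sequentially. a u + (test_error n (n1 n) u + inverse (real n)) / u < \<beta>"
      using \<beta> False by (intro order_tendstoD(2)) auto
    then show ?thesis using eventually_gt_at_top[of 0]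
    proof eventually_elim
      case (elim n)
      then show ?case
        using test_rule_rates_le(1)[OF u n1 elim(2) u'] unfolding inverse_eq_divide by linarith
    qed
  qed
  have FNR_le: "\<forall>\<^sub>F n in sequentially. FNR M f0 f1 n (n1 n) (test_rule n u) \<le> b u + \<zeta>"
  proof (cases "u = 1")
    case True
    then show ?thesis using test_rule_FNR_0[OF n1] \<zeta> by simp
  next
    case False
    then have u': "u < 1" using u by simp
    have "(\<lambda>n. b u + (2 * test_error n (n1 n) u + \<bar>real (n1 n) / real n - \<pi>1\<bar> + inverse (real n)) / (1 - u))
        \<longlonglongrightarrow> b u + (2 * 0 + \<bar>\<pi>1 - \<pi>1\<bar> + 0) / (1 - u)"
      using u' by (intro tendsto_intros err lim lim_inverse_n) simp
    then have "\<forall>\<^sub>F n in sequentially. b u + (2 * test_error n (n1 n) u + \<bar>real (n1 n) / real n - \<pi>1\<bar>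
        + inverse (real n)) / (1 - u) < b u + \<zeta>"
      using \<zeta> by (intro order_tendstoD(2)) auto
    then show ?thesis using eventually_gt_at_top[of 0]
    proof eventually_elim
      case (elim n)
      then show ?case
        using test_rule_rates_le(2)[OF u n1 elim(2) u'] unfolding inverse_eq_divide by linarith
    qed
  qed
  show ?thesis
    using FDR_le FNR_le
  proof eventually_elim
    case (elim n)
    show ?case by (rule order_trans[OF FNR_opt_le[OF test_rule[OF u] elim(1) n1] elim(2)])
  qed
qed

text \<open>Both error rates integrate a loss that does not depend on the rule, hence they are
  affine in its weights.\<close>

lemma mixed_rule:
  assumes \<kappa>1: "\<kappa>1 \<in> decision_rules M n" and \<kappa>2: "\<kappa>2 \<in> decision_rules M n"
    and k: "k \<le> n" and t: "0 \<le> t" "t \<le> 1"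
  obtains \<kappa> where "\<kappa> \<in> decision_rules M n"
    "FDR M f0 f1 n k \<kappa> = (1 - t) * FDR M f0 f1 n k \<kappa>1 + t * FDR M f0 f1 n k \<kappa>2"
    "FNR M f0 f1 n k \<kappa> = (1 - t) * FNR M f0 f1 n k \<kappa>1 + t * FNR M f0 f1 n k \<kappa>2"
proof -
  define w where "w \<delta> x = (1 - t) * measure (\<kappa>1 x) {\<delta>} + t * measure (\<kappa>2 x) {\<delta>}" for \<delta> x
  note w1 = is_rule_weightsD[OF is_rule_weights_kernel[OF \<kappa>1]]
    and w2 = is_rule_weightsD[OF is_rule_weights_kernel[OF \<kappa>2]]
  have w: "is_rule_weights M n w"
    unfolding is_rule_weights_def
  proof (intro conjI ballI)
    show "w \<delta> \<in> borel_measurable (PiM {..<n} (\<lambda>_. M))" if "\<delta> \<in> binary_vectors n" for \<delta>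
      unfolding w_def using w1(1)[OF that] w2(1)[OF that] by measurable
    show "0 \<le> w \<delta> x" for \<delta> x using t by (simp add: w_def)
    show "(\<Sum>\<delta>\<in>binary_vectors n. w \<delta> x) = 1" if "x \<in> space (PiM {..<n} (\<lambda>_. M))" for x
      using w1(3)[OF that] w2(3)[OF that] by (simp add: w_def sum.distrib flip: sum_distrib_left)
  qed
  let ?\<kappa> = "kernel_of_weights n w"
  have rule: "?\<kappa> \<in> decision_rules M n" by (rule kernel_of_weights_decision_rule[OF w])
  have lin: "(\<integral>y. L y \<partial>joint_law M f0 f1 n k ?\<kappa>)
      = (1 - t) * (\<integral>y. L y \<partial>joint_law M f0 f1 n k \<kappa>1) + t * (\<integral>y. L y \<partial>joint_law M f0 f1 n k \<kappa>2)"
    if L: "\<And>\<theta> \<delta>. \<theta> \<in> fixed_sum_vectors n k \<Longrightarrow> \<delta> \<in> binary_vectors n \<Longrightarrow> \<bar>L (\<theta>, \<delta>)\<bar> \<le> 1" for L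
  proof -
    let ?I = "\<lambda>\<kappa> \<theta>. \<integral>x. (\<Sum>\<delta>\<in>binary_vectors n. L (\<theta>, \<delta>) * measure (\<kappa> x) {\<delta>}) \<partial>observation_law M f0 f1 n \<theta>"
    have int: "integrable (observation_law M f0 f1 n \<theta>)
        (\<lambda>x. \<Sum>\<delta>\<in>binary_vectors n. L (\<theta>, \<delta>) * measure (\<kappa> x) {\<delta>})"
      if \<kappa>: "\<kappa> \<in> decision_rules M n" for \<kappa> \<theta>
    proof (intro Bochner_Integration.integrable_sum integrable_mult_right)
      fix \<delta> assume \<delta>: "\<delta> \<in> binary_vectors n"
      show "integrable (observation_law M f0 f1 n \<theta>) (\<lambda>x. measure (\<kappa> x) {\<delta>})"
        using is_rule_weightsD(1,4)[OF is_rule_weights_kernel[OF \<kappa>] \<delta>]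
        by (intro finite_measure.integrable_const_bound[where B = 1] prob_space.finite_measure
            prob_space_observation_law) auto
    qed
    have "?I ?\<kappa> \<theta> = (1 - t) * ?I \<kappa>1 \<theta> + t * ?I \<kappa>2 \<theta>" for \<theta>
    proof -
      have "?I ?\<kappa> \<theta> = (\<integral>x. (1 - t) * (\<Sum>\<delta>\<in>binary_vectors n. L (\<theta>, \<delta>) * measure (\<kappa>1 x) {\<delta>})
          + t * (\<Sum>\<delta>\<in>binary_vectors n. L (\<theta>, \<delta>) * measure (\<kappa>2 x) {\<delta>}) \<partial>observation_law M f0 f1 n \<theta>)"
      proof (rule Bochner_Integration.integral_cong[OF refl])
        fix x assume "x \<in> space (observation_law M f0 f1 n \<theta>)"
        then have x: "x \<in> space (PiM {..<n} (\<lambda>_. M))" by simp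
        have "(\<Sum>\<delta>\<in>binary_vectors n. L (\<theta>, \<delta>) * measure (?\<kappa> x) {\<delta>})
            = (\<Sum>\<delta>\<in>binary_vectors n. (1 - t) * (L (\<theta>, \<delta>) * measure (\<kappa>1 x) {\<delta>})
                + t * (L (\<theta>, \<delta>) * measure (\<kappa>2 x) {\<delta>}))"
          by (intro sum.cong refl)
            (simp add: measure_kernel_of_weights[OF w x] w_def algebra_simps)
        then show "(\<Sum>\<delta>\<in>binary_vectors n. L (\<theta>, \<delta>) * measure (?\<kappa> x) {\<delta>})
            = (1 - t) * (\<Sum>\<delta>\<in>binary_vectors n. L (\<theta>, \<delta>) * measure (\<kappa>1 x) {\<delta>})
              + t * (\<Sum>\<delta>\<in>binary_vectors n. L (\<theta>, \<delta>) * measure (\<kappa>2 x) {\<delta>})"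
          by (simp only: sum.distrib sum_distrib_left)
      qed
      also have "\<dots> = (1 - t) * ?I \<kappa>1 \<theta> + t * ?I \<kappa>2 \<theta>"
        using int[OF \<kappa>1] int[OF \<kappa>2]
        by (subst Bochner_Integration.integral_add) (auto intro!: integrable_mult_right)
      finally show ?thesis .
    qed
    then have "(\<Sum>\<theta>\<in>fixed_sum_vectors n k. ?I ?\<kappa> \<theta>)
        = (1 - t) * (\<Sum>\<theta>\<in>fixed_sum_vectors n k. ?I \<kappa>1 \<theta>) + t * (\<Sum>\<theta>\<in>fixed_sum_vectors n k. ?I \<kappa>2 \<theta>)"
      by (simp only: sum.distrib sum_distrib_left)
    then show ?thesis
      using joint_law_integral_support(2)[where L = L, OF rule k L]
        joint_law_integral_support(2)[where L = L, OF \<kappa>1 k L]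
        joint_law_integral_support(2)[where L = L, OF \<kappa>2 k L]
      by (simp only: add_divide_distrib times_divide_eq_right)
  qed
  show thesis
  proof (rule that[OF rule])
    show "FDR M f0 f1 n k ?\<kappa> = (1 - t) * FDR M f0 f1 n k \<kappa>1 + t * FDR M f0 f1 n k \<kappa>2"
      unfolding FDR_eq_FDP by (intro lin abs_FDP_FNP_le)
    show "FNR M f0 f1 n k ?\<kappa> = (1 - t) * FNR M f0 f1 n k \<kappa>1 + t * FNR M f0 f1 n k \<kappa>2"
      unfolding FNR_eq_FNP by (intro lin abs_FDP_FNP_le)
  qed
qed

lemma FNR_opt_convex:
  assumes k: "k \<le> n" and t: "0 < t" "t < 1" and \<alpha>: "0 \<le> \<alpha>1" "0 \<le> \<alpha>2"
  shows "FNR_opt M f0 f1 n k ((1 - t) * \<alpha>1 + t * \<alpha>2)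
    \<le> (1 - t) * FNR_opt M f0 f1 n k \<alpha>1 + t * FNR_opt M f0 f1 n k \<alpha>2"
proof -
  let ?opt = "FNR_opt M f0 f1 n k" and ?\<alpha> = "(1 - t) * \<alpha>1 + t * \<alpha>2"
  have step: "?opt ?\<alpha> \<le> (1 - t) * FNR M f0 f1 n k \<kappa>1 + t * FNR M f0 f1 n k \<kappa>2"
    if \<kappa>1: "\<kappa>1 \<in> decision_rules M n" "FDR M f0 f1 n k \<kappa>1 \<le> \<alpha>1"
      and \<kappa>2: "\<kappa>2 \<in> decision_rules M n" "FDR M f0 f1 n k \<kappa>2 \<le> \<alpha>2" for \<kappa>1 \<kappa>2
  proof -
    obtain \<kappa> where \<kappa>: "\<kappa> \<in> decision_rules M n"
      "FDR M f0 f1 n k \<kappa> = (1 - t) * FDR M f0 f1 n k \<kappa>1 + t * FDR M f0 f1 n k \<kappa>2"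
      "FNR M f0 f1 n k \<kappa> = (1 - t) * FNR M f0 f1 n k \<kappa>1 + t * FNR M f0 f1 n k \<kappa>2"
      using mixed_rule[OF \<kappa>1(1) \<kappa>2(1) k, of t] t by auto
    have "FDR M f0 f1 n k \<kappa> \<le> ?\<alpha>"
      unfolding \<kappa>(2) using t \<kappa>1 \<kappa>2 by (intro add_mono mult_left_mono) auto
    from FNR_opt_le[OF \<kappa>(1) this k] show ?thesis by (simp only: \<kappa>(3))
  qed
  \<comment> \<open>As in the convexity of \<open>bss\<close>, the two infima are reached one after
    the other, each time by solving for the rate of a single rule.\<close>
  have "(?opt ?\<alpha> - t * FNR M f0 f1 n k \<kappa>2) / (1 - t) \<le> ?opt \<alpha>1"
    if "\<kappa>2 \<in> decision_rules M n" "FDR M f0 f1 n k \<kappa>2 \<le> \<alpha>2" for \<kappa>2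
    using step[OF _ _ that] t \<alpha> k
    by (intro FNR_opt_greatest) (auto simp: pos_divide_le_eq algebra_simps)
  then have "(?opt ?\<alpha> - (1 - t) * ?opt \<alpha>1) / t \<le> ?opt \<alpha>2"
    using t \<alpha> k by (intro FNR_opt_greatest) (auto simp: pos_divide_le_eq algebra_simps)
  then show ?thesis using t by (simp add: pos_divide_le_eq algebra_simps)
qed

end

subsection \<open>The limit\<close>

context two_groups
begin

lemma FNR_opt_le_1:
  assumes "0 \<le> \<alpha>" "k \<le> n"
  shows "FNR_opt M f0 f1 n k \<alpha> \<le> 1"
proof -
  let ?\<kappa> = "no_discoveries n"
  note rule = no_discoveries[OF assms(2)]
  interpret J: prob_space "joint_law M f0 f1 n k ?\<kappa>" by (rule prob_space_joint_law[OF rule(1)])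
  have "FNR M f0 f1 n k ?\<kappa> \<le> (\<integral>y. 1 \<partial>joint_law M f0 f1 n k ?\<kappa>)"
    unfolding FNR_eq_FNP
  proof (rule integral_mono_AE)
    show "AE y in joint_law M f0 f1 n k ?\<kappa>. FNP n y \<le> 1"
      using AE_joint_law[OF rule(1) assms(2)] by eventually_elim (auto simp: FNP_bounds)
  qed (use integrable_FDP_FNP[OF rule(1) assms(2)] in auto)
  then have "FNR M f0 f1 n k ?\<kappa> \<le> 1" by (simp add: J.prob_space)
  moreover have "FNR_opt M f0 f1 n k \<alpha> \<le> FNR M f0 f1 n k ?\<kappa>"
    using rule assms by (intro FNR_opt_le) auto
  ultimately show ?thesis by simp
qed

lemma FNR_opt_eventually_le_bss:
  assumes n1: "\<And>n. n1 n \<le> n" and lim: "(\<lambda>n. real (n1 n) / real n) \<longlonglongrightarrow> \<pi>1"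
    and \<alpha>: "0 < \<alpha>" "\<alpha> < 1" and \<zeta>: "0 < \<zeta>"
  shows "\<forall>\<^sub>F n in sequentially. FNR_opt M f0 f1 n (n1 n) \<alpha> \<le> bss \<alpha> + \<zeta>"
proof -
  define Y where "Y \<beta> = {y. \<forall>\<^sub>F n in sequentially. FNR_opt M f0 f1 n (n1 n) \<beta> \<le> y}" for \<beta>
  define C where "C \<beta> = Inf (Y \<beta>)" for \<beta>
    \<comment> \<open>the limit superior of the optimal rates, hence convex, so that the tests \<open>s u\<close> suffice to bound it\<close>
  have Y_nonneg: "0 \<le> y" if "y \<in> Y \<beta>" "0 \<le> \<beta>" for y \<beta>
  proof -
    have "\<forall>\<^sub>F n in sequentially. FNR_opt M f0 f1 n (n1 n) \<beta> \<le> y" using that(1) by (simp add: Y_def)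
    then obtain n where "FNR_opt M f0 f1 n (n1 n) \<beta> \<le> y"
      by (meson eventually_sequentially order_refl)
    then show ?thesis using FNR_opt_nonneg[OF that(2) n1, of n] by simp
  qed
  have C_le: "C \<beta> \<le> y" if "y \<in> Y \<beta>" "0 \<le> \<beta>" for y \<beta>
    unfolding C_def using that Y_nonneg by (intro cInf_lower bdd_belowI[of _ 0]) auto
  have Y_nonempty: "1 \<in> Y \<beta>" if "0 \<le> \<beta>" for \<beta>
    using FNR_opt_le_1[OF that n1] by (simp add: Y_def)
  \<comment> \<open>\<open>Y \<beta>\<close> need not contain its infimum: a limit superior is an
    eventual upper bound only up to an error.\<close>
  have C_approx: "\<exists>y\<in>Y \<beta>. y < C \<beta> + e" if "0 \<le> \<beta>" "0 < e" for \<beta> e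
  proof (rule ccontr)
    assume "\<not> ?thesis"
    then have "C \<beta> + e \<le> Inf (Y \<beta>)"
      using Y_nonempty[OF that(1)] by (intro cInf_greatest) (auto simp: not_less)
    then show False using that(2) by (simp add: C_def)
  qed
  have convex: "convex_on {0..1} C"
  proof (rule convex_onI)
    fix t x y :: real
    assume t: "0 < t" "t < 1" and xy: "x \<in> {0..1}" "y \<in> {0..1}"
    show "C ((1 - t) *\<^sub>R x + t *\<^sub>R y) \<le> (1 - t) * C x + t * C y"
    proof (rule field_le_epsilon)
      fix e :: real assume e: "0 < e"
      obtain x' y' where x': "x' \<in> Y x" "x' < C x + e" and y': "y' \<in> Y y" "y' < C y + e"
        using C_approx[of x e] C_approx[of y e] xy e by auto
      have "\<forall>\<^sub>F n in sequentially. FNR_opt M f0 f1 n (n1 n) x \<le> x'"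
        "\<forall>\<^sub>F n in sequentially. FNR_opt M f0 f1 n (n1 n) y \<le> y'"
        using x' y' by (simp_all add: Y_def)
      then have "\<forall>\<^sub>F n in sequentially.
          FNR_opt M f0 f1 n (n1 n) ((1 - t) * x + t * y) \<le> (1 - t) * x' + t * y'"
      proof eventually_elim
        case (elim n)
        have "FNR_opt M f0 f1 n (n1 n) ((1 - t) * x + t * y)
            \<le> (1 - t) * FNR_opt M f0 f1 n (n1 n) x + t * FNR_opt M f0 f1 n (n1 n) y"
          using t xy by (intro FNR_opt_convex n1) auto
        also have "\<dots> \<le> (1 - t) * x' + t * y'"
          using elim t by (intro add_mono mult_left_mono) auto
        finally show ?case .
      qed
      then have "(1 - t) * x' + t * y' \<in> Y ((1 - t) * x + t * y)" by (simp add: Y_def)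
      then have "C ((1 - t) * x + t * y) \<le> (1 - t) * x' + t * y'"
        using t xy by (intro C_le) auto
      also have "\<dots> \<le> (1 - t) * (C x + e) + t * (C y + e)"
        using x'(2) y'(2) t by (intro add_mono mult_left_mono) auto
      also have "\<dots> = (1 - t) * C x + t * C y + e" by (simp add: algebra_simps)
      finally show "C ((1 - t) *\<^sub>R x + t *\<^sub>R y) \<le> (1 - t) * C x + t * C y + e" by simp
    qed
  qed simp
  have "C \<alpha> \<le> bss \<alpha>"
  proof (rule convex_le_bss[OF convex \<alpha>])
    fix u \<beta> assume u: "u \<in> {0..1}" and \<beta>: "a u < \<beta>" "\<beta> \<le> 1"
    have "0 \<le> \<beta>" using a_nonneg[OF u] \<beta> by simp
    show "C \<beta> \<le> b u"
    proof (rule field_le_epsilon)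
      fix e :: real assume "0 < e"
      then show "C \<beta> \<le> b u + e"
        using FNR_opt_eventually_le[OF n1 lim u disjI1[OF \<beta>(1)], of e] \<open>0 \<le> \<beta>\<close>
        by (intro C_le) (simp_all add: Y_def)
    qed
  qed
  moreover obtain y where y: "y \<in> Y \<alpha>" "y < C \<alpha> + \<zeta>"
    using C_approx[of \<alpha> \<zeta>] \<alpha> \<zeta> by auto
  ultimately have "y \<le> bss \<alpha> + \<zeta>" by simp
  moreover have "\<forall>\<^sub>F n in sequentially. FNR_opt M f0 f1 n (n1 n) \<alpha> \<le> y"
    using y(1) by (simp add: Y_def)
  ultimately show ?thesis by (auto elim: eventually_mono)
qed

theorem FNR_opt_tendsto_bss:
  assumes n1: "\<And>n. n1 n \<le> n" and lim: "(\<lambda>n. real (n1 n) / real n) \<longlonglongrightarrow> \<pi>1"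
    and \<alpha>: "\<alpha> \<in> {0..1}"
  shows "(\<lambda>n. FNR_opt M f0 f1 n (n1 n) \<alpha>) \<longlonglongrightarrow> bss \<alpha>"
proof -
  have upper: "\<forall>\<^sub>F n in sequentially. FNR_opt M f0 f1 n (n1 n) \<alpha> \<le> bss \<alpha> + \<zeta>" if \<zeta>: "0 < \<zeta>" for \<zeta>
  proof -
    consider "\<alpha> = 0" | "\<alpha> = 1" | "0 < \<alpha>" "\<alpha> < 1" using \<alpha> by fastforce
    then show ?thesis
    proof cases
      \<comment> \<open>At both end points a single test already attains \<open>bss\<close>: size
        \<open>u0\<close> with no false discovery at level 0, size 1 with nothing missed at level
        1.\<close>
      case 1
      then show ?thesis
        using FNR_opt_eventually_le[OF n1 lim _ _ \<zeta>, of u0 0] u0_bounds by (simp add: A_u0 bss_0)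
    next
      case 2
      then show ?thesis
        using FNR_opt_eventually_le[OF n1 lim _ _ \<zeta>, of 1 1] \<pi>_less_1 by (simp add: a_1 bss_1)
    next
      case 3
      then show ?thesis by (rule FNR_opt_eventually_le_bss[OF n1 lim _ _ \<zeta>])
    qed
  qed
  have lower: "\<forall>\<^sub>F n in sequentially. bss \<alpha> - \<zeta> \<le> FNR_opt M f0 f1 n (n1 n) \<alpha>" if \<zeta>: "0 < \<zeta>" for \<zeta>
  proof (cases "\<alpha> = 1")
    case True
    \<comment> \<open>There is no room to the right of level 1, but \<open>bss 1 = 0\<close> and
      rates are nonnegative.\<close>
    have "bss \<alpha> - \<zeta> \<le> FNR_opt M f0 f1 n (n1 n) \<alpha>" for n
      using FNR_opt_nonneg[of \<alpha> "n1 n" n] n1[of n] \<zeta> True by (simp add: bss_1)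
    then show ?thesis by simp
  next
    case False
    then show ?thesis using \<alpha> by (intro FNR_opt_eventually_ge n1 lim \<zeta>) auto
  qed
  show ?thesis
  proof (rule tendstoI)
    fix e :: real assume "0 < e"
    then have "0 < e / 2" by simp
    from upper[OF this] lower[OF this]
    show "\<forall>\<^sub>F n in sequentially. dist (FNR_opt M f0 f1 n (n1 n) \<alpha>) (bss \<alpha>) < e"
    proof eventually_elim
      case (elim n)
      then show ?case using \<open>0 < e\<close> by (simp add: dist_real_def)
    qed
  qed
qed

end

theorem theorem19:
  fixes M :: "'a measure"
    and f0 f1 :: "'a \<Rightarrow> real"
    and \<pi>0 \<pi>1 :: real
    and p :: "real \<Rightarrow> real"
    and n1 :: "nat \<Rightarrow> nat"
  assumes "0 < \<pi>0" "\<pi>0 < 1" "0 < \<pi>1" "\<pi>1 < 1" "\<pi>0 + \<pi>1 = 1"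
    and "is_prob_density M f0" "is_prob_density M f1"
    and "is_tie_breaker M f0 f1 \<pi>0 \<pi>1 p"
    and "\<And>n. n1 n \<le> n"
    and "(\<lambda>n. real (n1 n) / real n) \<longlonglongrightarrow> \<pi>1"
  shows "(\<forall>\<alpha>\<in>{0..1}. (\<lambda>n. FNR_opt M f0 f1 n (n1 n) \<alpha>)
            \<longlonglongrightarrow> b_star_star M f0 f1 \<pi>0 \<pi>1 p \<alpha>)
       \<and> (\<forall>\<alpha>\<in>{0..1}. b_star_star M f0 f1 \<pi>0 \<pi>1 p \<alpha>
            = greatest_convex_minorant (b_star M f0 f1 \<pi>0 \<pi>1 p) \<alpha>)"
proof -
  interpret two_groups M f0 f1 \<pi>0 \<pi>1 p
    using assms by unfold_locales
  show ?thesis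
    using FNR_opt_tendsto_bss[OF assms(9,10)] bss_eq_minorant by blast
qed

end
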